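(* Let $B$ be a closed braid of $m$ components. Then, for any integer $N\ge1$, the $\mathfrak{sl}(N)$ Khovanov-Rozansky homology $H_N(B)$, regarded as a module over $R_B=\mathbb{Q}[X_1,\dots,X_m]$, has projective dimension $\mathrm{pd}_{R_B}H_N(B)=m$.
   Context: $H_N(B)$ is the $\mathfrak{sl}(N)$ homology of Khovanov and Rozansky over $\mathbb{Q}$, which can be described as follows. Let $B$ be a closed braid diagram with components $K_1,\dots,K_m$. An edge is an arc of the diagram between consecutive crossings (a component without crossings counts as one edge). Number the edges $1,\dots,M$ so that edge $l$ lies on $K_l$ for $1\le l\le m$, assign to edge $l$ a variable $X_l$ of degree $2$, and let $S=\mathbb{Q}[X_1,\dots,X_M]$. For $f,g\in S$ let $\{f,g\}$ denote the rank-two Koszul matrix factorization $S\xrightarrow{\,g\,}S\xrightarrow{\,f\,}S$ of potential $fg$. For a crossing $c$ with outgoing edges $k$ (left), $l$ (right) and incoming edges $i$ (left), $j$ (right), put $\rho=X_k+X_l-X_i-X_j$ and $W_c=X_k^{N+1}+X_l^{N+1}-X_i^{N+1}-X_j^{N+1}$, and choose homogeneous $A,F\in S$ with $W_c=A\rho+F\,(X_k-X_i)(X_j-X_k)$. Let $$\Gamma_0(c)=\{A,\rho\}\otimes_S\{F(X_j-X_k),\,X_k-X_i\},\qquad \Gamma_1(c)=\{A,\rho\}\otimes_S\{F,\,(X_k-X_i)(X_j-X_k)\},$$ both of potential $W_c$. There are morphisms $\chi_1:\Gamma_1(c)\to\Gamma_0(c)$ (identity on the first factor; on the second factor, multiplication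 by $X_j-X_k$ on the left copy of $S$ and by $1$ on the right copy) and $\chi_0:\Gamma_0(c)\to\Gamma_1(c)$ (identity on the first factor; on the second factor, multiplication by $1$ on the left copy and by $X_j-X_k$ on the right copy). To a positive crossing assign the two-term complex $\Gamma_1(c)\xrightarrow{\chi_1}\Gamma_0(c)$, and to a negative crossing the two-term complex $\Gamma_0(c)\xrightarrow{\chi_0}\Gamma_1(c)$, with $\Gamma_0(c)$ in homological degree $0$ in both cases. To a component without crossings with variable $X$ assign $\{(N+1)X^N,0\}$. The tensor product over $S$ of all these is a complex, with differential $d_v$, of matrix factorizations of potential $0$ with differential $d$, and $H_N(B)=H(H(\,\cdot\,,d),d_v)$ (up to overall grading shifts, which do not affect the projective dimension). $H_N(B)$ is finite dimensional over $\mathbb{Q}$, is graded so that each $X_l$ acts with degree $2$, and is a nonzero link invariant. Variables of edges on the same component of $B$ act identically on $H_N(B)$ (Rasmussen), so $H_N(B)$ is a graded module over $R_B=\mathbb{Q}[X_1,\dots,X_m]$, with one variable of degree $2$ for each component.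
   Formalization: The equation for A and F at a crossing is imposed with X_k, X_l, X_i, X_j as four independent variables and then specialized to S, since when edges coincide the equation in S may allow A=F=0, for which the claim fails. *)

theory Defs
  imports
    "HOL-Algebra.Module"
    "HOL-Algebra.AbelCoset"
    "HOL-Library.Poly_Mapping"
    "HOL-Library.Extended_Nat"
begin

section \<open>Polynomial rings over the rationals\<close>

text \<open>A monomial is a finitely supported exponent vector; a polynomial is a finitely supported
  family of rational coefficients indexed by monomials.\<close>

type_synonym 'v mpoly = "('v \<Rightarrow>\<^sub>0 nat) \<Rightarrow>\<^sub>0 rat"

definition Var :: "'v \<Rightarrow> 'v mpoly" where
  "Var v = Poly_Mapping.single (Poly_Mapping.single v 1) 1"

definition Const :: "rat \<Rightarrow> 'v mpoly" where
  "Const c = Poly_Mapping.single 0 c"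

definition indets :: "'v mpoly \<Rightarrow> 'v set" where
  "indets p = (\<Union>u\<in>Poly_Mapping.keys p. Poly_Mapping.keys u)"

text \<open>Every variable has degree 2.\<close>

definition monom_deg :: "('v \<Rightarrow>\<^sub>0 nat) \<Rightarrow> nat" where
  "monom_deg u = (\<Sum>v\<in>Poly_Mapping.keys u. 2 * Poly_Mapping.lookup u v)"

definition homogeneous :: "'v mpoly \<Rightarrow> bool" where
  "homogeneous p \<longleftrightarrow> (\<exists>d. \<forall>u\<in>Poly_Mapping.keys p. monom_deg u = d)"

definition poly_subst :: "('v \<Rightarrow> 'w mpoly) \<Rightarrow> 'v mpoly \<Rightarrow> 'w mpoly" where
  "poly_subst \<sigma> p = (\<Sum>u\<in>Poly_Mapping.keys p.
     Const (Poly_Mapping.lookup p u) *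
     (\<Prod>v\<in>Poly_Mapping.keys u. \<sigma> v ^ Poly_Mapping.lookup u v))"

definition poly_ring :: "'v set \<Rightarrow> 'v mpoly ring" where
  "poly_ring V = \<lparr>carrier = {p. indets p \<subseteq> V}, mult = (*), one = 1, zero = 0, add = (+)\<rparr>"


section \<open>Projective dimension\<close>

definition linear_maps :: "('r, 'c) ring_scheme \<Rightarrow> ('r, 'm, 'd) module_scheme \<Rightarrow>
    ('r, 'n, 'e) module_scheme \<Rightarrow> ('m \<Rightarrow> 'n) set" where
  "linear_maps R M M' = {h. h \<in> carrier M \<rightarrow> carrier M' \<and>
     (\<forall>x\<in>carrier M. \<forall>y\<in>carrier M. h (x \<oplus>\<^bsub>M\<^esub> y) = h x \<oplus>\<^bsub>M'\<^esub> h y) \<and>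
     (\<forall>r\<in>carrier R. \<forall>x\<in>carrier M. h (r \<odot>\<^bsub>M\<^esub> x) = r \<odot>\<^bsub>M'\<^esub> h x)}"

text \<open>In a module record, the fields \<open>mult\<close> and \<open>one\<close> inherited from rings carry no information.\<close>

definition free_module :: "('r, 'c) ring_scheme \<Rightarrow> 'i set \<Rightarrow> ('r, 'i \<Rightarrow> 'r) module" where
  "free_module R I =
    \<lparr>carrier = {f. (\<forall>i\<in>I. f i \<in> carrier R) \<and> (\<forall>i. i \<notin> I \<longrightarrow> f i = \<zero>\<^bsub>R\<^esub>) \<and>
                   finite {i. f i \<noteq> \<zero>\<^bsub>R\<^esub>}},
     mult = undefined, one = undefined,
     zero = (\<lambda>_. \<zero>\<^bsub>R\<^esub>), add = (\<lambda>f g i. f i \<oplus>\<^bsub>R\<^esub> g i),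
     smult = (\<lambda>r f i. r \<otimes>\<^bsub>R\<^esub> f i)\<rparr>"

text \<open>Projective means: direct summand of a free module. Index sets inside the element type of the
  module suffice, because a projective module is a direct summand of the free module on its own
  underlying set.\<close>

definition projective :: "('r, 'c) ring_scheme \<Rightarrow> ('r, 'm, 'd) module_scheme \<Rightarrow> bool" where
  "projective R P \<longleftrightarrow> Module.module R P \<and>
     (\<exists>(I :: 'm set) s r. s \<in> linear_maps R P (free_module R I) \<and>
        r \<in> linear_maps R (free_module R I) P \<and> (\<forall>x\<in>carrier P. r (s x) = x))"

text \<open>The modules of the resolution have elements in the type \<open>nat \<times> 'm \<Rightarrow> 'r\<close>. This is no
  restriction: every syzygy of the standard free resolution has cardinality at most the maximum of
  the cardinalities of \<open>R\<close>, \<open>M\<close> and the natural numbers, hence has an isomorphic copy in this type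
  (if \<open>R\<close> is nontrivial).\<close>

definition has_projective_resolution ::
    "('r, 'c) ring_scheme \<Rightarrow> ('r, 'm, 'd) module_scheme \<Rightarrow> nat \<Rightarrow> bool" where
  "has_projective_resolution R M k \<longleftrightarrow>
    (\<exists>(P :: nat \<Rightarrow> ('r, nat \<times> 'm \<Rightarrow> 'r) module) \<delta> \<epsilon>.
       (\<forall>i. projective R (P i)) \<and>
       (\<forall>i>k. carrier (P i) = {\<zero>\<^bsub>P i\<^esub>}) \<and>
       (\<forall>i. \<delta> i \<in> linear_maps R (P (Suc i)) (P i)) \<and>
       \<epsilon> \<in> linear_maps R (P 0) M \<and>
       \<epsilon> ` carrier (P 0) = carrier M \<and>
       {x \<in> carrier (P 0). \<epsilon> x = \<zero>\<^bsub>M\<^esub>} = \<delta> 0 ` carrier (P 1) \<and>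
       (\<forall>i. {x \<in> carrier (P (Suc i)). \<delta> i x = \<zero>\<^bsub>P i\<^esub>} = \<delta> (Suc i) ` carrier (P (Suc (Suc i)))))"

definition projective_dimension ::
    "('r, 'c) ring_scheme \<Rightarrow> ('r, 'm, 'd) module_scheme \<Rightarrow> enat" where
  "projective_dimension R M = Inf {enat k | k. has_projective_resolution R M k}"


section \<open>Homology of an endomorphism of square zero\<close>

definition homology :: "('r, 'm) module \<Rightarrow> ('m \<Rightarrow> 'm) \<Rightarrow> ('r, 'm set) module" where
  "homology M f =
    \<lparr>carrier = (\<lambda>x. (f ` carrier M) +>\<^bsub>M\<^esub> x) ` {x \<in> carrier M. f x = \<zero>\<^bsub>M\<^esub>},
     mult = undefined, one = undefined,
     zero = f ` carrier M, add = (\<lambda>X Y. X <+>\<^bsub>M\<^esub> Y),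
     smult = (\<lambda>r X. \<Union>x\<in>X. (f ` carrier M) +>\<^bsub>M\<^esub> (r \<odot>\<^bsub>M\<^esub> x))\<rparr>"

text \<open>The map induced on \<open>homology M f\<close> by an endomorphism \<open>g\<close> commuting with \<open>f\<close>.\<close>

definition induced_map :: "('r, 'm) module \<Rightarrow> ('m \<Rightarrow> 'm) \<Rightarrow> ('m \<Rightarrow> 'm) \<Rightarrow> 'm set \<Rightarrow> 'm set" where
  "induced_map M f g X = (\<Union>x\<in>X. (f ` carrier M) +>\<^bsub>M\<^esub> g x)"


section \<open>Complexes of free matrix factorizations\<close>

text \<open>A complex of matrix factorizations with a fixed finite homogeneous basis: \<open>par\<close> is the degree
  modulo 2 of a basis element within its matrix factorization and \<open>hdeg\<close> its homological degree.
  The entry \<open>dmat C b b'\<close> (resp. \<open>vmat C b b'\<close>) is the coefficient of \<open>b'\<close> in the image of \<open>b\<close>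
  under the differential of the matrix factorization (resp. of the complex).\<close>

record ('b, 's) mf_complex =
  basis :: "'b set"
  par :: "'b \<Rightarrow> int"
  hdeg :: "'b \<Rightarrow> int"
  dmat :: "'b \<Rightarrow> 'b \<Rightarrow> 's"
  vmat :: "'b \<Rightarrow> 'b \<Rightarrow> 's"

definition psign :: "int \<Rightarrow> 's::comm_ring_1" where
  "psign k = (if even k then 1 else -1)"

text \<open>The tensor product \<open>C\<^sub>1 \<otimes> \<dots> \<otimes> C\<^sub>n\<close> over the base ring, on the basis of pure tensors of basis
  elements, with the Koszul sign rule in each of the two gradings: \<open>d\<close> acts on the second factor of
  \<open>x \<otimes> y\<close> with sign \<open>(-1)^par x\<close>, and \<open>d\<^sub>v\<close> with sign \<open>(-1)^hdeg x\<close>. Thus \<open>d\<close> and \<open>d\<^sub>v\<close> commute.\<close>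

primrec tensor :: "('b, 's::comm_ring_1) mf_complex list \<Rightarrow> ('b list, 's) mf_complex" where
  "tensor [] = \<lparr>basis = {[]}, par = (\<lambda>_. 0), hdeg = (\<lambda>_. 0), dmat = (\<lambda>_ _. 0), vmat = (\<lambda>_ _. 0)\<rparr>"
| "tensor (C # Cs) =
    \<lparr>basis = {b # bs | b bs. b \<in> basis C \<and> bs \<in> basis (tensor Cs)},
     par = (\<lambda>x. par C (hd x) + par (tensor Cs) (tl x)),
     hdeg = (\<lambda>x. hdeg C (hd x) + hdeg (tensor Cs) (tl x)),
     dmat = (\<lambda>x y.
       (if tl x = tl y then dmat C (hd x) (hd y) else 0) +
       (if hd x = hd y then psign (par C (hd x)) * dmat (tensor Cs) (tl x) (tl y) else 0)),
     vmat = (\<lambda>x y.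
       (if tl x = tl y then vmat C (hd x) (hd y) else 0) +
       (if hd x = hd y then psign (hdeg C (hd x)) * vmat (tensor Cs) (tl x) (tl y) else 0))\<rparr>"

datatype side = LeftCopy | RightCopy

text \<open>\<open>koszul f g\<close> is the factorization with \<open>g\<close> from the left to the right copy of the base ring
  and \<open>f\<close> back; it is placed in homological degree 0.\<close>

definition koszul :: "'s::comm_ring_1 \<Rightarrow> 's \<Rightarrow> (side, 's) mf_complex" where
  "koszul f g =
    \<lparr>basis = {LeftCopy, RightCopy},
     par = (\<lambda>b. case b of LeftCopy \<Rightarrow> 0 | RightCopy \<Rightarrow> 1),
     hdeg = (\<lambda>_. 0),
     dmat = (\<lambda>b b'. case (b, b') of (LeftCopy, RightCopy) \<Rightarrow> g | (RightCopy, LeftCopy) \<Rightarrow> f | _ \<Rightarrow> 0),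
     vmat = (\<lambda>_ _. 0)\<rparr>"

text \<open>\<open>two_term h C D \<chi>\<close> is the complex of the two matrix factorizations \<open>C\<close>, \<open>D\<close> (whose own
  \<open>hdeg\<close>, \<open>vmat\<close> are ignored) with \<open>\<chi>\<close> from \<open>C\<close>, in homological degree \<open>h\<close>, to \<open>D\<close>, in
  degree \<open>h + 1\<close>; \<open>one_term C\<close> is \<open>C\<close> alone in homological degree 0.\<close>

definition two_term :: "int \<Rightarrow> ('b, 's::comm_ring_1) mf_complex \<Rightarrow> ('b, 's) mf_complex \<Rightarrow>
    ('b \<Rightarrow> 'b \<Rightarrow> 's) \<Rightarrow> ('b + 'b, 's) mf_complex" where
  "two_term h C D \<chi> =
    \<lparr>basis = Inl ` basis C \<union> Inr ` basis D,
     par = (\<lambda>z. case z of Inl b \<Rightarrow> par C b | Inr b \<Rightarrow> par D b),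
     hdeg = (\<lambda>z. case z of Inl b \<Rightarrow> h | Inr b \<Rightarrow> h + 1),
     dmat = (\<lambda>z z'. case (z, z') of (Inl b, Inl b') \<Rightarrow> dmat C b b'
                                  | (Inr b, Inr b') \<Rightarrow> dmat D b b' | _ \<Rightarrow> 0),
     vmat = (\<lambda>z z'. case (z, z') of (Inl b, Inr b') \<Rightarrow> \<chi> b b' | _ \<Rightarrow> 0)\<rparr>"

definition one_term :: "('b, 's::comm_ring_1) mf_complex \<Rightarrow> ('b + 'b, 's) mf_complex" where
  "one_term C =
    \<lparr>basis = Inl ` basis C,
     par = (\<lambda>z. case z of Inl b \<Rightarrow> par C b | Inr b \<Rightarrow> 0),
     hdeg = (\<lambda>_. 0),
     dmat = (\<lambda>z z'. case (z, z') of (Inl b, Inl b') \<Rightarrow> dmat C b b' | _ \<Rightarrow> 0),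
     vmat = (\<lambda>_ _. 0)\<rparr>"

text \<open>The free module over \<open>poly_ring V\<close> spanned by the basis, as coefficient vectors.\<close>

definition total_module :: "'v set \<Rightarrow> ('b, 'v mpoly) mf_complex \<Rightarrow>
    ('v mpoly, 'b \<Rightarrow> 'v mpoly) module" where
  "total_module V C = free_module (poly_ring V) (basis C)"

definition apply_matrix :: "'b set \<Rightarrow> ('b \<Rightarrow> 'b \<Rightarrow> 's::comm_ring_1) \<Rightarrow> ('b \<Rightarrow> 's) \<Rightarrow> 'b \<Rightarrow> 's" where
  "apply_matrix B D x = (\<lambda>b'. if b' \<in> B then \<Sum>b\<in>B. D b b' * x b else 0)"

text \<open>\<open>H(H(C, d), d\<^sub>v)\<close>\<close>

definition double_homology :: "'v set \<Rightarrow> ('b, 'v mpoly) mf_complex \<Rightarrow>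
    ('v mpoly, ('b \<Rightarrow> 'v mpoly) set set) module" where
  "double_homology V C =
    (let M = total_module V C;
         d = apply_matrix (basis C) (dmat C);
         d\<^sub>v = apply_matrix (basis C) (vmat C)
     in homology (homology M d) (induced_map M d d\<^sub>v))"


section \<open>Closed braid diagrams\<close>

text \<open>A braid diagram on \<open>n\<close> upward oriented strands, in positions \<open>1, \<dots>, n\<close> from left to right,
  is the list of its crossings from bottom to top: \<open>(i, s)\<close> is a crossing of the strands in
  positions \<open>i\<close> and \<open>i + 1\<close>, positive iff \<open>s\<close>. The closed braid diagram is its closure.\<close>

type_synonym braid = "(nat \<times> bool) list"

definition is_braid :: "nat \<Rightarrow> braid \<Rightarrow> bool" where
  "is_braid n w \<longleftrightarrow> 1 \<le> n \<and> (\<forall>(i, s)\<in>set w. 1 \<le> i \<and> i < n)"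

text \<open>The point \<open>(p, t)\<close> lies on the strand in position \<open>p\<close>, above the first \<open>t\<close> crossings and
  below the others.\<close>

type_synonym point = "nat \<times> nat"

definition points :: "nat \<Rightarrow> braid \<Rightarrow> point set" where
  "points n w = {1..n} \<times> {0..length w}"

definition touches :: "braid \<Rightarrow> nat \<Rightarrow> nat \<Rightarrow> bool" where
  "touches w t p \<longleftrightarrow> p = fst (w ! t) \<or> p = fst (w ! t) + 1"

definition arc_steps :: "nat \<Rightarrow> braid \<Rightarrow> (point \<times> point) set" where
  "arc_steps n w =
     {((p, t), (p, t + 1)) | p t. p \<in> {1..n} \<and> t < length w \<and> \<not> touches w t p} \<union>
     {((p, length w), (p, 0)) | p. p \<in> {1..n}}"

definition crossing_steps :: "braid \<Rightarrow> (point \<times> point) set" where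
  "crossing_steps w =
     (\<Union>t<length w. let i = fst (w ! t) in {((i, t), (i + 1, t + 1)), ((i + 1, t), (i, t + 1))})"

definition same_edge :: "nat \<Rightarrow> braid \<Rightarrow> (point \<times> point) set" where
  "same_edge n w = (arc_steps n w \<union> (arc_steps n w)\<inverse>)\<^sup>*"

definition same_component :: "nat \<Rightarrow> braid \<Rightarrow> (point \<times> point) set" where
  "same_component n w =
     (let r = arc_steps n w \<union> crossing_steps w in (r \<union> r\<inverse>)\<^sup>*)"

definition edges :: "nat \<Rightarrow> braid \<Rightarrow> point set set" where
  "edges n w = points n w // same_edge n w"

definition components :: "nat \<Rightarrow> braid \<Rightarrow> point set set" where
  "components n w = points n w // same_component n w"

definition edge_at :: "nat \<Rightarrow> braid \<Rightarrow> point \<Rightarrow> point set" where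
  "edge_at n w x = same_edge n w `` {x}"

definition free_circles :: "nat \<Rightarrow> braid \<Rightarrow> nat list" where
  "free_circles n w = filter (\<lambda>p. \<forall>t<length w. \<not> touches w t p) [1..<n + 1]"


section \<open>Khovanov--Rozansky homology\<close>

text \<open>The equation for \<open>A\<close> and \<open>F\<close> is imposed with \<open>X_k\<close>, \<open>X_l\<close>, \<open>X_i\<close>, \<open>X_j\<close> treated as four
  independent variables (below: \<open>OutL\<close>, \<open>OutR\<close>, \<open>InL\<close>, \<open>InR\<close>), and \<open>A\<close>, \<open>F\<close> are specialized to
  \<open>S\<close> afterwards. For a crossing with four distinct edges this is the same as choosing \<open>A\<close>, \<open>F\<close> in
  \<open>S\<close>. But in the closure the edges \<open>k\<close> and \<open>i\<close>, or \<open>l\<close> and \<open>j\<close>, can coincide; then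
  \<open>(X_k - X_i) * (X_j - X_k)\<close> or \<open>\<rho>\<close> can vanish in \<open>S\<close>, so that the equation in \<open>S\<close> would not
  determine the factorizations (it could be solved by \<open>F = 0\<close>).\<close>

datatype crossing_var = OutL | OutR | InL | InR | Edge nat

definition admissible_choice ::
    "nat \<Rightarrow> nat \<Rightarrow> crossing_var mpoly \<Rightarrow> crossing_var mpoly \<Rightarrow> bool" where
  "admissible_choice N M A F \<longleftrightarrow>
     homogeneous A \<and> homogeneous F \<and>
     indets A \<subseteq> {OutL, OutR, InL, InR} \<union> Edge ` {1..M} \<and>
     indets F \<subseteq> {OutL, OutR, InL, InR} \<union> Edge ` {1..M} \<and>
     Var OutL ^ (N + 1) + Var OutR ^ (N + 1) - Var InL ^ (N + 1) - Var InR ^ (N + 1) =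
       A * (Var OutL + Var OutR - Var InL - Var InR) +
       F * ((Var OutL - Var InL) * (Var InR - Var OutL))"

fun specialize :: "nat \<Rightarrow> nat \<Rightarrow> nat \<Rightarrow> nat \<Rightarrow> crossing_var \<Rightarrow> nat mpoly" where
  "specialize k l i j OutL = Var k"
| "specialize k l i j OutR = Var l"
| "specialize k l i j InL = Var i"
| "specialize k l i j InR = Var j"
| "specialize k l i j (Edge e) = Var e"

text \<open>In the next four definitions \<open>A\<close>, \<open>\<rho>\<close>, \<open>F\<close> are elements of \<open>S\<close>, \<open>u\<close> is \<open>X_k - X_i\<close> and
  \<open>v\<close> is \<open>X_j - X_k\<close>.\<close>

definition Gamma0 :: "'s::comm_ring_1 \<Rightarrow> 's \<Rightarrow> 's \<Rightarrow> 's \<Rightarrow> 's \<Rightarrow> (side list, 's) mf_complex" where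
  "Gamma0 A \<rho> F u v = tensor [koszul A \<rho>, koszul (F * v) u]"

definition Gamma1 :: "'s::comm_ring_1 \<Rightarrow> 's \<Rightarrow> 's \<Rightarrow> 's \<Rightarrow> 's \<Rightarrow> (side list, 's) mf_complex" where
  "Gamma1 A \<rho> F u v = tensor [koszul A \<rho>, koszul F (u * v)]"

definition chi1 :: "'s::comm_ring_1 \<Rightarrow> side list \<Rightarrow> side list \<Rightarrow> 's" where
  "chi1 v b b' = (if b = b' then case b ! 1 of LeftCopy \<Rightarrow> v | RightCopy \<Rightarrow> 1 else 0)"

definition chi0 :: "'s::comm_ring_1 \<Rightarrow> side list \<Rightarrow> side list \<Rightarrow> 's" where
  "chi0 v b b' = (if b = b' then case b ! 1 of LeftCopy \<Rightarrow> 1 | RightCopy \<Rightarrow> v else 0)"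

definition crossing_complex :: "bool \<Rightarrow> crossing_var mpoly \<Rightarrow> crossing_var mpoly \<Rightarrow>
    nat \<Rightarrow> nat \<Rightarrow> nat \<Rightarrow> nat \<Rightarrow> (side list + side list, nat mpoly) mf_complex" where
  "crossing_complex positive A F k l i j =
    (let A' = poly_subst (specialize k l i j) A;
         F' = poly_subst (specialize k l i j) F;
         \<rho> = Var k + Var l - Var i - Var j;
         u = Var k - Var i;
         v = Var j - Var k
     in if positive
        then two_term (-1) (Gamma1 A' \<rho> F' u v) (Gamma0 A' \<rho> F' u v) (chi1 v)
        else two_term 0 (Gamma0 A' \<rho> F' u v) (Gamma1 A' \<rho> F' u v) (chi0 v))"

definition circle_complex :: "nat \<Rightarrow> nat \<Rightarrow> (side list + side list, nat mpoly) mf_complex" where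
  "circle_complex N e = one_term (tensor [koszul (of_nat (N + 1) * Var e ^ N) 0])"

text \<open>Here \<open>\<nu>\<close> is the numbering of the edges, and \<open>A t\<close>, \<open>F t\<close> are the polynomials chosen at the
  crossing number \<open>t\<close>, counted from 0.\<close>

definition KR_complex :: "nat \<Rightarrow> nat \<Rightarrow> braid \<Rightarrow> (point set \<Rightarrow> nat) \<Rightarrow>
    (nat \<Rightarrow> crossing_var mpoly) \<Rightarrow> (nat \<Rightarrow> crossing_var mpoly) \<Rightarrow>
    ((side list + side list) list, nat mpoly) mf_complex" where
  "KR_complex N n w \<nu> A F = tensor
     (map (\<lambda>t. let p = fst (w ! t); e = (\<lambda>x. \<nu> (edge_at n w x))
               in crossing_complex (snd (w ! t)) (A t) (F t)
                    (e (p, t + 1)) (e (p + 1, t + 1)) (e (p, t)) (e (p + 1, t)))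
          [0..<length w]
      @ map (\<lambda>p. circle_complex N (\<nu> (edge_at n w (p, 0)))) (free_circles n w))"

text \<open>The scalar multiplication is that of \<open>S = poly_ring {1..card (edges n w)}\<close>; so this is also a
  module over every polynomial ring on a subset of the variables.\<close>

definition KR_homology :: "nat \<Rightarrow> nat \<Rightarrow> braid \<Rightarrow> (point set \<Rightarrow> nat) \<Rightarrow>
    (nat \<Rightarrow> crossing_var mpoly) \<Rightarrow> (nat \<Rightarrow> crossing_var mpoly) \<Rightarrow>
    (nat mpoly, ((side list + side list) list \<Rightarrow> nat mpoly) set set) module" where
  "KR_homology N n w \<nu> A F =
     double_homology {1..card (edges n w)} (KR_complex N n w \<nu> A F)"

end

theory Submission
  imports
    Defs
    "HOL-Library.Function_Algebras"
    "HOL-Library.Nat_Bijection"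
begin

text \<open>A module over \<open>R = \<rat>[X\<^sub>1, \<dots>, X\<^sub>m]\<close> that contains a nonzero element killed by all variables
  has projective dimension exactly \<open>m\<close>. The Koszul resolution \<open>R \<otimes>\<^sub>\<rat> M \<otimes> \<Lambda>(\<rat>\<^sup>m)\<close> with differential
  built from \<open>X\<^sub>k \<otimes> 1 - 1 \<otimes> X\<^sub>k\<close> gives the upper bound. For the lower bound, such an element is a
  Koszul cycle of degree \<open>m\<close> with coefficients in \<open>M\<close>, and passing to the syzygies of a projective
  resolution of length \<open>l < m\<close> would give a nontrivial Koszul cycle of positive degree with
  coefficients in a projective module.

  The homology has such an element as soon as it is nonzero, because \<open>X\<^sub>e\<^sup>N\<close> is null-homotopic:
  differentiating \<open>W\<^sub>c = A \<rho> + F u v\<close> with respect to an outgoing variable puts \<open>X\<^sub>e\<^sup>N\<close> into the ideal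
  of the entries of each factorization.

  It is nonzero because otherwise the total differential of \<open>d\<close> and \<open>d\<^sub>v\<close> would be exact on a free
  module, hence exact modulo the regular sequence of all variables. But modulo the variables
  a suitable pure tensor of basis elements (taken from \<open>\<Gamma>\<^sub>0\<close> at every crossing) has only zero matrix
  entries into it and out of it.\<close>

text \<open>Both bounds rest on one explicit contraction. On polynomial vectors the operators
  \<open>X - r k\<close>, with \<open>r k\<close> a rational matrix, admit unique division with
  remainder, and the quotients assemble to a homotopy of the Koszul complex. With \<open>r k\<close>
  the matrix of \<open>X\<close> on the module this gives exactness of the Koszul resolution; with
  \<open>r k = 0\<close> it gives acyclicity over free modules and hence over their retracts. The
  lower bound amounts to computing the top Tor of the module with the residue field from the
  projective resolution, spelled out on chains. The double homology is not the homology of a complex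
  of free modules, so reduction modulo the variables cannot be applied to it directly. The total
  complex is free, and since its filtration by homological degree is finite, vanishing of the double
  homology makes it exact. The choice of \<Gamma>0 reflects two units: the entry \<open>F\<close> of
  \<Gamma>1 is a nonzero constant for \<open>N = 1\<close>, and each of \<open>chi0\<close>,
  \<open>chi1\<close> is the identity on one copy. The basis element must therefore lie in
  \<Gamma>0, on the copy where the map is multiplication by \<open>v\<close>.\<close>

abbreviation "lookup \<equiv> Poly_Mapping.lookup"
abbreviation "single \<equiv> Poly_Mapping.single"
abbreviation "keys \<equiv> Poly_Mapping.keys"

section \<open>Polynomials\<close>

lemma poly_mapping_induct_add [case_names zero single add]:
  fixes p :: "'a \<Rightarrow>\<^sub>0 'b::comm_monoid_add"
  assumes zero: "P 0" and single: "\<And>k c. P (single k c)"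
    and add: "\<And>p q. P p \<Longrightarrow> P q \<Longrightarrow> P (p + q)"
  shows "P p"
proof (induction p rule: update_induct)
  case const
  then show ?case by (rule zero)
next
  case (update f a b)
  have "Poly_Mapping.update a b f = f + single a b"
    using update(1) by (intro poly_mapping_eqI)
      (auto simp: lookup_update lookup_add lookup_single when_def in_keys_iff)
  then show ?case using update(3) single add by metis
qed

lemma poly_mapping_sum_single:
  fixes p :: "'a \<Rightarrow>\<^sub>0 'b::comm_monoid_add"
  shows "p = (\<Sum>k\<in>keys p. single k (lookup p k))"
  by (intro poly_mapping_eqI) (simp add: lookup_sum lookup_single when_def in_keys_iff)

text \<open>The summands are the terms of \<open>p\<close> itself, so the single case may use
  everything known about its exponents and coefficients.\<close>

lemma poly_mapping_induct_keys [consumes 1, case_names zero single add]: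
  fixes p :: "'a \<Rightarrow>\<^sub>0 'b::comm_monoid_add"
  assumes "keys p \<subseteq> K"
    and "P 0" "\<And>k. k \<in> K \<Longrightarrow> k \<in> keys p \<Longrightarrow> P (single k (lookup p k))"
    and "\<And>p q. P p \<Longrightarrow> P q \<Longrightarrow> P (p + q)"
  shows "P p"
proof -
  have "P (\<Sum>k\<in>A. single k (lookup p k))"
    if "finite A" "A \<subseteq> keys p" for A
    using that assms by (induction A rule: finite_induct) auto
  from this[OF finite_keys order.refl] show ?thesis
    by (simp add: poly_mapping_sum_single [symmetric])
qed

lemma Const_0 [simp]: "Const 0 = 0" and Const_1 [simp]: "Const 1 = 1"
  by (simp_all add: Const_def)

lemma Const_add: "Const (a + b) = Const a + Const b"
  by (simp add: Const_def single_add)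

lemma Const_mult: "Const (a * b) = Const a * Const b"
  by (simp add: Const_def mult_single)

lemma Const_eq_iff [simp]: "Const a = Const b \<longleftrightarrow> a = b"
  by (metis Const_def lookup_single_eq)

lemma of_nat_eq_Const: "of_nat k = Const (of_nat k)"
  by (induction k) (auto simp: Const_add)

lemma lookup_Const: "lookup (Const c) u = (if u = 0 then c else 0)"
  by (simp add: Const_def lookup_single when_def)

lemma lookup_single_mult:
  fixes p :: "'v mpoly"
  shows "lookup (single a c * p) (a + u) = c * lookup p u"
proof (induction p rule: poly_mapping_induct_add)
  case (single k d)
  then show ?case by (auto simp: mult_single lookup_single when_def)
qed (auto simp: lookup_add algebra_simps)

lemma lookup_single_mult_other:
  fixes p :: "'v mpoly"
  assumes "\<And>w. u \<noteq> a + w"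
  shows "lookup (single a c * p) u = 0"
proof (induction p rule: poly_mapping_induct_add)
  case (single k d)
  then show ?case using assms[of k] by (auto simp: mult_single lookup_single when_def)
qed (auto simp: lookup_add algebra_simps)

lemma lookup_Const_mult: "lookup (Const c * p) u = c * lookup p u"
  using lookup_single_mult[of 0 c p u] by (simp add: Const_def)

lemma lookup_Var_mult_Suc:
  "lookup (Var v * p) (single v 1 + u) = lookup p u"
  using lookup_single_mult[of "single v 1" 1 p u] by (simp add: Var_def)

lemma lookup_Var_mult_notin:
  assumes "lookup u v = 0"
  shows "lookup (Var v * p) u = 0"
  unfolding Var_def using assms by (intro lookup_single_mult_other) (auto simp: lookup_add)

lemma monomial_split:
  assumes "lookup u v \<noteq> (0::nat)"
  obtains w where "u = single v 1 + w"
proof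
  show "u = single v 1 + (u - single v 1)"
    using assms by (intro poly_mapping_eqI) (auto simp: lookup_add lookup_minus lookup_single when_def)
qed

lemma lookup_Var_mult: "lookup (Var v * p) u =
  (if lookup u v = 0 then 0 else lookup p (u - single v 1))"
proof (cases "lookup u v = 0")
  case False
  then obtain w where w: "u = single v 1 + w" by (rule monomial_split)
  have "u - single v 1 = w"
    unfolding w by (intro poly_mapping_eqI) (auto simp: lookup_add lookup_minus lookup_single when_def)
  then show ?thesis using False by (simp add: w lookup_Var_mult_Suc[unfolded One_nat_def])
qed (simp add: lookup_Var_mult_notin)

lemma indets_subset_iff: "indets p \<subseteq> V \<longleftrightarrow> (\<forall>u. lookup p u \<noteq> 0 \<longrightarrow> keys u \<subseteq> V)"
  by (simp add: indets_def in_keys_iff [symmetric] UN_subset_iff Ball_def)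

lemma indets_0 [simp]: "indets 0 = {}" and indets_Const [simp]: "indets (Const c) = {}"
  by (auto simp: indets_def Const_def)

lemma indets_1 [simp]: "indets 1 = {}"
  using indets_Const[of 1] by (simp del: indets_Const)

lemma indets_Var [simp]: "indets (Var v) = {v}"
  by (simp add: indets_def Var_def)

lemma indets_uminus [simp]: "indets (- p) = indets p"
  by (simp add: indets_def Poly_Mapping.keys.rep_eq)

lemma indets_add: "indets (p + q) \<subseteq> indets p \<union> indets q"
  using keys_add[of p q] by (auto simp: indets_def)

lemma indets_diff: "indets (p - q) \<subseteq> indets p \<union> indets q"
  using indets_add[of p "- q"] by simp

lemma indets_mult: "indets (p * q) \<subseteq> indets p \<union> indets q"
proof
  fix v assume "v \<in> indets (p * q)"
  then obtain u where u: "u \<in> keys (p * q)" "v \<in> keys u"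
    by (auto simp: indets_def)
  then obtain a b where "u = a + b" "a \<in> keys p" "b \<in> keys q"
    using keys_mult[of p q] by auto
  then show "v \<in> indets p \<union> indets q"
    using u(2) keys_add[of a b] by (auto simp: indets_def)
qed

lemma indets_closed:
  assumes "indets p \<subseteq> V" "indets q \<subseteq> V"
  shows "indets (p + q) \<subseteq> V" "indets (p - q) \<subseteq> V" "indets (p * q) \<subseteq> V"
  using assms indets_add[of p q] indets_diff[of p q] indets_mult[of p q] by blast+

lemma indets_power: "indets p \<subseteq> V \<Longrightarrow> indets (p ^ k) \<subseteq> V"
  by (induction k) (simp_all add: indets_closed)

lemma indets_sum: "(\<And>a. a \<in> A \<Longrightarrow> indets (f a) \<subseteq> V) \<Longrightarrow> indets (sum f A) \<subseteq> V"
  by (induction A rule: infinite_finite_induct) (simp_all add: indets_closed)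

lemma indets_prod: "(\<And>a. a \<in> A \<Longrightarrow> indets (f a) \<subseteq> V) \<Longrightarrow> indets (prod f A) \<subseteq> V"
  by (induction A rule: infinite_finite_induct) (simp_all add: indets_closed)

lemma indets_empty_imp_Const: "indets p \<subseteq> {} \<Longrightarrow> p = Const (lookup p 0)"
  unfolding indets_subset_iff by (intro poly_mapping_eqI) (auto simp: lookup_Const)

text \<open>Monomials are hidden: a property that passes through multiplication by one variable
  passes through all of them. Division with remainder and ideal membership are most easily checked
  in this form.\<close>

lemma mpoly_induct [consumes 1, case_names Const add Var]:
  fixes p :: "'v mpoly"
  assumes "indets p \<subseteq> V" and Const: "\<And>c. P (Const c)"
    and add: "\<And>p q. P p \<Longrightarrow> P q \<Longrightarrow> P (p + q)"
    and Var: "\<And>v p. v \<in> V \<Longrightarrow> P p \<Longrightarrow> P (Var v * p)"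
  shows "P p"
proof -
  have mon: "P q \<Longrightarrow> P (single u 1 * q)" if "keys u \<subseteq> V"
    for u :: "'v \<Rightarrow>\<^sub>0 nat" and q
    using that
  proof (induction u arbitrary: q rule: poly_mapping_induct_keys)
    case (single v)
    have "P (single (single v n) 1 * q)" for n
    proof (induction n)
      case (Suc n)
      have "single (single v (Suc n)) 1 * q =
        Var v * (single (single v n) 1 * q)"
        by (simp add: Var_def mult.assoc [symmetric] mult_single single_add [symmetric])
      then show ?case using Suc Var single by metis
    qed (use single in auto)
    then show ?case .
  next
    case (add u w)
    then show ?case by (metis (no_types) mult.assoc mult_single mult_1)
  qed auto
  have "keys p \<subseteq> {u. keys u \<subseteq> V}"
    using assms(1) by (auto simp: indets_def)
  then show ?thesis
  proof (induction p rule: poly_mapping_induct_keys)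
    case zero
    then show ?case using Const[of 0] by simp
  next
    case (single u)
    have "single u c = single u 1 * Const c" for c
      by (simp add: Const_def mult_single)
    then show ?case using mon Const single by (metis mem_Collect_eq)
  qed (rule add)
qed

lemma cring_poly_ring: "cring (poly_ring V)"
proof (rule cringI)
  show "abelian_group (poly_ring V)"
  proof (rule abelian_groupI)
    show "\<exists>y\<in>carrier (poly_ring V). y \<oplus>\<^bsub>poly_ring V\<^esub> x = \<zero>\<^bsub>poly_ring V\<^esub>" if "x \<in> carrier (poly_ring V)" for x
      using that by (intro bexI[of _ "- x"]) (auto simp: poly_ring_def)
  qed (simp_all add: poly_ring_def add.assoc add.commute indets_closed)
  show "Group.comm_monoid (poly_ring V)"
    by (rule comm_monoidI) (simp_all add: poly_ring_def mult.assoc mult.commute indets_closed)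
qed (simp add: poly_ring_def distrib_right)

section \<open>Koszul complexes and their contraction\<close>

text \<open>The Koszul differential of \<open>\<phi>\<^sub>0, \<dots>, \<phi>\<^bsub>j - 1\<^esub>\<close>; the value of a chain at \<open>S\<close> is its coefficient at
  the exterior monomial \<open>e\<^sub>S\<close>. Splitting off the largest index leaves a single sign. Indices
  in \<open>S\<close> that are at least \<open>j\<close> are inert.\<close>

primrec koszul_diff :: "(nat \<Rightarrow> 'e::ab_group_add \<Rightarrow> 'e) \<Rightarrow> nat \<Rightarrow> (nat set \<Rightarrow> 'e) \<Rightarrow> nat set \<Rightarrow> 'e" where
  "koszul_diff \<phi> 0 z S = 0"
| "koszul_diff \<phi> (Suc j) z S = (if j \<in> S then - koszul_diff \<phi> j z S else koszul_diff \<phi> j z S + \<phi> j (z (insert j S)))"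

lemma koszul_diff_Suc:
  "j \<in> S \<Longrightarrow> koszul_diff \<phi> (Suc j) z S = - koszul_diff \<phi> j z S"
  "j \<notin> S \<Longrightarrow> koszul_diff \<phi> (Suc j) z S = koszul_diff \<phi> j z S + \<phi> j (z (insert j S))"
  by simp_all

lemma additive_0:
  fixes f :: "'a::ab_group_add \<Rightarrow> 'b::ab_group_add"
  assumes "\<And>x y. f (x + y) = f x + f y"
  shows "f 0 = 0"
  using assms[of 0 0] by simp

lemma additive_minus:
  fixes f :: "'a::ab_group_add \<Rightarrow> 'b::ab_group_add"
  assumes "\<And>x y. f (x + y) = f x + f y"
  shows "f (- x) = - f x"
  using assms[of x "- x"] additive_0[of f] assms by (simp add: eq_neg_iff_add_eq_0 add.commute)

lemma additive_diff:
  fixes f :: "'a::ab_group_add \<Rightarrow> 'b::ab_group_add"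
  assumes "\<And>x y. f (x + y) = f x + f y"
  shows "f (x - y) = f x - f y"
  using assms[of x "- y"] additive_minus[of f, OF assms] by simp

text \<open>A term at \<open>S\<close> comes from a set with one more element. Such control of
  supports replaces the grading, which chains, being functions on all sets, do not carry.\<close>

lemma koszul_diff_nonzeroD:
  assumes "koszul_diff \<phi> j z S \<noteq> 0" and "\<And>k. \<phi> k 0 = 0"
  shows "\<exists>k<j. k \<notin> S \<and> z (insert k S) \<noteq> 0"
  using assms(1)
proof (induction j)
  case (Suc j)
  then show ?case using assms(2)
    by (cases "koszul_diff \<phi> j z S = 0") (auto split: if_splits intro: less_SucI)
qed simp

lemma koszul_diff_mem:
  assumes "\<And>S. z S \<in> G" and "0 \<in> G" "\<And>x y. x \<in> G \<Longrightarrow> y \<in> G \<Longrightarrow> x + y \<in> G" "\<And>x. x \<in> G \<Longrightarrow> - x \<in> G"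
    and "\<And>k x. k < j \<Longrightarrow> x \<in> G \<Longrightarrow> \<phi> k x \<in> G"
  shows "koszul_diff \<phi> j z S \<in> G"
  using assms(5)
proof (induction j)
  case (Suc j)
  then show ?case using assms(1-4) by auto
qed (simp add: assms)

lemma koszul_diff_cong:
  assumes "\<And>k. k < j \<Longrightarrow> k \<notin> S \<Longrightarrow> z (insert k S) = z' (insert k S)"
  shows "koszul_diff \<phi> j z S = koszul_diff \<phi> j z' S"
  using assms by (induction j) auto

text \<open>The sign of the term of index \<open>k\<close> counts the elements of \<open>S\<close>
  above \<open>k\<close> and below \<open>j\<close>, so adjoining an index \<open>l \<ge> j\<close>
  changes no sign.\<close>

lemma koszul_diff_insert:
  assumes "j \<le> l"
  shows "koszul_diff \<phi> j z (insert l S) = koszul_diff \<phi> j (\<lambda>T. z (insert l T)) S"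
  using assms by (induction j) (auto simp: insert_commute)

text \<open>\<open>f\<close> is constrained only on the subgroup \<open>G\<close>, because the
  differentials of a resolution and the retractions onto projective modules are linear only on
  carriers.\<close>

lemma koszul_diff_map:
  fixes f :: "'a::ab_group_add \<Rightarrow> 'b::ab_group_add"
  assumes G: "\<And>S. z S \<in> G" "0 \<in> G" "\<And>x y. x \<in> G \<Longrightarrow> y \<in> G \<Longrightarrow> x + y \<in> G" "\<And>x. x \<in> G \<Longrightarrow> - x \<in> G"
    and \<phi>: "\<And>k x. k < j \<Longrightarrow> x \<in> G \<Longrightarrow> \<phi> k x \<in> G"
    and add: "\<And>x y. x \<in> G \<Longrightarrow> y \<in> G \<Longrightarrow> f (x + y) = f x + f y"
    and comm: "\<And>k x. k < j \<Longrightarrow> x \<in> G \<Longrightarrow> f (\<phi> k x) = \<psi> k (f x)"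
  shows "f (koszul_diff \<phi> j z S) = koszul_diff \<psi> j (\<lambda>T. f (z T)) S"
  using \<phi> comm
proof (induction j)
  case 0
  then show ?case using add[of 0 0] G(2) by simp
next
  case (Suc j)
  have mem: "koszul_diff \<phi> j z S \<in> G"
    by (rule koszul_diff_mem[where G=G]) (use G Suc.prems in auto)
  have "f (- x) = - f x" if "x \<in> G" for x
    using add[of x "- x"] add[of 0 0] G that by (simp add: eq_neg_iff_add_eq_0 add.commute)
  then show ?case using Suc mem G add by simp
qed

context
  fixes \<phi> :: "nat \<Rightarrow> 'e::ab_group_add \<Rightarrow> 'e"
  assumes phi_add: "\<And>k x y. \<phi> k (x + y) = \<phi> k x + \<phi> k y"
begin

lemma koszul_diff_add: "koszul_diff \<phi> j (\<lambda>S. z S + z' S) S = koszul_diff \<phi> j z S + koszul_diff \<phi> j z' S"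
  by (induction j) (auto simp: phi_add)

lemma koszul_diff_minus: "koszul_diff \<phi> j (\<lambda>S. - z S) S = - koszul_diff \<phi> j z S"
  by (induction j) (auto simp: additive_minus[of "\<phi> _", OF phi_add])

lemma koszul_diff_diff: "koszul_diff \<phi> j (\<lambda>S. z S - z' S) S = koszul_diff \<phi> j z S - koszul_diff \<phi> j z' S"
  using koszul_diff_add[of j z "\<lambda>S. - z' S"] by (simp add: koszul_diff_minus)

lemma koszul_diff_commute_map:
  assumes "\<And>x y. f (x + y) = f x + f y" "\<And>k x. k < j \<Longrightarrow> f (\<phi> k x) = \<phi> k (f x)"
  shows "f (koszul_diff \<phi> j z S) = koszul_diff \<phi> j (\<lambda>T. f (z T)) S"
  by (rule koszul_diff_map[where G = UNIV]) (use assms in auto)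

text \<open>With the largest index split off, the complex is the cone of \<open>\<phi> j\<close>.
  For \<open>j \<notin> S\<close> the two mixed terms are \<open>\<phi> j\<close> of the smaller
  differential of \<open>z (insert j T)\<close>, once with each sign.\<close>

lemma koszul_diff_koszul_diff:
  assumes "\<And>k l x. \<phi> k (\<phi> l x) = \<phi> l (\<phi> k x)"
  shows "koszul_diff \<phi> j (koszul_diff \<phi> j z) S = 0"
proof (induction j arbitrary: z S)
  case (Suc j)
  have IH: "koszul_diff \<phi> j (koszul_diff \<phi> j z) S = 0" for z S by (rule Suc)
  show ?case
  proof (cases "j \<in> S")
    case True
    have "koszul_diff \<phi> j (koszul_diff \<phi> (Suc j) z) S = koszul_diff \<phi> j (\<lambda>T. - koszul_diff \<phi> j z T) S"
      by (rule koszul_diff_cong) (use True in auto)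
    also have "\<dots> = 0" by (simp add: koszul_diff_minus IH)
    finally show ?thesis using True by (simp add: koszul_diff_Suc del: koszul_diff.simps)
  next
    case False
    have "koszul_diff \<phi> j (koszul_diff \<phi> (Suc j) z) S = koszul_diff \<phi> j (\<lambda>T. koszul_diff \<phi> j z T + \<phi> j (z (insert j T))) S"
      by (rule koszul_diff_cong) (use False in auto)
    also have "\<dots> = \<phi> j (koszul_diff \<phi> j (\<lambda>T. z (insert j T)) S)"
      using koszul_diff_commute_map[of "\<phi> j" j "\<lambda>T. z (insert j T)" S] by (simp add: koszul_diff_add IH phi_add assms)
    finally show ?thesis using False
      by (simp add: koszul_diff_Suc koszul_diff_insert additive_minus[of "\<phi> _", OF phi_add] del: koszul_diff.simps)
  qed
qed simp

end

text \<open>Regularity of commuting operators in effective form: every element is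
  \<open>\<phi> k\<close> of a unique quotient plus a remainder in \<open>N k\<close>. In the
  application \<open>N k\<close> consists of the vectors free of one variable. Stability of
  \<open>N l\<close> under the other operators makes division by \<open>\<phi> l\<close> commute
  with them.\<close>

locale koszul_division =
  fixes \<phi> :: "nat \<Rightarrow> 'e::ab_group_add \<Rightarrow> 'e" and N :: "nat \<Rightarrow> 'e set"
  assumes phi_add: "\<phi> k (x + y) = \<phi> k x + \<phi> k y"
    and phi_comm: "\<phi> k (\<phi> l x) = \<phi> l (\<phi> k x)"
    and N_diff: "x \<in> N k \<Longrightarrow> y \<in> N k \<Longrightarrow> x - y \<in> N k"
    and phi_N: "k \<noteq> l \<Longrightarrow> x \<in> N l \<Longrightarrow> \<phi> k x \<in> N l"
    and division: "\<exists>q. y - \<phi> k q \<in> N k"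
    and division_0: "\<phi> k q \<in> N k \<Longrightarrow> q = 0"
begin

definition quo :: "nat \<Rightarrow> 'e \<Rightarrow> 'e" where
  "quo k y = (THE q. y - \<phi> k q \<in> N k)"

definition rem :: "nat \<Rightarrow> 'e \<Rightarrow> 'e" where
  "rem k y = y - \<phi> k (quo k y)"

lemmas phi_0 = additive_0[of "\<phi> _", OF phi_add]
lemmas phi_minus = additive_minus[of "\<phi> _", OF phi_add]
lemmas phi_diff = additive_diff[of "\<phi> _", OF phi_add]

lemma N_0: "0 \<in> N k"
  using division[of 0 k] N_diff by force

lemma N_add: "x \<in> N k \<Longrightarrow> y \<in> N k \<Longrightarrow> x + y \<in> N k"
  using N_diff[of x k "0 - y"] N_diff[of 0 k y] N_0 by simp

lemma quo_unique:
  assumes "y - \<phi> k q \<in> N k"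
  shows "quo k y = q"
  unfolding quo_def
proof (rule the_equality)
  fix q' assume "y - \<phi> k q' \<in> N k"
  from N_diff[OF assms this] have "\<phi> k (q' - q) \<in> N k" by (simp add: phi_diff)
  then show "q' = q" using division_0 by fastforce
qed (rule assms)

lemma rem_mem: "rem k y \<in> N k"
  using division[of y k] quo_unique unfolding rem_def by metis

lemma quo_add: "quo k (x + y) = quo k x + quo k y"
  using N_add[OF rem_mem[of k x] rem_mem[of k y]]
  by (intro quo_unique) (simp add: rem_def phi_add algebra_simps)

lemma rem_add: "rem k (x + y) = rem k x + rem k y"
  by (simp add: rem_def quo_add phi_add)

lemma quo_phi: "quo k (\<phi> k x) = x"
  by (rule quo_unique) (simp add: N_0)

lemma rem_phi: "rem k (\<phi> k x) = 0"
  by (simp add: rem_def quo_phi)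

lemma quo_commute: "k \<noteq> l \<Longrightarrow> quo k (\<phi> l x) = \<phi> l (quo k x)"
  using phi_N[of l k "rem k x"] rem_mem[of k x]
  by (intro quo_unique) (simp add: rem_def phi_diff phi_comm[of k l])

lemma rem_commute: "k \<noteq> l \<Longrightarrow> rem k (\<phi> l x) = \<phi> l (rem k x)"
  by (simp add: rem_def quo_commute phi_diff phi_comm[of l k])

text \<open>Successive remainders. For polynomial vectors and operators \<open>X - r k\<close> this
  substitutes \<open>r k\<close> for the corresponding variable, so it is an evaluation.\<close>

primrec ev :: "nat \<Rightarrow> 'e \<Rightarrow> 'e" where
  "ev 0 x = x"
| "ev (Suc j) x = rem j (ev j x)"

lemma ev_add: "ev j (x + y) = ev j x + ev j y"
  by (induction j) (simp_all add: rem_add)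

lemma ev_commute: "j \<le> l \<Longrightarrow> ev j (\<phi> l x) = \<phi> l (ev j x)"
  by (induction j) (simp_all add: rem_commute)

lemma ev_phi: "k < j \<Longrightarrow> ev j (\<phi> k x) = 0"
proof (induction j)
  case (Suc j)
  then show ?case
    by (cases "k = j") (simp_all add: ev_commute rem_phi additive_0[of "rem _", OF rem_add])
qed simp

text \<open>Projection onto the homology of the complex of the first \<open>j\<close> operators,
  which sits in degree 0 with respect to them and is represented by remainders.\<close>

definition proj :: "nat \<Rightarrow> (nat set \<Rightarrow> 'e) \<Rightarrow> nat set \<Rightarrow> 'e" where
  "proj j z S = (if S \<inter> {..<j} = {} then ev j (z S) else 0)"

text \<open>The contracting homotopy of a tensor product of two-term complexes \<open>\<phi>\<^sub>k : E \<rightarrow> E\<close>, each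
  contracted onto the remainders by \<open>quo\<close>.\<close>

primrec koszul_htpy :: "nat \<Rightarrow> (nat set \<Rightarrow> 'e) \<Rightarrow> nat set \<Rightarrow> 'e" where
  "koszul_htpy 0 z S = 0"
| "koszul_htpy (Suc j) z S = (if j \<in> S then - koszul_htpy j z S + quo j (proj j z (S - {j})) else koszul_htpy j z S)"

lemma koszul_htpy_Suc:
  "j \<in> S \<Longrightarrow> koszul_htpy (Suc j) z S = - koszul_htpy j z S + quo j (proj j z (S - {j}))"
  "j \<notin> S \<Longrightarrow> koszul_htpy (Suc j) z S = koszul_htpy j z S"
  by simp_all

lemmas quo_0 = additive_0[of "quo _", OF quo_add]
lemmas ev_0 = additive_0[of "ev _", OF ev_add]
lemmas ev_minus = additive_minus[of "ev _", OF ev_add]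

lemma proj_add: "proj j (\<lambda>S. z S + z' S) S = proj j z S + proj j z' S"
  by (simp add: proj_def ev_add)

lemma koszul_htpy_add: "koszul_htpy j (\<lambda>S. z S + z' S) S = koszul_htpy j z S + koszul_htpy j z' S"
  by (induction j) (auto simp: proj_add quo_add)

lemma koszul_htpy_minus: "koszul_htpy j (\<lambda>S. - z S) S = - koszul_htpy j z S"
  using koszul_htpy_add[of j z "\<lambda>S. - z S" S] koszul_htpy_add[of j "\<lambda>S. 0" "\<lambda>S. 0" S] by (simp add: eq_neg_iff_add_eq_0 add.commute)

lemma koszul_htpy_cong:
  assumes "\<And>k. k < j \<Longrightarrow> k \<in> S \<Longrightarrow> z (S - {k}) = z' (S - {k})"
  shows "koszul_htpy j z S = koszul_htpy j z' S"
  using assms by (induction j) (auto simp: proj_def)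

lemma koszul_htpy_insert:
  assumes "j \<le> l" "l \<notin> S"
  shows "koszul_htpy j z (insert l S) = koszul_htpy j (\<lambda>T. z (insert l T)) S"
  using assms
proof (induction j)
  case (Suc j)
  then have "insert l S - {j} = insert l (S - {j})" by auto
  then show ?case using Suc by (auto simp: proj_def)
qed simp

lemma koszul_htpy_commute:
  assumes "j \<le> l"
  shows "koszul_htpy j (\<lambda>T. \<phi> l (z T)) S = \<phi> l (koszul_htpy j z S)"
  using assms
  by (induction j) (auto simp: proj_def phi_0 phi_add phi_diff phi_minus ev_commute quo_commute quo_0)

text \<open>Each term of the differential is, up to sign, a value of some \<open>\<phi> k\<close>
  with \<open>k < j\<close>, and iterated remainders kill these.\<close>

lemma proj_koszul_diff: "proj j (koszul_diff \<phi> j z) S = 0"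
proof -
  have "ev j (koszul_diff \<phi> i z S) = 0" if "i \<le> j" for i
    using that by (induction i) (auto simp: ev_0 ev_minus ev_add ev_phi)
  then show ?thesis by (simp add: proj_def)
qed

text \<open>The chain lives on sets without indices below \<open>j\<close>, whereas the differential
  evaluates it only at sets \<open>insert k S\<close> with \<open>k < j\<close>.\<close>

lemma koszul_diff_proj: "koszul_diff \<phi> j (\<lambda>T. quo l (proj j z (T - {l}))) S = 0" if "j \<le> l"
proof -
  have "koszul_diff \<phi> i (\<lambda>T. quo l (proj j z (T - {l}))) S = 0" if "i \<le> j" for i
    using that \<open>j \<le> l\<close> by (induction i) (auto simp: proj_def phi_0 quo_0)
  then show ?thesis by simp
qed

text \<open>For a tensor product of two contractions the homotopy is that of the first factor plus
  the projection of the first tensored with the homotopy of the second. Here the second factor is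
  \<open>\<phi> j\<close> with homotopy \<open>quo j\<close>, and the cases \<open>j \<in> S\<close>
  and \<open>j \<notin> S\<close> are its two degrees.\<close>

theorem koszul_homotopy: "koszul_diff \<phi> j (koszul_htpy j z) S + koszul_htpy j (koszul_diff \<phi> j z) S = z S - proj j z S"
proof (induction j arbitrary: z S)
  case 0
  then show ?case by (simp add: proj_def)
next
  case (Suc j)
  note IH = Suc
  show ?case
  proof (cases "j \<in> S")
    case True
    have "koszul_diff \<phi> j (koszul_htpy (Suc j) z) S = koszul_diff \<phi> j (\<lambda>T. - koszul_htpy j z T + quo j (proj j z (T - {j}))) S"
      by (rule koszul_diff_cong) (use True in auto)
    also have "\<dots> = - koszul_diff \<phi> j (koszul_htpy j z) S"
      by (simp add: koszul_diff_diff[OF phi_add] koszul_diff_proj)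
    finally have 1: "koszul_diff \<phi> (Suc j) (koszul_htpy (Suc j) z) S = koszul_diff \<phi> j (koszul_htpy j z) S"
      using True by (simp add: koszul_diff_Suc koszul_htpy_Suc del: koszul_diff.simps koszul_htpy.simps)
    have "koszul_htpy j (koszul_diff \<phi> (Suc j) z) S = koszul_htpy j (\<lambda>T. - koszul_diff \<phi> j z T) S"
      by (rule koszul_htpy_cong) (use True in auto)
    then have 2: "koszul_htpy j (koszul_diff \<phi> (Suc j) z) S = - koszul_htpy j (koszul_diff \<phi> j z) S" by (simp add: koszul_htpy_minus)
    \<comment> \<open>At a set without \<open>j\<close> the differential has the extra term
      \<open>\<phi> j (z (insert j T))\<close>. The other terms die under the projection, and
      \<open>quo j\<close> will undo this \<open>\<phi> j\<close>.\<close>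
    have "proj j (koszul_diff \<phi> (Suc j) z) (S - {j}) = proj j (\<lambda>T. koszul_diff \<phi> j z T + \<phi> j (z (insert j T))) (S - {j})"
      by (simp add: proj_def)
    also have "\<dots> = \<phi> j (proj j z S)"
      using True by (auto simp: proj_add proj_koszul_diff) (auto simp: proj_def ev_commute phi_0 insert_absorb)
    finally have "koszul_htpy (Suc j) (koszul_diff \<phi> (Suc j) z) S = koszul_htpy j (koszul_diff \<phi> j z) S + proj j z S"
      using True 2 by (simp add: quo_phi koszul_htpy_Suc del: koszul_diff.simps koszul_htpy.simps)
    moreover have "proj (Suc j) z S = 0" using True by (auto simp: proj_def)
    ultimately show ?thesis using 1 IH[of z S] by (simp add: algebra_simps del: koszul_diff.simps koszul_htpy.simps)
  next
    case False
    have "koszul_diff \<phi> j (koszul_htpy (Suc j) z) S = koszul_diff \<phi> j (koszul_htpy j z) S"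
      by (rule koszul_diff_cong) (use False in auto)
    moreover have "koszul_htpy (Suc j) z (insert j S) = - koszul_htpy j (\<lambda>T. z (insert j T)) S + quo j (proj j z S)"
      using False by (simp add: koszul_htpy_insert koszul_htpy_Suc del: koszul_diff.simps koszul_htpy.simps)
    ultimately have 1: "koszul_diff \<phi> (Suc j) (koszul_htpy (Suc j) z) S =
      koszul_diff \<phi> j (koszul_htpy j z) S - \<phi> j (koszul_htpy j (\<lambda>T. z (insert j T)) S) + \<phi> j (quo j (proj j z S))"
      using False by (simp add: koszul_diff_Suc phi_add phi_diff phi_minus del: koszul_diff.simps koszul_htpy.simps)
    have "koszul_htpy j (koszul_diff \<phi> (Suc j) z) S = koszul_htpy j (\<lambda>T. koszul_diff \<phi> j z T + \<phi> j (z (insert j T))) S"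
      by (rule koszul_htpy_cong) (use False in auto)
    then have 2: "koszul_htpy (Suc j) (koszul_diff \<phi> (Suc j) z) S = koszul_htpy j (koszul_diff \<phi> j z) S + \<phi> j (koszul_htpy j (\<lambda>T. z (insert j T)) S)"
      using False by (simp add: koszul_htpy_Suc koszul_htpy_add koszul_htpy_commute del: koszul_diff.simps koszul_htpy.simps)
    have "proj (Suc j) z S = rem j (proj j z S)"
      using False by (auto simp: proj_def lessThan_Suc additive_0[of "rem _", OF rem_add])
    \<comment> \<open>Consecutive projections differ by one division. The homotopy has stored its
      quotient at \<open>insert j S\<close>, from where the differential brings it back.\<close>
    then have 3: "\<phi> j (quo j (proj j z S)) = proj j z S - proj (Suc j) z S"
      by (simp add: rem_def)
    show ?thesis unfolding 1 2 3 using IH[of z S] by (simp add: algebra_simps del: koszul_diff.simps koszul_htpy.simps)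
  qed
qed

lemma koszul_htpy_nonzeroD:
  assumes "koszul_htpy j z S \<noteq> 0"
  shows "\<exists>k<j. k \<in> S \<and> z (S - {k}) \<noteq> 0"
  using assms
proof (induction j)
  case (Suc j)
  then show ?case
    by (cases "koszul_htpy j z S = 0") (auto simp: proj_def quo_0 ev_0 split: if_splits intro: less_SucI)
qed simp

lemma koszul_htpy_mem:
  assumes "\<And>S. z S \<in> G" and "0 \<in> G" "\<And>x y. x \<in> G \<Longrightarrow> y \<in> G \<Longrightarrow> x + y \<in> G" "\<And>x. x \<in> G \<Longrightarrow> - x \<in> G"
    and "\<And>k x. k < j \<Longrightarrow> x \<in> G \<Longrightarrow> \<phi> k x \<in> G" and "\<And>k x. k < j \<Longrightarrow> x \<in> G \<Longrightarrow> quo k x \<in> G"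
  shows "koszul_htpy j z S \<in> G"
proof -
  have rem: "rem k x \<in> G" if "k < j" "x \<in> G" for k x
    using assms(3)[OF that(2) assms(4)[OF assms(5)[OF that(1) assms(6)[OF that]]]] by (simp add: rem_def)
  have ev: "ev i x \<in> G" if "i \<le> j" "x \<in> G" for i x
    using that by (induction i) (auto intro: rem)
  have diff: "x - y \<in> G" if "x \<in> G" "y \<in> G" for x y
    using assms(3)[OF that(1) assms(4)[OF that(2)]] by simp
  have "proj i z T \<in> G" if "i \<le> j" for i T
    using that assms(1,2) by (simp add: proj_def ev)
  then have "koszul_htpy i z S \<in> G" if "i \<le> j" for i
    using that assms(2,4,6) by (induction i) (simp_all add: diff)
  then show ?thesis by simp
qed

end

section \<open>Polynomial vectors with a rational matrix for each variable\<close>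

definition smul :: "'v mpoly \<Rightarrow> ('i \<Rightarrow>\<^sub>0 'v mpoly) \<Rightarrow> 'i \<Rightarrow>\<^sub>0 'v mpoly" where
  "smul p f = Poly_Mapping.map ((*) p) f"

lemma lookup_smul [simp]: "lookup (smul p f) i = p * lookup f i"
  by (simp add: smul_def Poly_Mapping.map.rep_eq when_def)

lemma smul_simps:
  "smul p (f + g) = smul p f + smul p g" "smul p (f - g) = smul p f - smul p g"
  "smul (p + q) f = smul p f + smul q f" "smul (p * q) f = smul p (smul q f)" "smul p 0 = 0"
  "smul 0 f = 0" "smul 1 f = f" "smul p (single i q) = single i (p * q)"
  "smul p (- f) = - smul p f"
  by (auto intro!: poly_mapping_eqI simp: lookup_add lookup_minus algebra_simps lookup_single when_def)

lemma smul_commute: "smul p (smul q f) = smul q (smul p f)"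
  by (metis mult.commute smul_simps(4))

lemma smul_sum: "smul p (sum f A) = (\<Sum>a\<in>A. smul p (f a))"
  by (induction A rule: infinite_finite_induct) (auto simp: smul_simps)

text \<open>The rational matrix whose row \<open>r b\<close> is the image of the basis element
  \<open>b\<close>, extended linearly over the polynomials.\<close>

definition act :: "('i \<Rightarrow> 'i \<Rightarrow>\<^sub>0 rat) \<Rightarrow> ('i \<Rightarrow>\<^sub>0 'v mpoly) \<Rightarrow> 'i \<Rightarrow>\<^sub>0 'v mpoly" where
  "act r f = (\<Sum>b\<in>keys f. smul (lookup f b) (Poly_Mapping.map Const (r b)))"

lemma act_superset:
  assumes "finite B" "keys f \<subseteq> B"
  shows "act r f = (\<Sum>b\<in>B. smul (lookup f b) (Poly_Mapping.map Const (r b)))"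
  unfolding act_def using assms by (intro sum.mono_neutral_left) (auto simp: in_keys_iff smul_simps)

lemma act_add: "act r (f + g) = act r f + act r g"
proof -
  let ?B = "keys f \<union> keys g"
  have "finite ?B" "keys (f + g) \<subseteq> ?B" by (simp_all add: keys_add)
  then show ?thesis
    by (simp add: act_superset[of ?B] lookup_add smul_simps sum.distrib)
qed

lemma act_smul: "act r (smul p f) = smul p (act r f)"
proof -
  have "keys (smul p f) \<subseteq> keys f" by (auto simp: in_keys_iff)
  then show ?thesis
    by (simp add: act_superset[of "keys f"] smul_sum smul_simps)
qed

lemma act_single: "act r (single b p) = smul p (Poly_Mapping.map Const (r b))"
  by (simp add: act_superset[of "{b}"])

lemma lookup_act: "lookup (act r f) c =
  (\<Sum>b\<in>keys f. lookup f b * Const (lookup (r b) c))"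
  by (simp add: act_def lookup_sum Poly_Mapping.map.rep_eq when_def)
    (intro sum.cong, auto)

text \<open>All free modules over polynomial rings as subsets of one type. Shrinking
  \<open>V\<close> records that a remainder has lost a variable.\<close>

definition free_part :: "'i set \<Rightarrow> 'v set \<Rightarrow> ('i \<Rightarrow>\<^sub>0 'v mpoly) set" where
  "free_part \<beta> V = {f. keys f \<subseteq> \<beta> \<and> (\<forall>b. indets (lookup f b) \<subseteq> V)}"

lemma free_part_0: "0 \<in> free_part \<beta> V"
  by (simp add: free_part_def)

lemma free_part_add: "f \<in> free_part \<beta> V \<Longrightarrow> g \<in> free_part \<beta> V \<Longrightarrow> f + g \<in> free_part \<beta> V"
  using keys_add[of f g] by (auto simp: free_part_def lookup_add dest!: indets_add[THEN subsetD])

lemma free_part_uminus: "f \<in> free_part \<beta> V \<Longrightarrow> - f \<in> free_part \<beta> V"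
  by (auto simp: free_part_def in_keys_iff)

lemma free_part_smul: "f \<in> free_part \<beta> V \<Longrightarrow> indets p \<subseteq> V \<Longrightarrow> smul p f \<in> free_part \<beta> V"
proof -
  assume "f \<in> free_part \<beta> V" "indets p \<subseteq> V"
  moreover have "keys (smul p f) \<subseteq> keys f" by (auto simp: in_keys_iff)
  ultimately show ?thesis by (auto simp: free_part_def dest!: indets_mult[THEN subsetD])
qed

lemma free_part_diff: "f \<in> free_part \<beta> V \<Longrightarrow> g \<in> free_part \<beta> V \<Longrightarrow> f - g \<in> free_part \<beta> V"
  using free_part_add[of f \<beta> V "- g"] free_part_uminus by auto

lemma free_part_act:
  assumes "\<And>b. b \<in> \<beta> \<Longrightarrow> keys (r b) \<subseteq> \<beta>" "f \<in> free_part \<beta> V"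
  shows "act r f \<in> free_part \<beta> V"
proof -
  have "c \<in> \<beta>" if "lookup (act r f) c \<noteq> 0" for c
  proof -
    have "\<exists>b\<in>keys f. lookup (r b) c \<noteq> 0"
    proof (rule ccontr)
      assume "\<not> ?thesis"
      then have "lookup (act r f) c = 0"
        unfolding lookup_act by (intro sum.neutral) auto
      then show False using that by simp
    qed
    then obtain b where b: "b \<in> keys f" "lookup (r b) c \<noteq> 0" by auto
    then have "b \<in> \<beta>" using assms(2) by (auto simp: free_part_def)
    then show ?thesis using assms(1)[of b] b(2) by (auto simp: in_keys_iff)
  qed
  moreover have "indets (lookup (act r f) c) \<subseteq> V" for c
    unfolding lookup_act using assms(2) by (intro indets_sum indets_closed) (auto simp: free_part_def)
  ultimately show ?thesis by (auto simp: free_part_def in_keys_iff)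
qed

locale koszul_free =
  fixes r :: "nat \<Rightarrow> 'i \<Rightarrow> 'i \<Rightarrow>\<^sub>0 rat"
  assumes act_commute: "act (r k) (act (r l) f) = act (r l) (act (r k) (f :: 'i \<Rightarrow>\<^sub>0 nat mpoly))"
begin

text \<open>The operator \<open>X \<otimes> 1 - 1 \<otimes> X\<close> in coordinates. Koszul indices
  start at 0 and variables at 1, hence \<open>Suc k\<close>.\<close>

definition phi :: "nat \<Rightarrow> ('i \<Rightarrow>\<^sub>0 nat mpoly) \<Rightarrow> 'i \<Rightarrow>\<^sub>0 nat mpoly" where
  "phi k f = smul (Var (Suc k)) f - act (r k) f"

definition N :: "nat \<Rightarrow> ('i \<Rightarrow>\<^sub>0 nat mpoly) set" where
  "N k = free_part UNIV (- {Suc k})"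

lemma phi_add': "phi k (f + g) = phi k f + phi k g"
  by (simp add: phi_def smul_simps act_add)

lemma phi_smul: "phi k (smul p f) = smul p (phi k f)"
  by (simp add: phi_def smul_simps act_smul smul_commute[of p])

lemma free_part_phi:
  assumes "\<And>b. b \<in> \<beta> \<Longrightarrow> keys (r k b) \<subseteq> \<beta>" "f \<in> free_part \<beta> V" "Suc k \<in> V"
  shows "phi k f \<in> free_part \<beta> V"
  unfolding phi_def using assms by (intro free_part_diff free_part_act free_part_smul) auto

text \<open>Division by a monic linear operator: modulo the image of \<open>phi k\<close> the
  variable may be replaced by the matrix \<open>r k\<close>, whose entries are rational, so the
  remainder does not regain the variable.\<close>

lemma division_in:
  assumes r: "\<And>b. b \<in> \<beta> \<Longrightarrow> keys (r k b) \<subseteq> \<beta>" and "y \<in> free_part \<beta> V"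
  shows "\<exists>n\<in>free_part \<beta> (V - {Suc k}). \<exists>q\<in>free_part \<beta> V. y = n + phi k q"
proof -
  let ?D = "\<lambda>y. \<exists>n\<in>free_part \<beta> (V - {Suc k}). \<exists>q\<in>free_part \<beta> V. y = n + phi k q"
  have mono: "free_part \<beta> (V - {Suc k}) \<subseteq> free_part \<beta> V"
    by (auto simp: free_part_def)
  have D_add: "?D (x + y)" if x: "?D x" and y: "?D y" for x y
  proof -
    obtain n q n' q' where "n \<in> free_part \<beta> (V - {Suc k})" "q \<in> free_part \<beta> V" "x = n + phi k q"
      "n' \<in> free_part \<beta> (V - {Suc k})" "q' \<in> free_part \<beta> V" "y = n' + phi k q'"
      using x y by auto
    then show ?thesis
      by (intro bexI[of _ "n + n'"] bexI[of _ "q + q'"]) (auto simp: phi_add' free_part_add)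
  qed
  have D_Var: "?D (smul (Var v) x)" if v: "v \<in> V" and x: "?D x" for v x
  proof -
    obtain n q where nq: "n \<in> free_part \<beta> (V - {Suc k})" "q \<in> free_part \<beta> V" "x = n + phi k q"
      using x by auto
    show ?thesis
    proof (cases "v = Suc k")
      case False
      then show ?thesis using nq v
        by (intro bexI[of _ "smul (Var v) n"] bexI[of _ "smul (Var v) q"])
          (auto simp: phi_smul smul_simps free_part_smul)
    next
      case True
      \<comment> \<open>The variable applied to the remainder \<open>n\<close> is
        \<open>act (r k) n + phi k n\<close>; the second summand joins the quotient.\<close>
      have "smul (Var v) x = act (r k) n + phi k (n + smul (Var v) q)"
        by (simp add: nq(3) phi_add' phi_smul smul_simps True) (simp add: phi_def)
      moreover have "act (r k) n \<in> free_part \<beta> (V - {Suc k})"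
        using r nq(1) by (rule free_part_act)
      moreover have "n + smul (Var v) q \<in> free_part \<beta> V"
        using nq mono v by (intro free_part_add free_part_smul) auto
      ultimately show ?thesis by blast
    qed
  qed
  have 0: "?D 0"
    by (intro bexI[of _ 0]) (auto simp: free_part_0 additive_0[of "phi _", OF phi_add'])
  have D_single: "?D (single b p)" if "b \<in> \<beta>" "indets p \<subseteq> V" for b p
    using that(2)
  proof (induction p rule: mpoly_induct)
    case (Const c)
    show ?case
      using that(1) by (intro bexI[of _ "single b (Const c)"] bexI[of _ 0])
        (auto simp: free_part_def additive_0[of "phi _", OF phi_add'] lookup_single when_def)
  next
    case (add p q)
    then show ?case using D_add by (simp add: single_add)
  next
    case (Var v p)
    then show ?case using D_Var[of v "single b p"] by (simp add: smul_simps)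
  qed
  have "keys y \<subseteq> \<beta>" using assms(2) by (simp add: free_part_def)
  then show ?thesis
  proof (induction y rule: poly_mapping_induct_keys)
    case (single b)
    then show ?case using assms(2) by (intro D_single) (auto simp: free_part_def)
  qed (use 0 D_add in blast)+
qed

text \<open>A term of \<open>q\<close> of highest degree in the variable is raised by one degree by
  \<open>phi k\<close>, and \<open>act (r k)\<close> cannot cancel it because it does not raise that
  degree. So the variable occurs in \<open>phi k q\<close> unless \<open>q = 0\<close>.\<close>

lemma phi_eq_0:
  assumes "phi k q \<in> N k"
  shows "q = 0"
proof (rule ccontr)
  assume "q \<noteq> 0"
  define A where "A = (\<Union>b\<in>keys q. (\<lambda>u. lookup u (Suc k)) ` keys (lookup q b))"
  have fin: "finite A" by (simp add: A_def)
  obtain b where "lookup q b \<noteq> 0"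
    using \<open>q \<noteq> 0\<close> by (metis lookup_zero poly_mapping_eqI)
  then have "A \<noteq> {}"
    by (auto simp: A_def in_keys_iff)
  then have "Max A \<in> A" using fin by simp
  then obtain b u where u: "lookup (lookup q b) u \<noteq> 0"
    "lookup u (Suc k) = Max A"
    by (auto simp: A_def in_keys_iff)
  let ?u = "single (Suc k) 1 + u"
  have "lookup (lookup q c) ?u = 0" for c
  proof (rule ccontr)
    assume *: "lookup (lookup q c) ?u \<noteq> 0"
    then have "c \<in> keys q" by (auto simp: in_keys_iff)
    with * have "lookup ?u (Suc k) \<in> A" by (force simp: A_def in_keys_iff)
    then have "lookup ?u (Suc k) \<le> Max A" using fin by simp
    then show False using u(2) by (simp add: lookup_add)
  qed
  then have "lookup (lookup (act (r k) q) b) ?u = 0"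
    by (simp add: lookup_act lookup_sum mult.commute[of _ "Const _"] lookup_Const_mult)
  then have "lookup (lookup (phi k q) b) ?u \<noteq> 0"
    using u(1) by (simp add: phi_def lookup_minus lookup_Var_mult_Suc[unfolded One_nat_def])
  moreover have "indets (lookup (phi k q) b) \<subseteq> - {Suc k}"
    using assms by (auto simp: N_def free_part_def)
  ultimately have "keys ?u \<subseteq> - {Suc k}"
    unfolding indets_subset_iff by blast
  then show False by (auto simp: in_keys_iff lookup_add)
qed

sublocale koszul_division phi N
proof
  show "phi k (phi l x) = phi l (phi k x)" for k l x
    by (simp add: phi_def smul_simps act_smul smul_commute[of "Var (Suc k)"] act_commute[of k]
      additive_diff[of "act _", OF act_add])
  show "phi k x \<in> N l" if "k \<noteq> l" "x \<in> N l" for k l x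
    using that unfolding N_def by (intro free_part_phi) auto
  show "\<exists>q. y - phi k q \<in> N k" for y k
  proof -
    obtain n q where "n \<in> free_part UNIV (UNIV - {Suc k})" "y = n + phi k q"
      using division_in[of UNIV k y UNIV] by (auto simp: free_part_def)
    then show ?thesis by (intro exI[of _ q]) (simp add: N_def Compl_eq_Diff_UNIV)
  qed
qed (use phi_add' free_part_diff phi_eq_0 in \<open>auto simp: N_def\<close>)

text \<open>\<open>quo\<close> is defined by division in the whole type; uniqueness identifies it
  with the division carried out inside \<open>free_part \<beta> V\<close>.\<close>

lemma division_mem:
  assumes r: "\<And>b. b \<in> \<beta> \<Longrightarrow> keys (r k b) \<subseteq> \<beta>" and "y \<in> free_part \<beta> V"
  shows "quo k y \<in> free_part \<beta> V" "rem k y \<in> free_part \<beta> (V - {Suc k})"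
proof -
  obtain n q where nq: "n \<in> free_part \<beta> (V - {Suc k})" "q \<in> free_part \<beta> V" "y = n + phi k q"
    using division_in[OF assms] by auto
  then have "quo k y = q" by (intro quo_unique) (auto simp: N_def free_part_def)
  then show "quo k y \<in> free_part \<beta> V" "rem k y \<in> free_part \<beta> (V - {Suc k})"
    using nq by (auto simp: rem_def)
qed

lemma ev_mem:
  assumes "\<And>b k. b \<in> \<beta> \<Longrightarrow> keys (r k b) \<subseteq> \<beta>" "y \<in> free_part \<beta> V"
  shows "ev j y \<in> free_part \<beta> (V - {1..j})"
proof (induction j)
  case (Suc j)
  have "V - {1..Suc j} = V - {1..j} - {Suc j}" by auto
  then show ?case using division_mem(2)[OF assms(1) Suc, of j] by simp
qed (use assms in simp)

end

section \<open>Free modules\<close>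

lemma abelian_group_free_module:
  assumes "cring R"
  shows "abelian_group (free_module R I)"
proof -
  interpret cring R by fact
  have fin: "finite {i. f i \<oplus>\<^bsub>R\<^esub> g i \<noteq> \<zero>\<^bsub>R\<^esub>}"
    if "finite {i. f i \<noteq> \<zero>\<^bsub>R\<^esub>}" "finite {i. g i \<noteq> \<zero>\<^bsub>R\<^esub>}" for f g :: "_ \<Rightarrow> _"
    by (rule finite_subset[OF _ finite_UnI[OF that]]) auto
  have mem: "f i \<in> carrier R" if "f \<in> carrier (free_module R I)" for f i
    using that by (cases "i \<in> I") (auto simp: free_module_def)
  show ?thesis
  proof (rule abelian_groupI)
    fix x assume x: "x \<in> carrier (free_module R I)"
    show "\<exists>y\<in>carrier (free_module R I). y \<oplus>\<^bsub>free_module R I\<^esub> x = \<zero>\<^bsub>free_module R I\<^esub>"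
    proof (intro bexI)
      show "(\<lambda>i. \<ominus>\<^bsub>R\<^esub> x i) \<oplus>\<^bsub>free_module R I\<^esub> x = \<zero>\<^bsub>free_module R I\<^esub>"
        using mem[OF x] by (auto simp: free_module_def l_neg)
      have "finite {i. \<ominus>\<^bsub>R\<^esub> x i \<noteq> \<zero>\<^bsub>R\<^esub>}"
        by (rule finite_subset[of _ "{i. x i \<noteq> \<zero>\<^bsub>R\<^esub>}"]) (use x in \<open>auto simp: free_module_def\<close>)
      then show "(\<lambda>i. \<ominus>\<^bsub>R\<^esub> x i) \<in> carrier (free_module R I)"
        using x by (auto simp: free_module_def)
    qed
  next
    fix x y assume "x \<in> carrier (free_module R I)" "y \<in> carrier (free_module R I)"
    with mem[OF this(1)] mem[OF this(2)] show "x \<oplus>\<^bsub>free_module R I\<^esub> y = y \<oplus>\<^bsub>free_module R I\<^esub> x"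
      by (auto simp: free_module_def a_comm)
  next
    fix x y z assume "x \<in> carrier (free_module R I)" "y \<in> carrier (free_module R I)" "z \<in> carrier (free_module R I)"
    with mem[OF this(1)] mem[OF this(2)] mem[OF this(3)]
    show "x \<oplus>\<^bsub>free_module R I\<^esub> y \<oplus>\<^bsub>free_module R I\<^esub> z = x \<oplus>\<^bsub>free_module R I\<^esub> (y \<oplus>\<^bsub>free_module R I\<^esub> z)"
      by (auto simp: free_module_def a_assoc)
  next
    fix x assume "x \<in> carrier (free_module R I)"
    with mem[OF this] show "\<zero>\<^bsub>free_module R I\<^esub> \<oplus>\<^bsub>free_module R I\<^esub> x = x"
      by (auto simp: free_module_def)
  qed (use fin in \<open>auto simp: free_module_def\<close>)
qed

lemma module_free_module:
  assumes "cring R"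
  shows "Module.module R (free_module R I)"
proof -
  interpret cring R by fact
  have mem: "f i \<in> carrier R" if "f \<in> carrier (free_module R I)" for f i
    using that by (cases "i \<in> I") (auto simp: free_module_def)
  show ?thesis
  proof (rule moduleI)
    show "abelian_group (free_module R I)" by (rule abelian_group_free_module) fact
    fix a x assume a: "a \<in> carrier R" and x: "x \<in> carrier (free_module R I)"
    have "finite {i. a \<otimes>\<^bsub>R\<^esub> x i \<noteq> \<zero>\<^bsub>R\<^esub>}"
      by (rule finite_subset[of _ "{i. x i \<noteq> \<zero>\<^bsub>R\<^esub>}"]) (use x a in \<open>auto simp: free_module_def\<close>)
    then show "a \<odot>\<^bsub>free_module R I\<^esub> x \<in> carrier (free_module R I)"
      using a x by (auto simp: free_module_def)
  next
    fix a b x assume "a \<in> carrier R" "b \<in> carrier R" and x: "x \<in> carrier (free_module R I)"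
    with mem[OF x] show "(a \<oplus>\<^bsub>R\<^esub> b) \<odot>\<^bsub>free_module R I\<^esub> x =
        a \<odot>\<^bsub>free_module R I\<^esub> x \<oplus>\<^bsub>free_module R I\<^esub> b \<odot>\<^bsub>free_module R I\<^esub> x"
      "(a \<otimes>\<^bsub>R\<^esub> b) \<odot>\<^bsub>free_module R I\<^esub> x = a \<odot>\<^bsub>free_module R I\<^esub> (b \<odot>\<^bsub>free_module R I\<^esub> x)"
      by (auto simp: free_module_def l_distr m_assoc)
  next
    fix a x y assume "a \<in> carrier R" and x: "x \<in> carrier (free_module R I)" and y: "y \<in> carrier (free_module R I)"
    with mem[OF x] mem[OF y] show "a \<odot>\<^bsub>free_module R I\<^esub> (x \<oplus>\<^bsub>free_module R I\<^esub> y) =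
        a \<odot>\<^bsub>free_module R I\<^esub> x \<oplus>\<^bsub>free_module R I\<^esub> a \<odot>\<^bsub>free_module R I\<^esub> y"
      by (auto simp: free_module_def r_distr)
  next
    fix x assume x: "x \<in> carrier (free_module R I)"
    with mem[OF x] show "\<one>\<^bsub>R\<^esub> \<odot>\<^bsub>free_module R I\<^esub> x = x"
      by (auto simp: free_module_def)
  qed fact
qed

text \<open>The required index set in the element type is the set of unit vectors.\<close>

lemma projective_free_module:
  fixes R (structure) and I :: "'i set"
  assumes "cring R" and "\<one> \<noteq> \<zero>"
  shows "projective R (free_module R I)"
  unfolding projective_def
proof (intro conjI module_free_module exI ballI)
  interpret cring R by fact
  define u where "u i = (\<lambda>j. if j = i then \<one> else \<zero>)" for i :: 'i
  have inj: "u i = u j \<longleftrightarrow> i = j" for i j using assms(2) by (auto simp: u_def fun_eq_iff split: if_splits)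
  define s where "s f h = (if h \<in> u ` I then f (THE i. h = u i) else \<zero>)" for f :: "'i \<Rightarrow> 'a" and h
  have s_in: "s f (u i) = f i" if "i \<in> I" for f i
    using that by (auto simp: s_def inj)
  have s_out: "s f h = \<zero>" if "h \<notin> u ` I" for f h
    using that by (simp add: s_def)
  let ?r = "\<lambda>g i. if i \<in> I then g (u i) else \<zero>"
  have fin_s: "finite {h. s f h \<noteq> \<zero>}" if "finite {i. f i \<noteq> \<zero>}" for f
    by (rule finite_subset[OF _ finite_imageI[OF that, of u]]) (auto simp: image_iff, metis s_in s_out imageE)
  have fin_r: "finite {i. ?r g i \<noteq> \<zero>}" if "finite {h. g h \<noteq> \<zero>}" for g :: "('i \<Rightarrow> 'a) \<Rightarrow> 'a"
    by (rule finite_subset[OF _ finite_vimageI[OF that, of u]]) (auto simp: inj inj_on_def)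
  have s_add: "s (\<lambda>i. f i \<oplus> g i) = (\<lambda>h. s f h \<oplus> s g h)" for f g
    by (rule ext, case_tac "h \<in> u ` I") (auto simp: s_in s_out)
  have s_smult: "s (\<lambda>i. a \<otimes> f i) = (\<lambda>h. a \<otimes> s f h)" if "a \<in> carrier R" for a f
    by (rule ext, case_tac "h \<in> u ` I") (auto simp: s_in s_out that)
  show "s \<in> linear_maps R (free_module R I) (free_module R (u ` I))"
    using fin_s s_out by (auto simp: linear_maps_def free_module_def s_add s_smult s_in)
  show "?r \<in> linear_maps R (free_module R (u ` I)) (free_module R I)"
    using fin_r by (auto simp: linear_maps_def free_module_def fun_eq_iff)
  show "?r (s x) = x" if "x \<in> carrier (free_module R I)" for x
    using that by (auto simp: free_module_def fun_eq_iff s_in)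
qed (use assms in auto)

section \<open>The Koszul resolution\<close>

lemmas fun_apply = plus_fun_apply zero_fun_apply minus_apply uminus_apply

declare fun_apply [simp del]

definition fscale :: "'v mpoly \<Rightarrow> ('b \<Rightarrow> 'v mpoly) \<Rightarrow> 'b \<Rightarrow> 'v mpoly" where
  "fscale p x = (\<lambda>b. p * x b)"

lemma fscale_simps:
  "fscale p (x + y) = fscale p x + fscale p y" "fscale (p + q) x = fscale p x + fscale q x"
  "fscale p (fscale q x) = fscale (p * q) x" "fscale 1 x = x" "fscale p 0 = 0" "fscale 0 x = 0"
  "fscale p (- x) = - fscale p x" "fscale p (x - y) = fscale p x - fscale p y"
  by (simp_all add: fscale_def fun_eq_iff fun_apply algebra_simps)

lemma fscale_sum: "fscale p (sum f A) = (\<Sum>a\<in>A. fscale p (f a))"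
  by (induction A rule: infinite_finite_induct) (auto simp: fscale_simps)

interpretation rat_fun: vector_space "\<lambda>c. fscale (Const c)"
  by unfold_locales (simp_all add: fscale_simps Const_add Const_mult)

text \<open>The module \<open>M\<close> is presented as a quotient of a set \<open>Z\<close> of functions, which lies in a type
  that is a rational vector space, so that the library's bases of vector spaces apply.\<close>

locale quotient_presentation =
  fixes m :: nat and M :: "(nat mpoly, 'm) module"
    and Z :: "('b \<Rightarrow> nat mpoly) set" and \<pi> :: "('b \<Rightarrow> nat mpoly) \<Rightarrow> 'm"
  assumes module_M: "Module.module (poly_ring {1..m}) M"
    and Z_0: "0 \<in> Z" and Z_add: "x \<in> Z \<Longrightarrow> y \<in> Z \<Longrightarrow> x + y \<in> Z"
    and Z_scale: "indets p \<subseteq> {1..m} \<Longrightarrow> x \<in> Z \<Longrightarrow> fscale p x \<in> Z"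
    and pi_onto: "\<pi> ` Z = carrier M"
    and pi_add: "x \<in> Z \<Longrightarrow> y \<in> Z \<Longrightarrow> \<pi> (x + y) = \<pi> x \<oplus>\<^bsub>M\<^esub> \<pi> y"
    and pi_scale: "indets p \<subseteq> {1..m} \<Longrightarrow> x \<in> Z \<Longrightarrow> \<pi> (fscale p x) = p \<odot>\<^bsub>M\<^esub> \<pi> x"
begin

sublocale M: Module.module "poly_ring {1..m}" M by (rule module_M)

lemma pi_mem: "x \<in> Z \<Longrightarrow> \<pi> x \<in> carrier M"
  using pi_onto by blast

lemma Z_uminus: "x \<in> Z \<Longrightarrow> - x \<in> Z"
  using Z_scale[of "- 1" x] by (simp add: fscale_def fun_Compl_def)

lemma Z_diff: "x \<in> Z \<Longrightarrow> y \<in> Z \<Longrightarrow> x - y \<in> Z"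
  using Z_add[of x "- y"] Z_uminus by simp

lemma Z_sum: "(\<And>a. a \<in> A \<Longrightarrow> f a \<in> Z) \<Longrightarrow> sum f A \<in> Z"
  by (induction A rule: infinite_finite_induct) (auto simp: Z_0 Z_add)

definition K where "K = {z \<in> Z. \<pi> z = \<zero>\<^bsub>M\<^esub>}"

lemma pi_0: "\<pi> 0 = \<zero>\<^bsub>M\<^esub>"
  using pi_add[OF Z_0 Z_0] pi_mem[OF Z_0] by (metis M.add.r_cancel_one' add_0)

lemma pi_uminus: "x \<in> Z \<Longrightarrow> \<pi> (- x) = \<ominus>\<^bsub>M\<^esub> \<pi> x"
  using pi_add[of "- x" x] pi_0 pi_mem Z_uminus by (metis M.minus_equality ab_left_minus)

lemma pi_diff: "x \<in> Z \<Longrightarrow> y \<in> Z \<Longrightarrow> \<pi> (x - y) = \<pi> x \<ominus>\<^bsub>M\<^esub> \<pi> y"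
  using pi_add[of x "- y"] by (simp add: pi_uminus Z_uminus M.minus_eq)

lemma pi_eq_iff: "x \<in> Z \<Longrightarrow> y \<in> Z \<Longrightarrow> \<pi> x = \<pi> y \<longleftrightarrow> x - y \<in> K"
proof -
  assume "x \<in> Z" "y \<in> Z"
  then have "\<pi> (x - y) = \<zero>\<^bsub>M\<^esub> \<longleftrightarrow> \<pi> x = \<pi> y"
    using pi_mem by (simp add: pi_diff M.minus_eq) (metis M.add.inv_closed M.add.inv_inv M.minus_equality M.r_neg)
  then show ?thesis using Z_diff \<open>x \<in> Z\<close> \<open>y \<in> Z\<close> by (auto simp: K_def)
qed

lemma K_add: "x \<in> K \<Longrightarrow> y \<in> K \<Longrightarrow> x + y \<in> K"
  by (auto simp: K_def Z_add pi_add)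

lemma K_scale: "indets p \<subseteq> {1..m} \<Longrightarrow> x \<in> K \<Longrightarrow> fscale p x \<in> K"
  by (auto simp: K_def Z_scale pi_scale) (simp add: M.smult_r_null poly_ring_def)

lemma K_0: "0 \<in> K" by (simp add: K_def Z_0 pi_0)

end

text \<open>\<open>\<Gamma>\<close> indexes a rational basis of \<open>M\<close> and is taken inside
  \<open>M\<close>, because the modules of a resolution must consist of functions on
  \<open>nat \<times> 'm\<close>. \<open>e\<close> lifts this basis to \<open>Z\<close>, and
  \<open>\<kappa>\<close> reads off the coordinates of the class of a vector.\<close>

locale quotient_coordinates = quotient_presentation m M Z \<pi>
  for m :: nat and M :: "(nat mpoly, 'm) module"
    and Z :: "('b \<Rightarrow> nat mpoly) set" and \<pi> :: "('b \<Rightarrow> nat mpoly) \<Rightarrow> 'm" +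
  fixes \<Gamma> :: "'m set" and e :: "'m \<Rightarrow> 'b \<Rightarrow> nat mpoly" and \<kappa> :: "('b \<Rightarrow> nat mpoly) \<Rightarrow> 'm \<Rightarrow>\<^sub>0 rat"
  assumes e_mem: "c \<in> \<Gamma> \<Longrightarrow> e c \<in> Z"
    and kappa_keys: "z \<in> Z \<Longrightarrow> keys (\<kappa> z) \<subseteq> \<Gamma>"
    and kappa_add: "x \<in> Z \<Longrightarrow> y \<in> Z \<Longrightarrow> \<kappa> (x + y) = \<kappa> x + \<kappa> y"
    and kappa_scale: "x \<in> Z \<Longrightarrow> \<kappa> (fscale (Const a) x) = Poly_Mapping.map ((*) a) (\<kappa> x)"
    and kappa_K: "x \<in> K \<Longrightarrow> \<kappa> x = 0"
    and kappa_e: "c \<in> \<Gamma> \<Longrightarrow> \<kappa> (e c) = single c 1"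
    and kappa_sum: "z \<in> Z \<Longrightarrow>
      z - (\<Sum>c\<in>keys (\<kappa> z). fscale (Const (lookup (\<kappa> z) c)) (e c)) \<in> K"

text \<open>A rational basis \<open>B0\<close> of \<open>K\<close> extends to a basis
  \<open>B\<close> of \<open>Z\<close>. The classes of \<open>B - B0\<close> form a basis of the
  quotient, and the coordinates of a class are the coordinates outside \<open>B0\<close>.\<close>

lemma (in quotient_presentation) quotient_coordinates_exist:
  "\<exists>\<Gamma> e \<kappa>. quotient_coordinates m M Z \<pi> \<Gamma> e \<kappa>"
proof -
  have sub_K: "rat_fun.subspace K"
    by (simp add: rat_fun.subspace_def K_0 K_add K_scale)
  obtain B0 where B0: "B0 \<subseteq> K" "rat_fun.independent B0" "K \<subseteq> rat_fun.span B0"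
    by (rule rat_fun.maximal_independent_subset)
  have "B0 \<subseteq> Z" using B0(1) by (auto simp: K_def)
  then obtain B where B: "B0 \<subseteq> B" "B \<subseteq> Z" "rat_fun.independent B" "Z \<subseteq> rat_fun.span B"
    using B0(2) by (rule rat_fun.maximal_independent_subset_extend)
  define rep where "rep = rat_fun.representation B"
  have rep_add: "rep (x + y) b = rep x b + rep y b" if "x \<in> Z" "y \<in> Z" for x y b
    unfolding rep_def using that B(4) by (subst rat_fun.representation_add[OF B(3)]) auto
  have rep_scale: "rep (fscale (Const a) x) b = a * rep x b" if "x \<in> Z" for x a b
    unfolding rep_def using that B(4) by (subst rat_fun.representation_scale[OF B(3)]) auto
  have rep_K: "rep x b = 0" if "x \<in> K" "b \<in> B - B0" for x b
  proof -
    have "rep x = rat_fun.representation B0 x"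
      unfolding rep_def using that(1) B0(3) by (intro rat_fun.representation_extend B) auto
    then show ?thesis using that(2) rat_fun.representation_ne_zero[of B0 x b] by auto
  qed
  have rep_basis: "rep b b' = (if b' = b then 1 else 0)" if "b \<in> B" for b b'
    unfolding rep_def by (subst rat_fun.representation_basis[OF B(3) that]) simp
  have fin: "finite {b. rep z b \<noteq> 0}" for z
    unfolding rep_def by (rule rat_fun.finite_representation)
  \<comment> \<open>Distinct basis vectors outside \<open>B0\<close> have distinct classes, so the
    classes can serve as labels.\<close>
  have inj: "inj_on \<pi> (B - B0)"
  proof (rule inj_onI)
    fix b b' assume b: "b \<in> B - B0" "b' \<in> B - B0" "\<pi> b = \<pi> b'"
    then have "b - b' \<in> K" using pi_eq_iff[of b b'] B(2) by auto
    moreover have "rep b b = rep (b - b') b + rep b' b"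
      using rep_add[of "b - b'" b' b] b B(2) Z_diff[of b b'] by auto
    ultimately have "rep b b = rep b' b" using rep_K b by auto
    then show "b = b'" using rep_basis b by (auto split: if_splits)
  qed
  define \<Gamma> where "\<Gamma> = \<pi> ` (B - B0)"
  define e where "e = inv_into (B - B0) \<pi>"
  define \<kappa> where "\<kappa> z = Abs_poly_mapping (\<lambda>c. if c \<in> \<Gamma> then rep z (e c) else 0)" for z
  have e_B: "e c \<in> B - B0" if "c \<in> \<Gamma>" for c
    using that unfolding e_def \<Gamma>_def by (rule inv_into_into)
  have pi_e: "\<pi> (e c) = c" if "c \<in> \<Gamma>" for c
    using that unfolding e_def \<Gamma>_def by (rule f_inv_into_f)
  have e_pi: "e (\<pi> b) = b" if "b \<in> B - B0" for b
    using inj that unfolding e_def by (rule inv_into_f_f)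
  have "finite {c. (if c \<in> \<Gamma> then rep z (e c) else 0) \<noteq> 0}" for z
    by (rule finite_subset[OF _ finite_imageI[OF fin[of z], of \<pi>]])
      (auto simp: image_iff pi_e split: if_splits intro!: exI[of _ "e _"])
  then have lookup_kappa: "lookup (\<kappa> z) = (\<lambda>c. if c \<in> \<Gamma> then rep z (e c) else 0)" for z
    unfolding \<kappa>_def by (rule lookup_Abs_poly_mapping)
  have keys: "keys (\<kappa> z) = {c\<in>\<Gamma>. rep z (e c) \<noteq> 0}" for z
    by (auto simp: in_keys_iff lookup_kappa split: if_splits)
  have "quotient_coordinates m M Z \<pi> \<Gamma> e \<kappa>"
  proof
    show "z - (\<Sum>c\<in>keys (\<kappa> z). fscale (Const (lookup (\<kappa> z) c)) (e c)) \<in> K"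
      if z: "z \<in> Z" for z
    proof -
      let ?S = "{b. rep z b \<noteq> 0}"
      have S: "?S \<subseteq> B" using rat_fun.representation_ne_zero by (auto simp: rep_def)
      have "(\<Sum>c\<in>keys (\<kappa> z). fscale (Const (lookup (\<kappa> z) c)) (e c))
          = (\<Sum>b\<in>?S - B0. fscale (Const (rep z b)) b)"
        by (rule sum.reindex_bij_witness[of _ \<pi> e])
          (use S e_B pi_e e_pi in \<open>auto simp: keys lookup_kappa \<Gamma>_def\<close>)
      moreover have "z = (\<Sum>b\<in>?S. fscale (Const (rep z b)) b)"
        unfolding rep_def using z B(4)
        by (intro rat_fun.sum_nonzero_representation_eq[OF B(3), symmetric]) auto
      moreover have "\<dots> = (\<Sum>b\<in>?S - B0. fscale (Const (rep z b)) b) + (\<Sum>b\<in>?S \<inter> B0. fscale (Const (rep z b)) b)"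
        using fin[of z] by (metis (no_types, lifting) add.commute sum.Int_Diff)
      moreover have "(\<Sum>b\<in>?S \<inter> B0. fscale (Const (rep z b)) b) \<in> K"
        using B0(1) by (intro rat_fun.subspace_sum sub_K rat_fun.subspace_scale) auto
      ultimately show ?thesis by (metis (no_types, lifting) add_diff_cancel_left')
    qed
    show "\<kappa> (e c) = single c 1" if c: "c \<in> \<Gamma>" for c
    proof (rule poly_mapping_eqI)
      fix c'
      have "e c' = e c \<longleftrightarrow> c' = c" if "c' \<in> \<Gamma>" using pi_e[OF that] pi_e[OF c] by metis
      moreover have "rep (e c) (e c') = (if e c' = e c then 1 else 0)"
        using e_B[OF c] by (intro rep_basis) simp
      ultimately show "lookup (\<kappa> (e c)) c' = lookup (single c 1) c'"
        using c by (cases "c' = c"; cases "c' \<in> \<Gamma>") (simp_all add: lookup_kappa lookup_single when_def)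
    qed
    show "\<kappa> (fscale (Const a) x) = Poly_Mapping.map ((*) a) (\<kappa> x)" if "x \<in> Z" for a x
      by (rule poly_mapping_eqI) (simp add: lookup_kappa Poly_Mapping.map.rep_eq when_def rep_scale that)
    show "\<kappa> (x + y) = \<kappa> x + \<kappa> y" if "x \<in> Z" "y \<in> Z" for x y
      by (rule poly_mapping_eqI) (simp add: lookup_kappa lookup_add rep_add that)
    show "\<kappa> x = 0" if "x \<in> K" for x
      by (rule poly_mapping_eqI) (simp add: lookup_kappa rep_K[OF that e_B])
    show "e c \<in> Z" if "c \<in> \<Gamma>" for c
      using e_B[OF that] B(2) by blast
    show "keys (\<kappa> z) \<subseteq> \<Gamma>" for z
      by (simp add: keys)
  qed
  then show ?thesis by blast
qed

section \<open>The Koszul operators of a module in rational coordinates\<close>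

lemma lookup_map_Const: "lookup (Poly_Mapping.map Const f) c = Const (lookup f c)"
  by (simp add: Poly_Mapping.map.rep_eq when_def)

lemma map_Const_simps:
  "Poly_Mapping.map Const (f + g) = Poly_Mapping.map Const f + Poly_Mapping.map Const g"
  "Poly_Mapping.map Const (Poly_Mapping.map ((*) a) f) = smul (Const a) (Poly_Mapping.map Const f)"
  "Poly_Mapping.map Const 0 = 0"
  "Poly_Mapping.map Const (single c 1) = single c 1"
proof -
  have "lookup (Poly_Mapping.map ((*) a) f) c = a * lookup f c" for c
    by (simp add: Poly_Mapping.map.rep_eq when_def)
  then show "Poly_Mapping.map Const (Poly_Mapping.map ((*) a) f) = smul (Const a) (Poly_Mapping.map Const f)"
    by (intro poly_mapping_eqI) (simp add: lookup_map_Const Const_mult)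
qed (rule poly_mapping_eqI, simp add: lookup_map_Const lookup_add Const_add lookup_single when_def)+

lemma keys_map_Const [simp]: "keys (Poly_Mapping.map Const f) = keys f"
  by (auto simp: in_keys_iff lookup_map_Const)
    (metis Const_0 Const_eq_iff)

lemma map_Const_sum: "Poly_Mapping.map Const (sum f A) = (\<Sum>a\<in>A. Poly_Mapping.map Const (f a))"
  by (induction A rule: infinite_finite_induct) (auto simp: map_Const_simps)

context quotient_coordinates
begin

text \<open>The matrix of a variable acting on \<open>M\<close>. The value 0 outside the range lets
  the matrices commute for all indices, as \<open>koszul_free\<close> demands.\<close>

definition r :: "nat \<Rightarrow> 'm \<Rightarrow> 'm \<Rightarrow>\<^sub>0 rat" where
  "r k c = (if k < m \<and> c \<in> \<Gamma> then \<kappa> (fscale (Var (Suc k)) (e c)) else 0)"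

text \<open>A lift to \<open>Z\<close> of the multiplication map from polynomials tensor
  \<open>M\<close> to \<open>M\<close>, which is the augmentation of the resolution.\<close>

definition lin :: "('m \<Rightarrow>\<^sub>0 nat mpoly) \<Rightarrow> 'b \<Rightarrow> nat mpoly" where
  "lin f = (\<Sum>c\<in>keys f. fscale (lookup f c) (e c))"

lemma lin_superset:
  assumes "finite B" "keys f \<subseteq> B"
  shows "lin f = (\<Sum>c\<in>B. fscale (lookup f c) (e c))"
  unfolding lin_def using assms by (intro sum.mono_neutral_left) (auto simp: in_keys_iff fscale_simps)

lemma lin_add: "lin (f + g) = lin f + lin g"
proof -
  let ?B = "keys f \<union> keys g"
  have "finite ?B" "keys (f + g) \<subseteq> ?B" by (simp_all add: keys_add)
  then show ?thesis
    by (simp add: lin_superset[of ?B] lookup_add fscale_simps sum.distrib)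
qed

lemma lin_smul: "lin (smul p f) = fscale p (lin f)"
proof -
  have "keys (smul p f) \<subseteq> keys f" by (auto simp: in_keys_iff)
  then show ?thesis
    by (simp add: lin_superset[of "keys f"] fscale_sum fscale_simps)
qed

lemma lin_mem: "f \<in> free_part \<Gamma> {1..m} \<Longrightarrow> lin f \<in> Z"
  unfolding lin_def by (intro Z_sum Z_scale e_mem) (auto simp: free_part_def)

lemma kappa_0: "\<kappa> 0 = 0"
  using kappa_K[OF K_0] .

lemma kappa_Sum: "(\<And>a. a \<in> A \<Longrightarrow> f a \<in> Z) \<Longrightarrow> \<kappa> (sum f A) = (\<Sum>a\<in>A. \<kappa> (f a))"
  by (induction A rule: infinite_finite_induct) (auto simp: kappa_0 kappa_add Z_sum)

lemma lin_kappa: "z \<in> Z \<Longrightarrow> z - lin (Poly_Mapping.map Const (\<kappa> z)) \<in> K"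
  using kappa_sum[of z] by (simp add: lin_def lookup_map_Const)

lemma free_part_kappa: "z \<in> Z \<Longrightarrow> Poly_Mapping.map Const (\<kappa> z) \<in> free_part \<Gamma> V"
  using kappa_keys[of z] by (auto simp: free_part_def lookup_map_Const)

lemma kappa_cong: "x \<in> Z \<Longrightarrow> x - y \<in> K \<Longrightarrow> \<kappa> x = \<kappa> y"
proof -
  assume x: "x \<in> Z" "x - y \<in> K"
  then have "y \<in> Z" using Z_diff[of x "x - y"] by (simp add: K_def)
  then show ?thesis using kappa_add[of "x - y" y] x by (simp add: K_def kappa_K)
qed

text \<open>\<open>K\<close> is stable under the variables, so the coordinates of the variable times
  \<open>z\<close> depend only on the coordinates of \<open>z\<close>, and they do so through
  \<open>r k\<close>.\<close>

lemma act_kappa: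
  assumes "k < m" "z \<in> Z"
  shows "act (r k) (Poly_Mapping.map Const (\<kappa> z)) = Poly_Mapping.map Const (\<kappa> (fscale (Var (Suc k)) z))"
proof -
  let ?X = "Var (Suc k) :: nat mpoly"
  have X: "indets ?X \<subseteq> {1..m}" using assms(1) by simp
  have keys: "c \<in> \<Gamma>" if "c \<in> keys (\<kappa> z)" for c using kappa_keys[OF assms(2)] that by blast
  have mem: "fscale (Const a) (fscale ?X (e c)) \<in> Z" if "c \<in> \<Gamma>" for a c
    by (intro Z_scale X e_mem that) simp
  have swap: "fscale ?X (fscale (Const a) x) = fscale (Const a) (fscale ?X x)" for a x
    by (simp add: fscale_simps mult.commute)
  have "fscale ?X z - fscale ?X (lin (Poly_Mapping.map Const (\<kappa> z))) \<in> K"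
    using K_scale[OF X lin_kappa[OF assms(2)]] by (simp add: fscale_simps)
  then have "\<kappa> (fscale ?X z) = \<kappa> (fscale ?X (lin (Poly_Mapping.map Const (\<kappa> z))))"
    by (intro kappa_cong Z_scale X assms)
  also have "\<dots> = (\<Sum>c\<in>keys (\<kappa> z). \<kappa> (fscale (Const (lookup (\<kappa> z) c)) (fscale ?X (e c))))"
    using keys by (simp add: lin_def fscale_sum lookup_map_Const) (simp add: kappa_Sum mem swap)
  also have "\<dots> = (\<Sum>c\<in>keys (\<kappa> z). Poly_Mapping.map ((*) (lookup (\<kappa> z) c)) (\<kappa> (fscale ?X (e c))))"
    using X keys by (intro sum.cong refl kappa_scale Z_scale e_mem)
  finally show ?thesis
    using assms(1) keys by (simp add: act_def map_Const_sum map_Const_simps lookup_map_Const r_def)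
qed

lemma keys_r: "keys (r k c) \<subseteq> \<Gamma>"
  unfolding r_def using kappa_keys[of "fscale (Var (Suc k)) (e c)"] Z_scale[of "Var (Suc k)" "e c"] e_mem
  by (auto simp: subset_iff)

text \<open>On a basis element both orders give the coordinates of the product of the two variables
  times \<open>e c\<close>.\<close>

lemma act_r_commute: "act (r k) (act (r l) f) = act (r l) (act (r k) (f :: 'm \<Rightarrow>\<^sub>0 nat mpoly))"
proof (induction f rule: poly_mapping_induct_add)
  case (single c p)
  have zero: "act (\<lambda>c. 0) g = 0" for g :: "'m \<Rightarrow>\<^sub>0 nat mpoly"
    by (simp add: act_def map_Const_simps smul_simps)
  have r0: "r i = (\<lambda>c. 0)" if "\<not> i < m" for i using that by (auto simp: r_def)
  show ?case
  proof (cases "k < m \<and> l < m")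
    case True
    have *: "act (r i) (act (r j) (single c p)) =
      smul p (Poly_Mapping.map Const (\<kappa> (fscale (Var (Suc i) * Var (Suc j)) (e c))))"
      if "i < m" "j < m" "c \<in> \<Gamma>" for i j
      using that by (simp add: act_single act_smul r_def[of j] act_kappa Z_scale e_mem fscale_simps)
    show ?thesis
    proof (cases "c \<in> \<Gamma>")
      case c: True
      then show ?thesis using True *[of k l] *[of l k] by (simp add: mult.commute)
    next
      case False
      then show ?thesis
        by (simp add: act_single r_def[of _ c] map_Const_simps smul_simps additive_0[of "act _", OF act_add])
    qed
  next
    case False
    then show ?thesis by (auto simp: r0 zero additive_0[of "act _", OF act_add])
  qed
qed (simp_all add: act_add additive_0[of "act _", OF act_add])

sublocale koszul_free r
  by unfold_locales (rule act_r_commute)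

text \<open>The variable times \<open>e c\<close> and the lift of its coordinates have the same
  class. Hence the augmentation kills boundaries.\<close>

lemma lin_phi:
  assumes "k < m" "f \<in> free_part \<Gamma> {1..m}"
  shows "lin (phi k f) \<in> K"
proof -
  let ?X = "Var (Suc k) :: nat mpoly"
  have X: "indets ?X \<subseteq> {1..m}" using assms(1) by simp
  have "keys f \<subseteq> \<Gamma>" using assms(2) by (simp add: free_part_def)
  then show ?thesis
  proof (induction f rule: poly_mapping_induct_keys)
    case (single c)
    let ?p = "lookup f c"
    have p: "indets ?p \<subseteq> {1..m}" using assms(2) by (auto simp: free_part_def)
    have "phi k (single c ?p) = smul ?p (smul ?X (single c 1) - Poly_Mapping.map Const (r k c))"
      by (simp add: phi_def act_single smul_simps mult.commute)
    moreover have "lin (single c 1) = e c"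
      using lin_superset[of "{c}" "single c 1"] by (simp add: fscale_simps)
    ultimately have "lin (phi k (single c ?p)) =
      fscale ?p (fscale ?X (e c) - lin (Poly_Mapping.map Const (\<kappa> (fscale ?X (e c)))))"
      using single assms(1) by (simp add: lin_smul additive_diff[of lin, OF lin_add] r_def)
    then show ?case
      using single X p by (auto intro!: K_scale lin_kappa Z_scale e_mem)
  qed (simp_all add: phi_add' lin_add K_add K_0 additive_0[of "phi _", OF phi_add'] additive_0[of lin, OF lin_add])
qed

text \<open>The augmentation is injective on constant coefficients, so the remainders left after
  dividing out all variables form a copy of the module.\<close>

lemma kappa_lin:
  assumes "f \<in> free_part \<Gamma> {}"
  shows "Poly_Mapping.map Const (\<kappa> (lin f)) = f"
proof -
  have "keys f \<subseteq> \<Gamma>" using assms(1) by (simp add: free_part_def)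
  then have "lin f \<in> Z \<and> Poly_Mapping.map Const (\<kappa> (lin f)) = f"
  proof (induction f rule: poly_mapping_induct_keys)
    case (single c)
    have "indets (lookup f c) \<subseteq> {}"
      using assms unfolding free_part_def by blast
    then obtain a where a: "lookup f c = Const a"
      using indets_empty_imp_Const by blast
    have "lin (single c (Const a)) = fscale (Const a) (e c)"
      by (subst lin_superset[of "{c}"]) auto
    then show ?case
      using single by (simp add: a kappa_scale e_mem Z_scale kappa_e map_Const_simps smul_simps)
  qed (auto simp: lin_add kappa_add map_Const_simps Z_add Z_0 kappa_0 additive_0[of lin, OF lin_add])
  then show ?thesis by simp
qed

end

section \<open>The Koszul complex as a complex of free modules\<close>

declare One_nat_def [simp del]

lemma poly_mapping_nonzeroE:
  assumes "f \<noteq> 0"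
  obtains k where "lookup f k \<noteq> 0"
  using assms by (metis lookup_zero poly_mapping_eqI)

context quotient_coordinates
begin

definition chains :: "nat \<Rightarrow> (nat set \<Rightarrow> 'm \<Rightarrow>\<^sub>0 nat mpoly) set" where
  "chains i = {z. (\<forall>S. z S \<in> free_part \<Gamma> {1..m}) \<and> (\<forall>S. z S \<noteq> 0 \<longrightarrow> S \<subseteq> {..<m} \<and> card S = i)}"

text \<open>Basis of the Koszul module of degree \<open>i\<close>. Exterior monomials are coded as
  numbers to fit the element type prescribed for resolutions.\<close>

definition index :: "nat \<Rightarrow> (nat \<times> 'm) set" where
  "index i = {(set_encode S, c) | S c. S \<subseteq> {..<m} \<and> card S = i \<and> c \<in> \<Gamma>}"

definition P :: "nat \<Rightarrow> (nat mpoly, nat \<times> 'm \<Rightarrow> nat mpoly) module" where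
  "P i = free_module (poly_ring {1..m}) (index i)"

lemma P_simps:
  "(f \<oplus>\<^bsub>P i\<^esub> g) x = f x + g x" "(p \<odot>\<^bsub>P i\<^esub> f) x = p * f x" "\<zero>\<^bsub>P i\<^esub> x = 0"
  by (simp_all add: P_def free_module_def poly_ring_def)

lemma module_P: "Module.module (poly_ring {1..m}) (P i)"
  unfolding P_def by (rule module_free_module[OF cring_poly_ring])

definition enc :: "(nat set \<Rightarrow> 'm \<Rightarrow>\<^sub>0 nat mpoly) \<Rightarrow> nat \<times> 'm \<Rightarrow> nat mpoly" where
  "enc z = (\<lambda>(n, c). lookup (z (set_decode n)) c)"

text \<open>\<open>set_encode\<close> is faithful only on finite sets. On infinite sets the value 0
  agrees with that of every chain.\<close>

definition dec :: "(nat \<times> 'm \<Rightarrow> nat mpoly) \<Rightarrow> nat set \<Rightarrow> 'm \<Rightarrow>\<^sub>0 nat mpoly" where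
  "dec f S = (if finite S then Abs_poly_mapping (\<lambda>c. f (set_encode S, c)) else 0)"

lemma carrier_P: "f \<in> carrier (P i) \<longleftrightarrow>
    (\<forall>x. indets (f x) \<subseteq> {1..m}) \<and> (\<forall>x. x \<notin> index i \<longrightarrow> f x = 0) \<and> finite {x. f x \<noteq> 0}"
  unfolding P_def free_module_def poly_ring_def by (auto; metis empty_iff indets_0)

lemma lookup_dec:
  assumes "f \<in> carrier (P i)"
  shows "lookup (dec f S) c = (if finite S then f (set_encode S, c) else 0)"
proof -
  have "finite {x. f x \<noteq> 0}" using assms by (simp add: carrier_P)
  then have "finite {c. f (set_encode S, c) \<noteq> 0}"
    using finite_vimageI[of _ "Pair (set_encode S)"] by (fastforce simp: inj_on_def vimage_def)
  then show ?thesis by (simp add: dec_def)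
qed

lemma dec_chains:
  assumes "f \<in> carrier (P i)"
  shows "dec f \<in> chains i"
proof -
  have *: "S \<subseteq> {..<m} \<and> card S = i \<and> c \<in> \<Gamma>" if "lookup (dec f S) c \<noteq> 0" for S c
  proof -
    have S: "finite S" "f (set_encode S, c) \<noteq> 0"
      using that by (auto simp: lookup_dec[OF assms] split: if_splits)
    then have "(set_encode S, c) \<in> index i" using assms by (auto simp: carrier_P)
    then obtain T where "set_encode S = set_encode T" "T \<subseteq> {..<m}" "card T = i" "c \<in> \<Gamma>"
      by (auto simp: index_def)
    then show ?thesis using S(1) by (metis finite_lessThan finite_subset set_encode_inverse)
  qed
  have "dec f S \<in> free_part \<Gamma> {1..m}" for S
    using *[of S] assms by (auto simp: free_part_def in_keys_iff lookup_dec[OF assms] carrier_P)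
  moreover have "S \<subseteq> {..<m} \<and> card S = i" if nz: "dec f S \<noteq> 0" for S
  proof -
    obtain c where "lookup (dec f S) c \<noteq> 0"
      using nz by (rule poly_mapping_nonzeroE)
    then show ?thesis using * by blast
  qed
  ultimately show ?thesis by (simp add: chains_def)
qed

lemma enc_carrier:
  assumes "z \<in> chains i"
  shows "enc z \<in> carrier (P i)"
proof -
  have z: "z S \<in> free_part \<Gamma> {1..m}" and z': "z S \<noteq> 0 \<Longrightarrow> S \<subseteq> {..<m} \<and> card S = i" for S
    using assms by (auto simp: chains_def)
  have "{x. enc z x \<noteq> 0} \<subseteq> (\<Union>S\<in>Pow {..<m}. (\<lambda>c. (set_encode S, c)) ` keys (z S))"
  proof
    fix x assume "x \<in> {x. enc z x \<noteq> 0}"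
    then obtain n c where x: "x = (n, c)" "lookup (z (set_decode n)) c \<noteq> 0"
      by (cases x) (auto simp: enc_def)
    then have "z (set_decode n) \<noteq> 0" by (metis lookup_zero)
    then have "set_decode n \<subseteq> {..<m}" using z' by blast
    moreover have "x \<in> (\<lambda>c. (set_encode (set_decode n), c)) ` keys (z (set_decode n))"
      using x by (auto simp: in_keys_iff)
    ultimately show "x \<in> (\<Union>S\<in>Pow {..<m}. (\<lambda>c. (set_encode S, c)) ` keys (z S))"
      by blast
  qed
  then have "finite {x. enc z x \<noteq> 0}" by (rule finite_subset) auto
  moreover have "x \<in> index i" if nz: "enc z x \<noteq> 0" for x
  proof -
    obtain n c where x: "x = (n, c)" "lookup (z (set_decode n)) c \<noteq> 0"
      using nz by (cases x) (auto simp: enc_def)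
    then have "c \<in> \<Gamma>" using z[of "set_decode n"] by (auto simp: free_part_def in_keys_iff)
    then show ?thesis using x z'[of "set_decode n"] unfolding index_def
      by (metis (mono_tags, lifting) lookup_zero mem_Collect_eq set_decode_inverse)
  qed
  moreover have "indets (enc z x) \<subseteq> {1..m}" for x
    using z[of "set_decode (fst x)"] by (cases x) (simp add: enc_def free_part_def)
  ultimately show ?thesis unfolding carrier_P by blast
qed

lemma dec_enc:
  assumes "z \<in> chains i"
  shows "dec (enc z) = z"
proof
  fix S
  have inf: "z S = 0" if "infinite S"
    using that assms finite_subset[of S "{..<m}"] by (auto simp: chains_def)
  show "dec (enc z) S = z S"
    by (rule poly_mapping_eqI) (simp add: lookup_dec[OF enc_carrier[OF assms]] inf, simp add: enc_def)
qed

lemma enc_dec: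
  assumes "f \<in> carrier (P i)"
  shows "enc (dec f) = f"
  by (rule ext) (auto simp: enc_def lookup_dec[OF assms])

lemma dec_add:
  assumes "f \<in> carrier (P i)" "g \<in> carrier (P i)"
  shows "dec (f \<oplus>\<^bsub>P i\<^esub> g) = (\<lambda>S. dec f S + dec g S)"
proof (rule ext, rule poly_mapping_eqI)
  interpret F: Module.module "poly_ring {1..m}" "P i" by (rule module_P)
  fix S c
  show "lookup (dec (f \<oplus>\<^bsub>P i\<^esub> g) S) c = lookup (dec f S + dec g S) c"
    unfolding lookup_add lookup_dec[OF assms(1)] lookup_dec[OF assms(2)] lookup_dec[OF F.a_closed[OF assms]] P_simps
    by simp
qed

lemma dec_smult:
  assumes "f \<in> carrier (P i)" "p \<in> carrier (poly_ring {1..m})"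
  shows "dec (p \<odot>\<^bsub>P i\<^esub> f) = (\<lambda>S. smul p (dec f S))"
proof (rule ext, rule poly_mapping_eqI)
  interpret F: Module.module "poly_ring {1..m}" "P i" by (rule module_P)
  fix S c
  show "lookup (dec (p \<odot>\<^bsub>P i\<^esub> f) S) c = lookup (smul p (dec f S)) c"
    unfolding lookup_smul lookup_dec[OF assms(1)] lookup_dec[OF F.smult_closed[OF assms(2,1)]] P_simps
    by simp
qed

definition bd :: "(nat \<times> 'm \<Rightarrow> nat mpoly) \<Rightarrow> nat \<times> 'm \<Rightarrow> nat mpoly" where
  "bd f = enc (koszul_diff phi m (dec f))"

definition aug :: "(nat \<times> 'm \<Rightarrow> nat mpoly) \<Rightarrow> 'm" where
  "aug f = \<pi> (lin (dec f {}))"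

lemmas free_part_closed = free_part_0 free_part_add free_part_uminus

lemma koszul_diff_koszul_htpy:
  assumes "koszul_diff phi m z = (\<lambda>S. 0)"
  shows "koszul_diff phi m (koszul_htpy m z) S = z S - proj m z S"
proof -
  have "koszul_htpy m (\<lambda>S. 0) S = 0"
    using koszul_htpy_nonzeroD[of m "\<lambda>S. 0" S] by auto
  then show ?thesis using koszul_homotopy[of m z S] unfolding assms by simp
qed

lemma koszul_diff_chains:
  assumes "z \<in> chains (Suc i)"
  shows "koszul_diff phi m z \<in> chains i"
proof -
  have "koszul_diff phi m z S \<in> free_part \<Gamma> {1..m}" for S
    using assms keys_r
    by (intro koszul_diff_mem free_part_closed free_part_phi) (auto simp: chains_def)
  moreover have "S \<subseteq> {..<m} \<and> card S = i" if nz: "koszul_diff phi m z S \<noteq> 0" for S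
  proof -
    obtain k where k: "k \<notin> S" "z (insert k S) \<noteq> 0"
      using koszul_diff_nonzeroD[of phi m z S, OF nz phi_0] by auto
    then have "insert k S \<subseteq> {..<m}" "card (insert k S) = Suc i"
      using assms unfolding chains_def by blast+
    moreover from this have "finite S" using finite_subset[of S "{..<m}"] by simp
    ultimately show ?thesis using k(1) by simp
  qed
  ultimately show ?thesis by (simp add: chains_def)
qed

lemma koszul_htpy_chains:
  assumes "z \<in> chains i"
  shows "koszul_htpy m z \<in> chains (Suc i)"
proof -
  have "koszul_htpy m z S \<in> free_part \<Gamma> {1..m}" for S
    using assms keys_r
    by (intro koszul_htpy_mem free_part_closed free_part_phi division_mem) (auto simp: chains_def)
  moreover have "S \<subseteq> {..<m} \<and> card S = Suc i" if nz: "koszul_htpy m z S \<noteq> 0" for S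
  proof -
    obtain k where k: "k < m" "k \<in> S" "z (S - {k}) \<noteq> 0"
      using koszul_htpy_nonzeroD[OF nz] by auto
    then have "S - {k} \<subseteq> {..<m}" "card (S - {k}) = i" using assms by (auto simp: chains_def)
    moreover from this have "finite S" using finite_subset[of "S - {k}" "{..<m}"] by simp
    ultimately show ?thesis using k card_Suc_Diff1[of S k] by auto
  qed
  ultimately show ?thesis by (simp add: chains_def)
qed

lemma koszul_diff_chains_0: "z \<in> chains 0 \<Longrightarrow> koszul_diff phi m z S = 0"
  using koszul_diff_nonzeroD[of phi m z S, OF _ phi_0]
  by (force simp: chains_def dest: finite_subset[of _ "{..<m}"])

lemma dec_bd: "f \<in> carrier (P (Suc i)) \<Longrightarrow> dec (bd f) = koszul_diff phi m (dec f)"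
  unfolding bd_def by (rule dec_enc[OF koszul_diff_chains[OF dec_chains]])

lemma bd_mem: "f \<in> carrier (P (Suc i)) \<Longrightarrow> bd f \<in> carrier (P i)"
  unfolding bd_def by (intro enc_carrier koszul_diff_chains dec_chains)

lemma dec_inject: "f \<in> carrier (P i) \<Longrightarrow> g \<in> carrier (P i) \<Longrightarrow> dec f = dec g \<Longrightarrow> f = g"
  using enc_dec by metis

lemma dec_0: "dec \<zero>\<^bsub>P i\<^esub> = (\<lambda>S. 0)"
  by (rule ext) (simp add: dec_def P_simps)

lemma bd_linear: "bd \<in> linear_maps (poly_ring {1..m}) (P (Suc i)) (P i)"
proof -
  interpret F: Module.module "poly_ring {1..m}" "P (Suc i)" by (rule module_P)
  interpret F': Module.module "poly_ring {1..m}" "P i" by (rule module_P)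
  have "bd (x \<oplus>\<^bsub>P (Suc i)\<^esub> y) = bd x \<oplus>\<^bsub>P i\<^esub> bd y" if x: "x \<in> carrier (P (Suc i))" and y: "y \<in> carrier (P (Suc i))" for x y
  proof (rule dec_inject[OF bd_mem[OF F.a_closed[OF x y]] F'.a_closed[OF bd_mem[OF x] bd_mem[OF y]]])
    show "dec (bd (x \<oplus>\<^bsub>P (Suc i)\<^esub> y)) = dec (bd x \<oplus>\<^bsub>P i\<^esub> bd y)"
      unfolding dec_bd[OF F.a_closed[OF x y]] dec_add[OF bd_mem[OF x] bd_mem[OF y]]
        dec_bd[OF x] dec_bd[OF y] dec_add[OF x y]
      by (rule ext) (rule koszul_diff_add[OF phi_add'])
  qed
  moreover have "bd (p \<odot>\<^bsub>P (Suc i)\<^esub> x) = p \<odot>\<^bsub>P i\<^esub> bd x"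
    if x: "x \<in> carrier (P (Suc i))" and p: "p \<in> carrier (poly_ring {1..m})" for p x
  proof (rule dec_inject[OF bd_mem[OF F.smult_closed[OF p x]] F'.smult_closed[OF p bd_mem[OF x]]])
    show "dec (bd (p \<odot>\<^bsub>P (Suc i)\<^esub> x)) = dec (p \<odot>\<^bsub>P i\<^esub> bd x)"
      unfolding dec_bd[OF F.smult_closed[OF p x]] dec_smult[OF bd_mem[OF x] p] dec_bd[OF x] dec_smult[OF x p]
      by (rule ext) (rule koszul_diff_commute_map[of phi "smul p" m "dec x", OF phi_add' smul_simps(1) phi_smul[symmetric], symmetric])
  qed
  ultimately show ?thesis unfolding linear_maps_def by (intro CollectI conjI ballI funcsetI bd_mem)
qed

lemma chains_free_part: "z \<in> chains i \<Longrightarrow> z S \<in> free_part \<Gamma> {1..m}"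
  by (simp add: chains_def)

lemma aug_mem: "f \<in> carrier (P 0) \<Longrightarrow> lin (dec f {}) \<in> Z"
  by (intro lin_mem chains_free_part dec_chains)

lemma aug_linear: "aug \<in> linear_maps (poly_ring {1..m}) (P 0) M"
proof -
  have "indets p \<subseteq> {1..m}" if "p \<in> carrier (poly_ring {1..m})" for p :: "nat mpoly"
    using that by (simp add: poly_ring_def)
  then show ?thesis
    using aug_mem pi_mem
    by (simp add: linear_maps_def aug_def dec_add dec_smult lin_add lin_smul pi_add pi_scale)
qed

lemma aug_onto: "aug ` carrier (P 0) = carrier M"
proof
  show "aug ` carrier (P 0) \<subseteq> carrier M" using aug_mem pi_mem by (auto simp: aug_def)
  show "carrier M \<subseteq> aug ` carrier (P 0)"
  proof
    fix y assume "y \<in> carrier M"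
    then obtain z where z: "z \<in> Z" "y = \<pi> z" using pi_onto by auto
    \<comment> \<open>A class is hit by its own coordinates, read as a chain of degree 0 with
      constant coefficients.\<close>
    define w :: "nat set \<Rightarrow> 'm \<Rightarrow>\<^sub>0 nat mpoly" where "w S = (if S = {} then Poly_Mapping.map Const (\<kappa> z) else 0)" for S
    have w: "w \<in> chains 0"
      using free_part_kappa[OF z(1)] by (auto simp: w_def chains_def free_part_0)
    have "aug (enc w) = \<pi> (lin (Poly_Mapping.map Const (\<kappa> z)))"
      by (simp add: aug_def dec_enc[OF w]) (simp add: w_def)
    also have "\<dots> = \<pi> z"
      using pi_eq_iff[OF z(1) lin_mem[OF free_part_kappa[OF z(1)]]] lin_kappa[OF z(1)] by simp
    finally show "y \<in> aug ` carrier (P 0)" using z(2) enc_carrier[OF w] by (metis imageI)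
  qed
qed

lemma lin_koszul_diff:
  assumes "z \<in> chains 1"
  shows "lin (koszul_diff phi m z {}) \<in> K"
proof -
  have z: "z S \<in> free_part \<Gamma> {1..m}" for S using assms by (rule chains_free_part)
  have "lin (koszul_diff phi j z {}) \<in> K" if "j \<le> m" for j
    using that by (induction j)
      (auto simp: lin_add K_0 additive_0[of lin, OF lin_add] z intro!: K_add lin_phi)
  then show ?thesis by simp
qed

text \<open>Up to a boundary, a chain of degree 0 equals its remainder by all the operators, which
  has rational coefficients. If the augmentation kills the chain, it kills this remainder, on which
  it is injective.\<close>

lemma aug_kernel: "{x \<in> carrier (P 0). aug x = \<zero>\<^bsub>M\<^esub>} = bd ` carrier (P 1)"
proof
  show "bd ` carrier (P 1) \<subseteq> {x \<in> carrier (P 0). aug x = \<zero>\<^bsub>M\<^esub>}"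
  proof (intro subsetI CollectI conjI)
    fix y assume "y \<in> bd ` carrier (P 1)"
    then obtain x where x: "x \<in> carrier (P 1)" "y = bd x" by auto
    have x': "x \<in> carrier (P (Suc 0))" using x(1) by (simp add: One_nat_def)
    then show "y \<in> carrier (P 0)" using bd_mem x(2) by simp
    have "aug y = \<pi> (lin (koszul_diff phi m (dec x) {}))"
      using x(2) dec_bd[OF x'] by (simp add: aug_def)
    then show "aug y = \<zero>\<^bsub>M\<^esub>" using lin_koszul_diff[OF dec_chains[OF x(1)]] by (simp add: K_def)
  qed
  show "{x \<in> carrier (P 0). aug x = \<zero>\<^bsub>M\<^esub>} \<subseteq> bd ` carrier (P 1)"
  proof
    fix x assume "x \<in> {x \<in> carrier (P 0). aug x = \<zero>\<^bsub>M\<^esub>}"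
    then have x: "x \<in> carrier (P 0)" "lin (dec x {}) \<in> K" using aug_mem by (auto simp: aug_def K_def)
    let ?z = "dec x"
    have z: "?z \<in> chains 0" using x(1) by (rule dec_chains)
    have h: "koszul_htpy m ?z \<in> chains 1" using koszul_htpy_chains[OF z] by (simp add: One_nat_def)
    have "koszul_diff phi m ?z = (\<lambda>S. 0)" using koszul_diff_chains_0[OF z] by auto
    then have hom: "koszul_diff phi m (koszul_htpy m ?z) S = ?z S - proj m ?z S" for S
      by (rule koszul_diff_koszul_htpy)
    \<comment> \<open>All \<open>m\<close> variables have been divided out.\<close>
    have c: "ev m (?z {}) \<in> free_part \<Gamma> {}"
      using ev_mem[of \<Gamma> "?z {}" "{1..m}" m] keys_r chains_free_part[OF z] by simp
    then have c': "ev m (?z {}) \<in> free_part \<Gamma> {1..m}" by (auto simp: free_part_def)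
    have "lin (?z {} - ev m (?z {})) \<in> K"
      using lin_koszul_diff[OF h] hom[of "{}"] by (simp add: proj_def)
    then have "lin (ev m (?z {})) \<in> K"
      using x(2) pi_eq_iff[OF aug_mem[OF x(1)] lin_mem[OF c']] lin_mem[OF c']
      by (simp add: additive_diff[of lin, OF lin_add]) (simp add: K_def)
    then have "\<kappa> (lin (ev m (?z {}))) = 0" by (rule kappa_K)
    then have "ev m (?z {}) = 0" using kappa_lin[OF c] by (simp add: map_Const_simps)
    moreover have "?z S = 0" if "S \<noteq> {}" for S
      using z that finite_subset[of S "{..<m}"] by (auto simp: chains_def)
    ultimately have "proj m ?z S = 0" for S
      by (cases "S = {}") (simp_all add: proj_def ev_0)
    then have "koszul_diff phi m (koszul_htpy m ?z) = ?z" using hom by (simp add: fun_eq_iff)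
    moreover have "x = enc ?z" using enc_dec[OF x(1)] by simp
    ultimately have "x = bd (enc (koszul_htpy m ?z))" unfolding bd_def by (simp add: dec_enc[OF h])
    then show "x \<in> bd ` carrier (P 1)" using enc_carrier[OF h] by simp
  qed
qed

lemma bd_kernel: "{x \<in> carrier (P (Suc i)). bd x = \<zero>\<^bsub>P i\<^esub>} = bd ` carrier (P (Suc (Suc i)))"
proof
  show "bd ` carrier (P (Suc (Suc i))) \<subseteq> {x \<in> carrier (P (Suc i)). bd x = \<zero>\<^bsub>P i\<^esub>}"
  proof (intro subsetI CollectI conjI)
    fix y assume "y \<in> bd ` carrier (P (Suc (Suc i)))"
    then obtain x where x: "x \<in> carrier (P (Suc (Suc i)))" "y = bd x" by auto
    then show y: "y \<in> carrier (P (Suc i))" using bd_mem by simp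
    interpret F: Module.module "poly_ring {1..m}" "P i" by (rule module_P)
    show "bd y = \<zero>\<^bsub>P i\<^esub>"
    proof (rule dec_inject[OF bd_mem[OF y] F.zero_closed])
      show "dec (bd y) = dec \<zero>\<^bsub>P i\<^esub>"
        unfolding dec_bd[OF y] dec_0 unfolding x(2) dec_bd[OF x(1)]
        by (rule ext) (rule koszul_diff_koszul_diff[OF phi_add' phi_comm])
    qed
  qed
  show "{x \<in> carrier (P (Suc i)). bd x = \<zero>\<^bsub>P i\<^esub>} \<subseteq> bd ` carrier (P (Suc (Suc i)))"
  proof
    fix x assume "x \<in> {x \<in> carrier (P (Suc i)). bd x = \<zero>\<^bsub>P i\<^esub>}"
    then have x: "x \<in> carrier (P (Suc i))" "bd x = \<zero>\<^bsub>P i\<^esub>" by auto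
    let ?z = "dec x"
    have z: "?z \<in> chains (Suc i)" using x(1) by (rule dec_chains)
    have h: "koszul_htpy m ?z \<in> chains (Suc (Suc i))" using koszul_htpy_chains[OF z] .
    have "koszul_diff phi m ?z = (\<lambda>S. 0)" using dec_bd[OF x(1)] x(2) by (simp add: dec_0)
    then have hom: "koszul_diff phi m (koszul_htpy m ?z) S = ?z S - proj m ?z S" for S
      by (rule koszul_diff_koszul_htpy)
    \<comment> \<open>A chain of positive degree lives on nonempty subsets of \<open>{..<m}\<close>,
      where the projection vanishes.\<close>
    have "proj m ?z S = 0" for S
    proof (cases "S \<inter> {..<m} = {} \<and> ?z S \<noteq> 0")
      case True
      then have "S \<subseteq> {..<m}" "card S = Suc i" using z by (auto simp: chains_def)
      then show ?thesis using True by (metis Int_absorb2 card.empty nat.distinct(1))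
    qed (auto simp: proj_def ev_0)
    then have "koszul_diff phi m (koszul_htpy m ?z) = ?z" using hom by (simp add: fun_eq_iff)
    moreover have "x = enc ?z" using enc_dec[OF x(1)] by simp
    ultimately have "x = bd (enc (koszul_htpy m ?z))" unfolding bd_def by (simp add: dec_enc[OF h])
    then show "x \<in> bd ` carrier (P (Suc (Suc i)))" using enc_carrier[OF h] by simp
  qed
qed

lemma has_resolution: "has_projective_resolution (poly_ring {1..m}) M m"
  unfolding has_projective_resolution_def
proof (rule exI[of _ P], rule exI[of _ "\<lambda>_. bd"], rule exI[of _ aug], intro conjI allI impI)
  show "projective (poly_ring {1..m}) (P i)" for i
    unfolding P_def by (intro projective_free_module cring_poly_ring) (simp add: poly_ring_def)
  fix i assume "m < i"
  moreover have "card S \<le> m" if "S \<subseteq> {..<m}" for S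
    using card_mono[OF _ that] by simp
  ultimately have "\<not> (S \<subseteq> {..<m} \<and> card S = i)" for S
    by (meson leD)
  then have "index i = {}" unfolding index_def by blast
  then have "f = \<zero>\<^bsub>P i\<^esub>" if "f \<in> carrier (P i)" for f
    using that by (auto simp: carrier_P P_simps)
  moreover have "\<zero>\<^bsub>P i\<^esub> \<in> carrier (P i)"
    by (simp add: carrier_P P_simps)
  ultimately show "carrier (P i) = {\<zero>\<^bsub>P i\<^esub>}" by blast
next
  show "bd \<in> linear_maps (poly_ring {1..m}) (P (Suc i)) (P i)" for i
    by (rule bd_linear)
  show "{x \<in> carrier (P (Suc i)). bd x = \<zero>\<^bsub>P i\<^esub>} = bd ` carrier (P (Suc (Suc i)))" for i
    by (rule bd_kernel)
qed (rule aug_linear aug_onto aug_kernel)+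

end

theorem (in quotient_presentation) hilbert_syzygy: "has_projective_resolution (poly_ring {1..m}) M m"
  using quotient_coordinates_exist quotient_coordinates.has_resolution by blast

section \<open>Lower bound for the length of a resolution\<close>

lemma koszul_diff_mem_image:
  assumes "\<And>k S. k < j \<Longrightarrow> \<phi> k (z S) \<in> G" and "0 \<in> G" "\<And>x y. x \<in> G \<Longrightarrow> y \<in> G \<Longrightarrow> x + y \<in> G" "\<And>x. x \<in> G \<Longrightarrow> - x \<in> G"
  shows "koszul_diff \<phi> j z S \<in> G"
  using assms(1) by (induction j) (auto simp: assms(2-4))

context koszul_division
begin

text \<open>An element killed by \<open>\<phi>\<^sub>0, \<dots>, \<phi>\<^bsub>m - 1\<^esub>\<close> is a Koszul cycle of top degree; the connecting maps shift
  its class through the syzygies, lowering the Koszul degree by one at each step.\<close>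

lemma resolution_length_ge:
  fixes A :: "nat \<Rightarrow> 'e set" and d :: "nat \<Rightarrow> 'e \<Rightarrow> 'e"
  assumes A_0: "\<And>i. 0 \<in> A i" and A_add: "\<And>i x y. x \<in> A i \<Longrightarrow> y \<in> A i \<Longrightarrow> x + y \<in> A i"
    and A_minus: "\<And>i x. x \<in> A i \<Longrightarrow> - x \<in> A i"
    and A_phi: "\<And>i k x. k < m \<Longrightarrow> x \<in> A i \<Longrightarrow> \<phi> k x \<in> A i"
    and acyclic: "\<And>i z. (\<And>S. z S \<in> A i) \<Longrightarrow> (\<And>S. koszul_diff \<phi> m z S = 0) \<Longrightarrow> (\<And>S. proj m z S = 0) \<Longrightarrow>
      \<exists>w. (\<forall>S. w S \<in> A i) \<and> (\<forall>S. koszul_diff \<phi> m w S = z S)"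
    and d_mem: "\<And>i x. x \<in> A (Suc i) \<Longrightarrow> d i x \<in> A i"
    and d_add: "\<And>i x y. x \<in> A (Suc i) \<Longrightarrow> y \<in> A (Suc i) \<Longrightarrow> d i (x + y) = d i x + d i y"
    and d_phi: "\<And>i k x. k < m \<Longrightarrow> x \<in> A (Suc i) \<Longrightarrow> d i (\<phi> k x) = \<phi> k (d i x)"
    and exact: "\<And>i x. x \<in> A (Suc i) \<Longrightarrow> d i x = 0 \<longleftrightarrow> x \<in> d (Suc i) ` A (Suc (Suc i))"
    and p: "p \<in> A 0" "p \<notin> d 0 ` A (Suc 0)" "\<And>k. k < m \<Longrightarrow> \<phi> k p \<in> d 0 ` A (Suc 0)"
    and last: "A (Suc l) = {0}"
  shows "m \<le> l"
proof (rule ccontr)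
  assume "\<not> m \<le> l"
  define Z where "Z i = d i ` A (Suc i)" for i
  have d_0: "d i 0 = 0" for i using d_add[OF A_0 A_0, of i] by simp
  have d_minus: "d i (- x) = - d i x" if "x \<in> A (Suc i)" for i x
    using d_add[OF that A_minus[OF that]] d_0 by (simp add: eq_neg_iff_add_eq_0 add.commute)
  have Z_0: "0 \<in> Z i" for i unfolding Z_def using d_0 A_0 by (metis imageI)
  have Z_add: "x + y \<in> Z i" if xy: "x \<in> Z i" "y \<in> Z i" for x y i
  proof -
    obtain a b where "a \<in> A (Suc i)" "b \<in> A (Suc i)" "x = d i a" "y = d i b"
      using xy by (auto simp: Z_def)
    then show ?thesis unfolding Z_def by (intro image_eqI[of _ _ "a + b"]) (simp_all add: d_add A_add)
  qed
  have Z_minus: "- x \<in> Z i" if x: "x \<in> Z i" for x i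
  proof -
    obtain a where "a \<in> A (Suc i)" "x = d i a" using x by (auto simp: Z_def)
    then show ?thesis unfolding Z_def by (intro image_eqI[of _ _ "- a"]) (simp_all add: d_minus A_minus)
  qed
  have Z_A: "x \<in> A i" if "x \<in> Z i" for x i using that d_mem unfolding Z_def by auto
  have d_Z: "d i x = 0" if "x \<in> Z (Suc i)" for i x
    using exact[OF Z_A[OF that]] that unfolding Z_def by blast
  have koszul_diff_d: "d i (koszul_diff \<phi> m z S) = koszul_diff \<phi> m (\<lambda>S. d i (z S)) S" if "\<And>S. z S \<in> A (Suc i)" for i z S
    by (rule koszul_diff_map[where G = "A (Suc i)"]) (use that A_0 A_add A_minus A_phi d_add d_phi in auto)
  \<comment> \<open>\<open>A i\<close> modulo \<open>Z i\<close> is the resolved module for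
    \<open>i = 0\<close> and a copy of a syzygy for \<open>i > 0\<close>. The claim is a nonzero
    class in its Koszul homology of degree \<open>m - i\<close>: the boundary of \<open>y\<close>
    lies in \<open>Z i\<close>, but \<open>y\<close> is not a boundary modulo
    \<open>Z i\<close>.\<close>
  have "\<exists>y. (\<forall>S. y S \<in> A i) \<and> (\<forall>S. y S \<noteq> 0 \<longrightarrow> S \<subseteq> {..<m} \<and> card S = m - i) \<and>
      (\<forall>S. koszul_diff \<phi> m y S \<in> Z i) \<and>
      \<not> (\<exists>w \<zeta>. (\<forall>S. w S \<in> A i) \<and> (\<forall>S. \<zeta> S \<in> Z i) \<and> (\<forall>S. y S = koszul_diff \<phi> m w S + \<zeta> S))"
    if "i \<le> m" for i
    using that
  proof (induction i)
    case 0
    \<comment> \<open>\<open>p\<close> times the top exterior monomial. Nothing lies above it, so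
      boundaries vanish at \<open>{..<m}\<close>.\<close>
    define y where "y S = (if S = {..<m} then p else 0)" for S
    have "koszul_diff \<phi> m y S \<in> Z 0" for S
      by (rule koszul_diff_mem_image) (use p(3) Z_0 Z_add Z_minus in \<open>auto simp: y_def Z_def phi_0\<close>)
    moreover have "\<not> (\<forall>S. y S = koszul_diff \<phi> m w S + \<zeta> S)" if "\<forall>S. \<zeta> S \<in> Z 0" for w \<zeta>
    proof
      assume "\<forall>S. y S = koszul_diff \<phi> m w S + \<zeta> S"
      moreover have "koszul_diff \<phi> m w {..<m} = 0"
        using koszul_diff_nonzeroD[of \<phi> m w "{..<m}"] phi_0 by auto
      ultimately have "p = \<zeta> {..<m}" by (metis add_0 y_def)
      then show False using that p(2) Z_def by auto
    qed
    moreover have "y S \<in> A 0" "y S \<noteq> 0 \<Longrightarrow> S \<subseteq> {..<m} \<and> card S = m - 0" for S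
      using p(1) A_0 by (auto simp: y_def split: if_splits)
    ultimately show ?case by (intro exI[of _ y]) blast
  next
    case (Suc i)
    then obtain y where y: "\<And>S. y S \<in> A i" "\<And>S. y S \<noteq> 0 \<Longrightarrow> S \<subseteq> {..<m} \<and> card S = m - i"
      "\<And>S. koszul_diff \<phi> m y S \<in> Z i"
      "\<not> (\<exists>w \<zeta>. (\<forall>S. w S \<in> A i) \<and> (\<forall>S. \<zeta> S \<in> Z i) \<and> (\<forall>S. y S = koszul_diff \<phi> m w S + \<zeta> S))"
      by auto
    \<comment> \<open>The connecting map: the boundary of \<open>y\<close> is lifted through
      \<open>d i\<close>. Lifting zero to zero keeps the support in degree
      \<open>m - Suc i\<close>.\<close>
    have "\<exists>a. a \<in> A (Suc i) \<and> d i a = koszul_diff \<phi> m y S \<and> (koszul_diff \<phi> m y S = 0 \<longrightarrow> a = 0)" for S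
    proof (cases "koszul_diff \<phi> m y S = 0")
      case True
      then show ?thesis using A_0 d_0 by auto
    next
      case False
      then show ?thesis using y(3)[of S] unfolding Z_def by auto
    qed
    then obtain y' where y': "\<And>S. y' S \<in> A (Suc i)" "\<And>S. d i (y' S) = koszul_diff \<phi> m y S"
      "\<And>S. koszul_diff \<phi> m y S = 0 \<Longrightarrow> y' S = 0" by metis
    have shift: "S \<subseteq> {..<m} \<and> card S = m - Suc i"
      if "insert k S \<subseteq> {..<m} \<and> card (insert k S) = m - i" "k \<notin> S" for k S
    proof -
      have "finite S" using that(1) finite_subset[of S "{..<m}"] by auto
      then show ?thesis using that by auto
    qed
    have supp: "S \<subseteq> {..<m} \<and> card S = m - Suc i" if nz: "y' S \<noteq> 0" for S
    proof -
      have "koszul_diff \<phi> m y S \<noteq> 0" using nz y'(3) by blast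
      then obtain k where "k \<notin> S" "y (insert k S) \<noteq> 0" using koszul_diff_nonzeroD phi_0 by metis
      then show ?thesis using shift y(2) by metis
    qed
    have "koszul_diff \<phi> m y' S \<in> Z (Suc i)" for S
    proof -
      have "koszul_diff \<phi> m y' S \<in> A (Suc i)"
        by (rule koszul_diff_mem[where G = "A (Suc i)"]) (use y' A_0 A_add A_minus A_phi in auto)
      moreover have "d i (koszul_diff \<phi> m y' S) = 0"
        by (simp add: koszul_diff_d[OF y'(1)] y'(2) koszul_diff_koszul_diff[OF phi_add phi_comm])
      ultimately show ?thesis using exact unfolding Z_def by blast
    qed
    moreover have "\<not> (\<forall>S. y' S = koszul_diff \<phi> m w S + \<zeta> S)"
      if w: "\<forall>S. w S \<in> A (Suc i)" and \<zeta>: "\<forall>S. \<zeta> S \<in> Z (Suc i)" for w \<zeta>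
    proof
      assume eq: "\<forall>S. y' S = koszul_diff \<phi> m w S + \<zeta> S"
      \<comment> \<open>Only the part of \<open>w\<close> in degree \<open>m - i\<close> contributes
        to the boundary in the degree of \<open>y'\<close>. The corrected chain \<open>u\<close> is
        then a cycle with coefficients in \<open>A i\<close>, and acyclicity would make
        \<open>y\<close> a boundary modulo \<open>Z i\<close>.\<close>
      define w' where "w' S = (if S \<subseteq> {..<m} \<and> card S = m - i then w S else 0)" for S
      define u where "u S = y S - d i (w' S)" for S
      have w': "w' S \<in> A (Suc i)" for S using w A_0 by (simp add: w'_def)
      have "d i (y' S) = koszul_diff \<phi> m (\<lambda>S. d i (w' S)) S" for S
      proof (cases "S \<subseteq> {..<m} \<and> card S = m - Suc i")
        case True
        have "koszul_diff \<phi> m w S = koszul_diff \<phi> m w' S"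
        proof (rule koszul_diff_cong)
          fix k assume "k < m" "k \<notin> S"
          moreover have "finite S" using True finite_subset by blast
          moreover have "Suc (m - Suc i) = m - i" using Suc.prems by simp
          ultimately show "w (insert k S) = w' (insert k S)" using True by (simp add: w'_def)
        qed
        then have "y' S = koszul_diff \<phi> m w' S + \<zeta> S" using eq by simp
        moreover have "koszul_diff \<phi> m w' S \<in> A (Suc i)"
          by (rule koszul_diff_mem[where G = "A (Suc i)"]) (use w' A_0 A_add A_minus A_phi in auto)
        ultimately have "d i (y' S) = d i (koszul_diff \<phi> m w' S)"
          using \<zeta> Z_A d_Z d_add by (metis add.right_neutral)
        then show ?thesis using koszul_diff_d[OF w'] by simp
      next
        case False
        have "koszul_diff \<phi> m (\<lambda>S. d i (w' S)) S = 0"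
        proof (rule ccontr)
          assume "koszul_diff \<phi> m (\<lambda>S. d i (w' S)) S \<noteq> 0"
          then obtain k where k: "k \<notin> S" "d i (w' (insert k S)) \<noteq> 0"
            using koszul_diff_nonzeroD[of \<phi> m "\<lambda>S. d i (w' S)" S] phi_0 by auto
          then have "insert k S \<subseteq> {..<m} \<and> card (insert k S) = m - i"
            using d_0 by (auto simp: w'_def split: if_splits)
          then show False using shift k(1) False by blast
        qed
        moreover have "y' S = 0" using supp False by blast
        ultimately show ?thesis by (simp add: d_0)
      qed
      then have "koszul_diff \<phi> m u S = 0" for S
        unfolding u_def[abs_def] koszul_diff_diff[OF phi_add] using y'(2) by simp
      moreover have "u S \<in> A i" for S
        using A_add[OF y(1)[of S] A_minus[OF d_mem[OF w']]] by (simp add: u_def)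
      \<comment> \<open>\<open>Suc i \<le> m\<close> makes the degree \<open>m - i\<close> positive,
        so \<open>u\<close> vanishes at sets disjoint from \<open>{..<m}\<close>.\<close>
      moreover have "proj m u S = 0" for S
      proof (cases "S \<inter> {..<m} = {}")
        case True
        have "\<not> (S \<subseteq> {..<m} \<and> card S = m - i)"
        proof
          assume "S \<subseteq> {..<m} \<and> card S = m - i"
          then have "S = {}" "card S \<noteq> 0" using True Suc.prems by auto
          then show False by simp
        qed
        then have "y S = 0" "w' S = 0" using y(2)[of S] by (auto simp: w'_def)
        then show ?thesis by (simp add: proj_def u_def d_0 ev_0)
      qed (simp add: proj_def)
      ultimately obtain v where v: "\<forall>S. v S \<in> A i" "\<forall>S. koszul_diff \<phi> m v S = u S"
        using acyclic[of u i] by blast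
      have "d i (w' S) \<in> Z i" for S using w' unfolding Z_def by blast
      then have "\<exists>w \<zeta>. (\<forall>S. w S \<in> A i) \<and> (\<forall>S. \<zeta> S \<in> Z i) \<and> (\<forall>S. y S = koszul_diff \<phi> m w S + \<zeta> S)"
        using v by (intro exI[of _ v] exI[of _ "\<lambda>S. d i (w' S)"]) (simp add: u_def)
      then show False using y(4) by contradiction
    qed
    ultimately show ?case using y'(1) supp by (intro exI[of _ y']) blast
  qed
  \<comment> \<open>At stage \<open>Suc l\<close> all coefficients are zero, which leaves no room
    for a nonzero class.\<close>
  moreover have "Suc l \<le> m" using \<open>\<not> m \<le> l\<close> by simp
  ultimately obtain y where y: "\<forall>S. y S \<in> A (Suc l)"
    "\<not> (\<exists>w \<zeta>. (\<forall>S. w S \<in> A (Suc l)) \<and> (\<forall>S. \<zeta> S \<in> Z (Suc l)) \<and> (\<forall>S. y S = koszul_diff \<phi> m w S + \<zeta> S))"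
    by blast
  have "koszul_diff \<phi> m (\<lambda>S. 0) S = 0" for S
    using koszul_diff_nonzeroD[of \<phi> m "\<lambda>S. 0" S] phi_0 by auto
  then have "\<forall>S. y S = koszul_diff \<phi> m (\<lambda>S. 0) S + 0" using y(1) last by auto
  then show False using y(2) Z_0 A_0 by (metis (no_types, lifting))
qed

end

section \<open>Koszul complexes over free modules and their retracts\<close>

lemma act_zero: "act (\<lambda>_. 0) f = 0"
  by (simp add: act_def map_Const_simps smul_simps)

text \<open>With zero matrices the operators become multiplication by the variables, and remainders
  become the part free of a variable.\<close>

interpretation koszul_var: koszul_free "\<lambda>(_ :: nat) (_ :: 'i). 0 :: 'i \<Rightarrow>\<^sub>0 rat"
  by unfold_locales (simp add: act_zero)

lemma koszul_var_phi: "koszul_var.phi k f = smul (Var (Suc k)) f"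
  by (simp add: koszul_var.phi_def act_zero)

lemma koszul_var_acyclic:
  fixes z :: "nat set \<Rightarrow> 'i \<Rightarrow>\<^sub>0 nat mpoly"
  assumes "\<And>S. z S \<in> free_part \<beta> {1..m}" "\<And>S. koszul_diff koszul_var.phi m z S = 0" "\<And>S. koszul_var.proj m z S = 0"
  shows "koszul_var.koszul_htpy m z S \<in> free_part \<beta> {1..m}" "koszul_diff koszul_var.phi m (koszul_var.koszul_htpy m z) S = z S"
proof -
  show "koszul_var.koszul_htpy m z S \<in> free_part \<beta> {1..m}"
    by (intro koszul_var.koszul_htpy_mem free_part_0 free_part_add free_part_uminus koszul_var.free_part_phi
        koszul_var.division_mem assms(1)) auto
  have "koszul_diff koszul_var.phi m z = (\<lambda>S. 0)" using assms(2) by auto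
  moreover have "koszul_var.koszul_htpy m (\<lambda>S. 0) S = (0 :: 'i \<Rightarrow>\<^sub>0 nat mpoly)"
    using koszul_var.koszul_htpy_nonzeroD[of m "\<lambda>S. 0 :: 'i \<Rightarrow>\<^sub>0 nat mpoly" S] by blast
  ultimately show "koszul_diff koszul_var.phi m (koszul_var.koszul_htpy m z) S = z S"
    using koszul_var.koszul_homotopy[of m z S] assms(3)[of S] by simp
qed

lemma linear_maps_D:
  assumes "h \<in> linear_maps R M M'"
  shows "x \<in> carrier M \<Longrightarrow> h x \<in> carrier M'"
    "x \<in> carrier M \<Longrightarrow> y \<in> carrier M \<Longrightarrow> h (x \<oplus>\<^bsub>M\<^esub> y) = h x \<oplus>\<^bsub>M'\<^esub> h y"
    "a \<in> carrier R \<Longrightarrow> x \<in> carrier M \<Longrightarrow> h (a \<odot>\<^bsub>M\<^esub> x) = a \<odot>\<^bsub>M'\<^esub> h x"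
  using assms by (auto simp: linear_maps_def)

lemma linear_maps_zero:
  assumes "h \<in> linear_maps R M M'" "Module.module R M" "Module.module R M'"
  shows "h \<zero>\<^bsub>M\<^esub> = \<zero>\<^bsub>M'\<^esub>"
proof -
  interpret M: Module.module R M by fact
  interpret M': Module.module R M' by fact
  have "h \<zero>\<^bsub>M\<^esub> = \<zero>\<^bsub>R\<^esub> \<odot>\<^bsub>M'\<^esub> h \<zero>\<^bsub>M\<^esub>"
    using linear_maps_D(3)[OF assms(1), of "\<zero>\<^bsub>R\<^esub>" "\<zero>\<^bsub>M\<^esub>"] by simp
  then show ?thesis using linear_maps_D(1)[OF assms(1), of "\<zero>\<^bsub>M\<^esub>"] by simp
qed

lemma lookup_mem_free_module:
  "lookup g \<in> carrier (free_module (poly_ring V) I) \<longleftrightarrow> g \<in> free_part I V"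
  by (auto simp: free_module_def free_part_def poly_ring_def in_keys_iff)

text \<open>Each \<open>P i\<close> is embedded in the free module of which it is a retract. The
  images \<open>A i\<close> lie in one type with one addition, where the Koszul machinery applies,
  and the operations of the individual records disappear.\<close>

theorem projective_resolution_length:
  fixes M :: "(nat mpoly, 'm) module"
  assumes M: "Module.module (poly_ring {1..m}) M"
    and s: "s \<in> carrier M" "s \<noteq> \<zero>\<^bsub>M\<^esub>" "\<And>k. k \<in> {1..m} \<Longrightarrow> Var k \<odot>\<^bsub>M\<^esub> s = \<zero>\<^bsub>M\<^esub>"
    and res: "has_projective_resolution (poly_ring {1..m}) M l"
  shows "m \<le> l"
proof -
  define R where "R = (poly_ring {1..m} :: nat mpoly ring)"
  obtain P :: "nat \<Rightarrow> (nat mpoly, nat \<times> 'm \<Rightarrow> nat mpoly) module" and \<delta> \<epsilon> where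
    proj: "\<And>i. projective R (P i)" and zero: "\<And>i. i > l \<Longrightarrow> carrier (P i) = {\<zero>\<^bsub>P i\<^esub>}"
    and \<delta>: "\<And>i. \<delta> i \<in> linear_maps R (P (Suc i)) (P i)" and \<epsilon>: "\<epsilon> \<in> linear_maps R (P 0) M"
    and onto: "\<epsilon> ` carrier (P 0) = carrier M"
    and ex0: "{x \<in> carrier (P 0). \<epsilon> x = \<zero>\<^bsub>M\<^esub>} = \<delta> 0 ` carrier (P 1)"
    and ex: "\<And>i. {x \<in> carrier (P (Suc i)). \<delta> i x = \<zero>\<^bsub>P i\<^esub>} = \<delta> (Suc i) ` carrier (P (Suc (Suc i)))"
    using res unfolding has_projective_resolution_def R_def by auto
  define split where "split i I s r \<longleftrightarrow> s \<in> linear_maps R (P i) (free_module R I) \<and>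
      r \<in> linear_maps R (free_module R I) (P i) \<and> (\<forall>x\<in>carrier (P i). r (s x) = x)"
    for i and I :: "(nat \<times> 'm \<Rightarrow> nat mpoly) set" and s r
  have "\<exists>I s r. split i I s r" for i
    using proj[of i] unfolding projective_def split_def by blast
  then obtain I s' r where "\<And>i. split i (I i) (s' i) (r i)" by metis
  then have s': "\<And>i. s' i \<in> linear_maps R (P i) (free_module R (I i))"
    and r: "\<And>i. r i \<in> linear_maps R (free_module R (I i)) (P i)"
    and rs: "\<And>i x. x \<in> carrier (P i) \<Longrightarrow> r i (s' i x) = x"
    unfolding split_def by blast+
  have modP: "Module.module R (P i)" for i using proj unfolding projective_def by blast
  interpret P: Module.module R "P i" for i by (rule modP)
  have R_mem: "p \<in> carrier R \<longleftrightarrow> indets p \<subseteq> {1..m}" for p by (simp add: R_def poly_ring_def)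
  have free: "lookup g \<in> carrier (free_module R (I i)) \<longleftrightarrow> g \<in> free_part (I i) {1..m}" for i g
    unfolding R_def by (rule lookup_mem_free_module)
  have free_add: "lookup (f + g) = lookup f \<oplus>\<^bsub>free_module R (I i)\<^esub> lookup g"
    and free_smul: "lookup (smul p f) = p \<odot>\<^bsub>free_module R (I i)\<^esub> lookup f" for f g p i
    by (simp_all add: R_def free_module_def poly_ring_def fun_eq_iff lookup_add)
  define \<sigma> where "\<sigma> i x = Abs_poly_mapping (s' i x)" for i x
  define \<rho> where "\<rho> i g = r i (lookup g)" for i g
  have lookup_\<sigma>: "lookup (\<sigma> i x) = s' i x" if "x \<in> carrier (P i)" for i x
    using linear_maps_D(1)[OF s' that] unfolding \<sigma>_def
    by (intro lookup_Abs_poly_mapping) (simp add: free_module_def R_def poly_ring_def)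
  have \<sigma>_mem: "\<sigma> i x \<in> free_part (I i) {1..m}" if "x \<in> carrier (P i)" for i x
    using linear_maps_D(1)[OF s' that] lookup_\<sigma>[OF that] free by metis
  have \<sigma>_add: "\<sigma> i (x \<oplus>\<^bsub>P i\<^esub> y) = \<sigma> i x + \<sigma> i y" if "x \<in> carrier (P i)" "y \<in> carrier (P i)" for i x y
    using lookup_\<sigma>[OF that(1)] lookup_\<sigma>[OF that(2)] lookup_\<sigma>[OF P.a_closed[OF that]]
      linear_maps_D(2)[OF s' that] free_add by (metis poly_mapping_eq_iff)
  have \<sigma>_smul: "\<sigma> i (p \<odot>\<^bsub>P i\<^esub> x) = smul p (\<sigma> i x)" if "p \<in> carrier R" "x \<in> carrier (P i)" for i x p
    using lookup_\<sigma>[OF that(2)] lookup_\<sigma>[OF P.smult_closed[OF that]]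
      linear_maps_D(3)[OF s' that] free_smul by (metis poly_mapping_eq_iff)
  have \<rho>\<sigma>: "\<rho> i (\<sigma> i x) = x" if "x \<in> carrier (P i)" for i x
    by (simp add: \<rho>_def lookup_\<sigma> that rs)
  have \<rho>_mem: "\<rho> i g \<in> carrier (P i)" if "g \<in> free_part (I i) {1..m}" for i g
    using that linear_maps_D(1)[OF r] free unfolding \<rho>_def by blast
  have \<rho>_add: "\<rho> i (f + g) = \<rho> i f \<oplus>\<^bsub>P i\<^esub> \<rho> i g"
    if "f \<in> free_part (I i) {1..m}" "g \<in> free_part (I i) {1..m}" for i f g
    unfolding \<rho>_def free_add[of f g i] using that free by (intro linear_maps_D(2)[OF r]) blast+
  have \<rho>_smul: "\<rho> i (smul p g) = p \<odot>\<^bsub>P i\<^esub> \<rho> i g" if "p \<in> carrier R" "g \<in> free_part (I i) {1..m}" for i g p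
    unfolding \<rho>_def free_smul[of p g i] using that free by (intro linear_maps_D(3)[OF r]) blast+
  have \<sigma>_0: "\<sigma> i \<zero>\<^bsub>P i\<^esub> = 0" for i
    using \<sigma>_add[OF P.zero_closed P.zero_closed, of i] by simp
  have \<sigma>_0_iff: "\<sigma> i x = 0 \<longleftrightarrow> x = \<zero>\<^bsub>P i\<^esub>" if "x \<in> carrier (P i)" for i x
    using \<rho>\<sigma>[OF that] \<rho>\<sigma>[OF P.zero_closed] \<sigma>_0 by metis
  have X: "Var (Suc k) \<in> carrier R" if "k < m" for k using that by (simp add: R_mem)
  define A where "A i = \<sigma> i ` carrier (P i)" for i
  define d where "d i g = \<sigma> i (\<delta> i (\<rho> (Suc i) g))" for i g
  have \<sigma>_A: "\<sigma> i x \<in> A i" if "x \<in> carrier (P i)" for i x using that by (simp add: A_def)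
  have A_E: "\<exists>a\<in>carrier (P i). x = \<sigma> i a" if "x \<in> A i" for x i using that by (auto simp: A_def)
  have d_\<sigma>: "d i (\<sigma> (Suc i) a) = \<sigma> i (\<delta> i a)" if "a \<in> carrier (P (Suc i))" for i a
    by (simp add: d_def \<rho>\<sigma> that)
  have \<delta>_mem: "\<delta> i a \<in> carrier (P i)" if "a \<in> carrier (P (Suc i))" for i a
    using linear_maps_D(1)[OF \<delta> that] .
  have A_0: "0 \<in> A i" for i using \<sigma>_A[OF P.zero_closed] \<sigma>_0 by metis
  have A_free: "x \<in> free_part (I i) {1..m}" if "x \<in> A i" for x i using A_E[OF that] \<sigma>_mem by auto
  have "s \<in> \<epsilon> ` carrier (P 0)" using s(1) unfolding onto .
  then obtain p0 where p0: "p0 \<in> carrier (P 0)" "\<epsilon> p0 = s" by auto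
  have A_add: "x + y \<in> A i" if xy: "x \<in> A i" "y \<in> A i" for i x y
  proof -
    obtain a b where "a \<in> carrier (P i)" "b \<in> carrier (P i)" "x = \<sigma> i a" "y = \<sigma> i b"
      using A_E[OF xy(1)] A_E[OF xy(2)] by auto
    then show ?thesis using \<sigma>_add[of a i b] \<sigma>_A[OF P.a_closed, of a i b] by simp
  qed
  have A_minus: "- x \<in> A i" if x: "x \<in> A i" for i x
  proof -
    obtain a where a: "a \<in> carrier (P i)" "x = \<sigma> i a" using A_E[OF x] by auto
    then have "\<sigma> i (\<ominus>\<^bsub>P i\<^esub> a) + x = 0"
      using \<sigma>_add[of "\<ominus>\<^bsub>P i\<^esub> a" i a] \<sigma>_0 by (simp add: P.l_neg)
    then show ?thesis using \<sigma>_A[OF P.a_inv_closed[OF a(1)]] by (simp add: eq_neg_iff_add_eq_0[symmetric])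
  qed
  have A_phi: "koszul_var.phi k x \<in> A i" if "k < m" "x \<in> A i" for i k x
    using A_E[OF that(2)] \<sigma>_smul[OF X[OF that(1)]] \<sigma>_A P.smult_closed[OF X[OF that(1)]]
    unfolding koszul_var_phi by metis
  have d_mem: "d i x \<in> A i" if "x \<in> A (Suc i)" for i x
    using A_E[OF that] d_\<sigma> \<sigma>_A \<delta>_mem by metis
  have d_add: "d i (x + y) = d i x + d i y" if "x \<in> A (Suc i)" "y \<in> A (Suc i)" for i x y
  proof -
    have "\<rho> (Suc i) (x + y) = \<rho> (Suc i) x \<oplus>\<^bsub>P (Suc i)\<^esub> \<rho> (Suc i) y"
      by (rule \<rho>_add[OF A_free[OF that(1)] A_free[OF that(2)]])
    then show ?thesis
      unfolding d_def using linear_maps_D(2)[OF \<delta>[of i] \<rho>_mem[OF A_free[OF that(1)]] \<rho>_mem[OF A_free[OF that(2)]]]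
        \<sigma>_add \<delta>_mem[OF \<rho>_mem[OF A_free[OF that(1)]]] \<delta>_mem[OF \<rho>_mem[OF A_free[OF that(2)]]] by simp
  qed
  have d_phi: "d i (koszul_var.phi k x) = koszul_var.phi k (d i x)" if "k < m" "x \<in> A (Suc i)" for i k x
    unfolding d_def koszul_var_phi
    using \<rho>_smul[OF X[OF that(1)] A_free[OF that(2)]] linear_maps_D(3)[OF \<delta>[of i] X[OF that(1)] \<rho>_mem[OF A_free[OF that(2)]]]
      \<sigma>_smul[OF X[OF that(1)] \<delta>_mem[OF \<rho>_mem[OF A_free[OF that(2)]]]] by simp
  have exact: "d i x = 0 \<longleftrightarrow> x \<in> d (Suc i) ` A (Suc (Suc i))" if x: "x \<in> A (Suc i)" for i x
  proof -
    obtain a where a: "a \<in> carrier (P (Suc i))" "x = \<sigma> (Suc i) a" using A_E[OF x] by auto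
    have "d i x = 0 \<longleftrightarrow> \<delta> i a = \<zero>\<^bsub>P i\<^esub>"
      using \<sigma>_0_iff[OF \<delta>_mem[OF a(1)]] d_\<sigma>[OF a(1)] a(2) by simp
    also have "\<dots> \<longleftrightarrow> a \<in> \<delta> (Suc i) ` carrier (P (Suc (Suc i)))" using ex[of i] a(1) by blast
    also have "\<dots> \<longleftrightarrow> x \<in> (\<lambda>b. \<sigma> (Suc i) (\<delta> (Suc i) b)) ` carrier (P (Suc (Suc i)))"
      using a \<rho>\<sigma>[OF a(1)] \<rho>\<sigma>[OF \<delta>_mem] by (auto simp: image_iff)
    also have "(\<lambda>b. \<sigma> (Suc i) (\<delta> (Suc i) b)) ` carrier (P (Suc (Suc i))) = d (Suc i) ` A (Suc (Suc i))"
      unfolding A_def image_image using d_\<sigma> by (intro image_cong) auto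
    finally show ?thesis .
  qed
  have p_mem: "\<sigma> 0 p0 \<in> A 0" using p0 \<sigma>_A by auto
  have im: "\<sigma> 0 a \<in> d 0 ` A (Suc 0) \<longleftrightarrow> \<epsilon> a = \<zero>\<^bsub>M\<^esub>" if a: "a \<in> carrier (P 0)" for a
  proof -
    have "\<epsilon> a = \<zero>\<^bsub>M\<^esub> \<longleftrightarrow> a \<in> \<delta> 0 ` carrier (P (Suc 0))"
      using ex0[unfolded One_nat_def] a by blast
    also have "\<dots> \<longleftrightarrow> \<sigma> 0 a \<in> (\<lambda>b. \<sigma> 0 (\<delta> 0 b)) ` carrier (P (Suc 0))"
      using \<rho>\<sigma>[OF a] \<rho>\<sigma>[OF \<delta>_mem] by (auto simp: image_iff)
    also have "(\<lambda>b. \<sigma> 0 (\<delta> 0 b)) ` carrier (P (Suc 0)) = d 0 ` A (Suc 0)"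
      unfolding A_def image_image using d_\<sigma> by (intro image_cong) auto
    finally show ?thesis by simp
  qed
  have p_notin: "\<sigma> 0 p0 \<notin> d 0 ` A (Suc 0)" using im[OF p0(1)] p0(2) s(2) by simp
  have p_phi: "koszul_var.phi k (\<sigma> 0 p0) \<in> d 0 ` A (Suc 0)" if "k < m" for k
    using im[OF P.smult_closed[OF X[OF that] p0(1)]] linear_maps_D(3)[OF \<epsilon> X[OF that] p0(1)] s(3)[of "Suc k"] p0 that
    by (simp add: koszul_var_phi \<sigma>_smul[OF X[OF that] p0(1)])
  have A_last: "A (Suc l) = {0}" using zero[of "Suc l"] by (simp add: A_def \<sigma>_0)
  \<comment> \<open>A cycle in the retract is contracted in the free module; the retraction commutes
    with the Koszul differential and fixes the cycle.\<close>
  have acyclic: "\<exists>w. (\<forall>S. w S \<in> A i) \<and> (\<forall>S. koszul_diff koszul_var.phi m w S = z S)"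
    if z: "\<And>S. z S \<in> A i" "\<And>S. koszul_diff koszul_var.phi m z S = 0" "\<And>S. koszul_var.proj m z S = 0" for i z
  proof (intro exI conjI allI)
    let ?h = "koszul_var.koszul_htpy m z"
    have h: "?h S \<in> free_part (I i) {1..m}" "koszul_diff koszul_var.phi m ?h S = z S" for S
      using koszul_var_acyclic[OF A_free[OF z(1)] z(2,3)] by blast+
    show "\<sigma> i (\<rho> i (?h S)) \<in> A i" for S by (intro \<sigma>_A \<rho>_mem h)
    have "\<sigma> i (\<rho> i (koszul_diff koszul_var.phi m ?h S)) = koszul_diff koszul_var.phi m (\<lambda>S. \<sigma> i (\<rho> i (?h S))) S" for S
    proof (rule koszul_diff_map[where G = "free_part (I i) {1..m}" and f = "\<lambda>g. \<sigma> i (\<rho> i g)"])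
      show "\<sigma> i (\<rho> i (koszul_var.phi k x)) = koszul_var.phi k (\<sigma> i (\<rho> i x))"
        if "k < m" "x \<in> free_part (I i) {1..m}" for k x
        using that X[OF that(1)] by (simp add: koszul_var_phi \<rho>_smul \<sigma>_smul \<rho>_mem)
    qed (use h in \<open>auto simp: free_part_0 free_part_add free_part_uminus \<rho>_add \<sigma>_add \<rho>_mem koszul_var.free_part_phi\<close>)
    moreover have "\<sigma> i (\<rho> i (z S)) = z S" for S using A_E[OF z(1)[of S]] \<rho>\<sigma> by auto
    ultimately show "koszul_diff koszul_var.phi m (\<lambda>S. \<sigma> i (\<rho> i (?h S))) S = z S" for S
      using h(2) by metis
  qed
  show ?thesis
    by (rule koszul_var.resolution_length_ge[of A m d, OF A_0 A_add A_minus A_phi acyclic d_mem d_add d_phi exact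
        p_mem p_notin p_phi A_last])
qed

section \<open>Crossings\<close>

definition const_coeff :: "'v mpoly \<Rightarrow> rat" where "const_coeff p = lookup p 0"

lemma const_coeff_mult: "const_coeff (p * q) = const_coeff p * const_coeff (q :: 'v mpoly)"
proof -
  have "indets p \<subseteq> UNIV" by simp
  then show ?thesis
    by (induction p rule: mpoly_induct)
      (simp_all add: const_coeff_def lookup_Const_mult lookup_Const lookup_add distrib_right mult.assoc lookup_Var_mult_notin)
qed

lemma const_coeff_simps [simp]:
  "const_coeff (p + q) = const_coeff p + const_coeff q" "const_coeff (p - q) = const_coeff p - const_coeff q" "const_coeff (- p) = - const_coeff p" "const_coeff (p * q) = const_coeff p * const_coeff q"
  "const_coeff (Var v) = 0" "const_coeff (Const c) = c" "const_coeff 0 = 0" "const_coeff 1 = 1"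
proof -
  show "const_coeff (Var v) = 0" using lookup_Var_mult_notin[of 0 v 1] by (simp add: const_coeff_def)
qed (simp_all add: const_coeff_mult, simp_all add: const_coeff_def lookup_add lookup_minus lookup_Const)

lemma const_coeff_power [simp]: "const_coeff (p ^ n) = const_coeff p ^ n"
  by (induction n) auto

lemma const_coeff_sum: "const_coeff (sum f A) = (\<Sum>a\<in>A. const_coeff (f a))"
  by (induction A rule: infinite_finite_induct) auto

section \<open>Substitution and partial derivatives\<close>

definition monom_subst :: "('v \<Rightarrow> 'w mpoly) \<Rightarrow> ('v \<Rightarrow>\<^sub>0 nat) \<Rightarrow> 'w mpoly" where
  "monom_subst \<sigma> u = (\<Prod>v\<in>keys u. \<sigma> v ^ lookup u v)"

lemma monom_subst_superset:
  "finite B \<Longrightarrow> keys u \<subseteq> B \<Longrightarrow> monom_subst \<sigma> u = (\<Prod>v\<in>B. \<sigma> v ^ lookup u v)"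
  unfolding monom_subst_def by (rule prod.mono_neutral_left) (auto simp: in_keys_iff)

lemma monom_subst_add: "monom_subst \<sigma> (u + w) = monom_subst \<sigma> u * monom_subst \<sigma> w"
proof -
  let ?B = "keys u \<union> keys w"
  have "finite ?B" "keys (u + w) \<subseteq> ?B" by (simp_all add: keys_add)
  then show ?thesis
    by (simp add: monom_subst_superset[of ?B] lookup_add power_add prod.distrib)
qed

lemma poly_subst_superset:
  "finite B \<Longrightarrow> keys p \<subseteq> B \<Longrightarrow>
    poly_subst \<sigma> p = (\<Sum>u\<in>B. Const (lookup p u) * monom_subst \<sigma> u)"
  unfolding poly_subst_def monom_subst_def by (rule sum.mono_neutral_left) (auto simp: in_keys_iff)

lemma poly_subst_add: "poly_subst \<sigma> (p + q) = poly_subst \<sigma> p + poly_subst \<sigma> q"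
proof -
  let ?B = "keys p \<union> keys q"
  have "finite ?B" "keys (p + q) \<subseteq> ?B" by (simp_all add: keys_add)
  then show ?thesis
    by (simp add: poly_subst_superset[of ?B] lookup_add Const_add distrib_right sum.distrib)
qed

lemma poly_subst_single: "poly_subst \<sigma> (single u c) = Const c * monom_subst \<sigma> u"
  by (subst poly_subst_superset[of "{u}"]) auto

lemma poly_subst_mult: "poly_subst \<sigma> (p * q) = poly_subst \<sigma> p * poly_subst \<sigma> q"
proof (induction p rule: poly_mapping_induct_add)
  case (single u c)
  show ?case
  proof (induction q rule: poly_mapping_induct_add)
    case (single w d)
    show ?case by (simp add: mult_single poly_subst_single monom_subst_add Const_mult)
  qed (simp_all add: poly_subst_add distrib_left, simp add: poly_subst_def)
qed (simp_all add: poly_subst_add distrib_right, simp add: poly_subst_def)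

lemma poly_subst_simps:
  "poly_subst \<sigma> (p + q) = poly_subst \<sigma> p + poly_subst \<sigma> q"
  "poly_subst \<sigma> (p - q) = poly_subst \<sigma> p - poly_subst \<sigma> q"
  "poly_subst \<sigma> (p * q) = poly_subst \<sigma> p * poly_subst \<sigma> q"
  "poly_subst \<sigma> (Var v) = \<sigma> v" "poly_subst \<sigma> (Const c) = Const c" "poly_subst \<sigma> 1 = 1"
proof -
  show c: "poly_subst \<sigma> (Const c) = Const c" for c
    using poly_subst_single[of \<sigma> 0 c] by (simp add: monom_subst_def Const_def)
  show "poly_subst \<sigma> 1 = 1" using c[of 1] by simp
  show "poly_subst \<sigma> (Var v) = \<sigma> v"
    by (simp add: Var_def poly_subst_single monom_subst_def)
qed (simp_all add: poly_subst_add poly_subst_mult additive_diff[of "poly_subst _", OF poly_subst_add])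

lemma poly_subst_power: "poly_subst \<sigma> (p ^ n) = poly_subst \<sigma> p ^ n"
  by (induction n) (simp_all add: poly_subst_simps)

lemma poly_subst_of_nat: "poly_subst \<sigma> (of_nat n) = of_nat n"
  by (simp add: of_nat_eq_Const poly_subst_simps)

lemma indets_poly_subst:
  assumes "\<And>v. v \<in> indets p \<Longrightarrow> indets (\<sigma> v) \<subseteq> V"
  shows "indets (poly_subst \<sigma> p) \<subseteq> V"
  unfolding poly_subst_def using assms
  by (intro indets_sum indets_closed indets_prod indets_power) (simp, rule assms, auto simp: indets_def)

text \<open>Subtraction of exponents truncates; where it does, the coefficient carries the factor
  0.\<close>

definition pderiv :: "'v \<Rightarrow> 'v mpoly \<Rightarrow> 'v mpoly" where
  "pderiv v p = (\<Sum>u\<in>keys p.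
    single (u - single v 1) (lookup p u * of_nat (lookup u v)))"

lemma pderiv_superset:
  "finite B \<Longrightarrow> keys p \<subseteq> B \<Longrightarrow> pderiv v p = (\<Sum>u\<in>B.
    single (u - single v 1) (lookup p u * of_nat (lookup u v)))"
  unfolding pderiv_def by (rule sum.mono_neutral_left) (auto simp: in_keys_iff)

lemma pderiv_add: "pderiv v (p + q) = pderiv v p + pderiv v q"
proof -
  let ?B = "keys p \<union> keys q"
  have "finite ?B" "keys (p + q) \<subseteq> ?B" by (simp_all add: keys_add)
  then show ?thesis
    by (simp add: pderiv_superset[of ?B] lookup_add distrib_right sum.distrib single_add)
qed

lemma pderiv_single: "pderiv v (single u c) =
    single (u - single v 1) (c * of_nat (lookup u v))"
  by (subst pderiv_superset[of "{u}"]) auto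

lemma pderiv_mult: "pderiv v (p * q) = pderiv v p * q + p * pderiv v q"
proof (induction p rule: poly_mapping_induct_add)
  case (single u c)
  show ?case
  proof (induction q rule: poly_mapping_induct_add)
    case (single w d)
    let ?v = "single v 1 :: 'a \<Rightarrow>\<^sub>0 nat"
    have *: "a + b - ?v = (a - ?v) + b" if "lookup a v \<noteq> 0" for a b :: "'a \<Rightarrow>\<^sub>0 nat"
      using that by (intro poly_mapping_eqI) (auto simp: lookup_add lookup_minus lookup_single when_def)
    show ?case
      using *[of u w] *[of w u]
      by (cases "lookup u v = 0"; cases "lookup w v = 0")
        (simp_all add: mult_single pderiv_single lookup_add single_add[symmetric] add.commute algebra_simps)
  qed (simp_all add: pderiv_add algebra_simps, simp add: pderiv_def)
qed (simp_all add: pderiv_add algebra_simps, simp add: pderiv_def)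

lemma pderiv_diff: "pderiv v (p - q) = pderiv v p - pderiv v q"
  by (rule additive_diff[OF pderiv_add])

lemma pderiv_1: "pderiv v 1 = 0"
  using pderiv_mult[of v 1 1] by simp

lemma pderiv_power: "pderiv v (p ^ Suc n) = of_nat (Suc n) * p ^ n * pderiv v p"
  by (induction n) (simp_all add: pderiv_mult pderiv_1 algebra_simps)

lemma pderiv_Var: "pderiv v (Var w) = (if v = w then 1 else 0)"
  by (auto simp: Var_def pderiv_single lookup_single when_def)

lemma indets_pderiv: "indets (pderiv v p) \<subseteq> indets p"
proof -
  have "indets (single (u - single v 1) c) \<subseteq> indets p"
    if "u \<in> keys p" for u and c :: rat
  proof -
    have "keys (u - single v 1) \<subseteq> keys u"
      by (auto simp: in_keys_iff lookup_minus)
    then show ?thesis using that by (auto simp: indets_def)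
  qed
  then show ?thesis unfolding pderiv_def by (intro indets_sum)
qed

text \<open>The defining equation is differentiated in independent variables and specialized
  afterwards. In \<open>S\<close> an outgoing edge can coincide with an incoming one, and a
  derivative taken there would see both.\<close>

lemma crossing_identities:
  assumes adm: "admissible_choice N M A F" and N: "N \<ge> 1"
    and ends: "k \<in> {1..M}" "l \<in> {1..M}" "i \<in> {1..M}" "j \<in> {1..M}"
  defines "A' \<equiv> poly_subst (specialize k l i j) A" and "F' \<equiv> poly_subst (specialize k l i j) F"
    and "\<rho> \<equiv> Var k + Var l - Var i - Var j" and "u \<equiv> Var k - Var i" and "v \<equiv> Var j - Var k"
  shows "A' * \<rho> + F' * (u * v) = Var k ^ (N + 1) + Var l ^ (N + 1) - Var i ^ (N + 1) - Var j ^ (N + 1)"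
    and "indets A' \<subseteq> {1..M}" "indets F' \<subseteq> {1..M}" and "const_coeff A' = 0"
    and "\<exists>A1 F1. indets A1 \<subseteq> {1..M} \<and> indets F1 \<subseteq> {1..M} \<and>
      of_nat (N + 1) * Var k ^ N = A1 * \<rho> + A' + F1 * (u * v) + F' * (v - u)"
    and "\<exists>A1 F1. indets A1 \<subseteq> {1..M} \<and> indets F1 \<subseteq> {1..M} \<and>
      of_nat (N + 1) * Var l ^ N = A1 * \<rho> + A' + F1 * (u * v)"
proof -
  let ?s = "poly_subst (specialize k l i j)"
  let ?V = "{OutL, OutR, InL, InR} \<union> Edge ` {1..M}"
  have ind: "indets A \<subseteq> ?V" "indets F \<subseteq> ?V"
    and eq: "Var OutL ^ (N + 1) + Var OutR ^ (N + 1) - Var InL ^ (N + 1) - Var InR ^ (N + 1) =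
       A * (Var OutL + Var OutR - Var InL - Var InR) +
       F * ((Var OutL - Var InL) * (Var InR - Var OutL))"
    using adm by (auto simp: admissible_choice_def)
  have subst_in: "indets (?s p) \<subseteq> {1..M}" if "indets p \<subseteq> ?V" for p
    using that ends by (intro indets_poly_subst) (auto dest!: subsetD)
  then show "indets A' \<subseteq> {1..M}" "indets F' \<subseteq> {1..M}" using ind by (simp_all add: A'_def F'_def)
  have "?s (A * (Var OutL + Var OutR - Var InL - Var InR) +
       F * ((Var OutL - Var InL) * (Var InR - Var OutL))) = A' * \<rho> + F' * (u * v)"
    by (simp add: poly_subst_simps A'_def F'_def \<rho>_def u_def v_def)
  then show "A' * \<rho> + F' * (u * v) = Var k ^ (N + 1) + Var l ^ (N + 1) - Var i ^ (N + 1) - Var j ^ (N + 1)"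
    unfolding eq[symmetric] by (simp add: poly_subst_simps poly_subst_power)
  have deriv: "indets (?s (pderiv z p)) \<subseteq> {1..M}" if "indets p \<subseteq> ?V" for z p
    using that indets_pderiv[of z p] by (intro subst_in) blast
  have powers: "pderiv z (Var w ^ (N + 1)) = (if z = w then of_nat (N + 1) * Var w ^ N else 0)" for z w :: crossing_var
    unfolding Suc_eq_plus1[symmetric] pderiv_power pderiv_Var by simp
  have "pderiv OutL (Var OutL ^ (N + 1) + Var OutR ^ (N + 1) - Var InL ^ (N + 1) - Var InR ^ (N + 1)) =
      of_nat (N + 1) * Var OutL ^ N"
    unfolding pderiv_add pderiv_diff powers by simp
  then have "of_nat (N + 1) * Var OutL ^ N = pderiv OutL A * (Var OutL + Var OutR - Var InL - Var InR) + A
      + pderiv OutL F * ((Var OutL - Var InL) * (Var InR - Var OutL))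
      + F * ((Var InR - Var OutL) - (Var OutL - Var InL))"
    unfolding eq by (simp add: pderiv_add pderiv_diff pderiv_mult pderiv_Var add.assoc)
  from arg_cong[OF this, of ?s]
  have k: "of_nat (N + 1) * Var k ^ N = ?s (pderiv OutL A) * \<rho> + A' + ?s (pderiv OutL F) * (u * v) + F' * (v - u)"
    by (simp only: poly_subst_simps poly_subst_power poly_subst_of_nat specialize.simps A'_def F'_def \<rho>_def u_def v_def)
  then show "\<exists>A1 F1. indets A1 \<subseteq> {1..M} \<and> indets F1 \<subseteq> {1..M} \<and>
      of_nat (N + 1) * Var k ^ N = A1 * \<rho> + A' + F1 * (u * v) + F' * (v - u)"
    using deriv ind by blast
  \<comment> \<open>At the origin every term on the right of the identity other than
    \<open>A'\<close> vanishes, and the left side vanishes because \<open>N \<ge> 1\<close>.\<close>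
  have "const_coeff (of_nat (N + 1) * Var k ^ N) = 0" using N by simp
  then show "const_coeff A' = 0" unfolding k by (simp add: \<rho>_def u_def v_def)
  have "pderiv OutR (Var OutL ^ (N + 1) + Var OutR ^ (N + 1) - Var InL ^ (N + 1) - Var InR ^ (N + 1)) =
      of_nat (N + 1) * Var OutR ^ N"
    unfolding pderiv_add pderiv_diff powers by simp
  then have "of_nat (N + 1) * Var OutR ^ N = pderiv OutR A * (Var OutL + Var OutR - Var InL - Var InR) + A
      + pderiv OutR F * ((Var OutL - Var InL) * (Var InR - Var OutL))"
    unfolding eq by (simp add: pderiv_add pderiv_diff pderiv_mult pderiv_Var)
  from arg_cong[OF this, of ?s]
  have "of_nat (N + 1) * Var l ^ N = ?s (pderiv OutR A) * \<rho> + A' + ?s (pderiv OutR F) * (u * v)"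
    by (simp only: poly_subst_simps poly_subst_power poly_subst_of_nat specialize.simps A'_def F'_def \<rho>_def u_def v_def)
  then show "\<exists>A1 F1. indets A1 \<subseteq> {1..M} \<and> indets F1 \<subseteq> {1..M} \<and>
      of_nat (N + 1) * Var l ^ N = A1 * \<rho> + A' + F1 * (u * v)"
    using deriv ind by blast
qed

section \<open>Tensor products of complexes of matrix factorizations\<close>

text \<open>Matrices are indexed by the source first, so this is \<open>a\<close> followed by
  \<open>b\<close>.\<close>

definition mprod :: "'b set \<Rightarrow> ('b \<Rightarrow> 'b \<Rightarrow> 's::comm_ring_1) \<Rightarrow> ('b \<Rightarrow> 'b \<Rightarrow> 's) \<Rightarrow> 'b \<Rightarrow> 'b \<Rightarrow> 's" where
  "mprod B a b x z = (\<Sum>y\<in>B. a x y * b y z)"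

definition cons_set :: "'b set \<Rightarrow> 'b list set \<Rightarrow> 'b list set" where
  "cons_set B B' = {b # bs | b bs. b \<in> B \<and> bs \<in> B'}"

text \<open>The common form of both differentials and of homotopies on a tensor product, with
  \<open>e\<close> as the Koszul sign.\<close>

definition tmat :: "('b \<Rightarrow> 'b \<Rightarrow> 's::comm_ring_1) \<Rightarrow> ('b \<Rightarrow> 's) \<Rightarrow> ('b list \<Rightarrow> 'b list \<Rightarrow> 's) \<Rightarrow> 'b list \<Rightarrow> 'b list \<Rightarrow> 's" where
  "tmat a e b x y = (if tl x = tl y then a (hd x) (hd y) else 0) + (if hd x = hd y then e (hd x) * b (tl x) (tl y) else 0)"

lemma cons_set_image: "cons_set B B' = (\<lambda>(b, bs). b # bs) ` (B \<times> B')"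
  by (auto simp: cons_set_def)

lemma finite_cons_set: "finite B \<Longrightarrow> finite B' \<Longrightarrow> finite (cons_set B B')"
  by (simp add: cons_set_image)

lemma sum_cons_set: "(\<Sum>y\<in>cons_set B B'. g y) = (\<Sum>b\<in>B. \<Sum>bs\<in>B'. g (b # bs))"
proof -
  have "inj_on (\<lambda>(b, bs). b # bs) (B \<times> B')" by (auto simp: inj_on_def)
  then have "(\<Sum>y\<in>cons_set B B'. g y) = (\<Sum>(b, bs)\<in>B \<times> B'. g (b # bs))"
    unfolding cons_set_image by (simp add: sum.reindex case_prod_unfold)
  then show ?thesis by (simp add: sum.cartesian_product)
qed

text \<open>There are two pure and two mixed terms. The sign of a mixed term is taken at the target
  \<open>h'\<close> if the first factor acts first and at the source \<open>h\<close> otherwise;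
  cancellation is decided by comparing the two.\<close>

lemma mprod_tmat:
  fixes a a' :: "'b \<Rightarrow> 'b \<Rightarrow> 's::comm_ring_1"
  assumes fin: "finite B" "finite B'" and mem: "h \<in> B" "h' \<in> B" "t \<in> B'" "t' \<in> B'"
  shows "mprod (cons_set B B') (tmat a e b) (tmat a' e' b') (h # t) (h' # t') =
    (if t = t' then mprod B a a' h h' else 0) + e' h' * a h h' * b' t t' +
    e h * a' h h' * b t t' + (if h = h' then e h * e' h * mprod B' b b' t t' else 0)"
proof -
  have *: "(if t = s then x else 0) * y = (if t = s then x * y else 0)" for s and x y :: 's
    and t by simp
  have **: "y * (if t = s then x else 0) = (if t = s then y * x else 0)" for s and x y :: 's
    and t by simp
  have 1: "(\<Sum>k\<in>B. \<Sum>s\<in>B'. (if t = s then a h k else 0) * (if s = t' then a' k h' else 0)) =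
      (if t = t' then mprod B a a' h h' else 0)"
    using fin mem by (simp add: * mprod_def)
  have "(\<Sum>k\<in>B. \<Sum>s\<in>B'. (if t = s then a h k else 0) * (if k = h' then e' k * b' s t' else 0)) =
      (\<Sum>k\<in>B. if k = h' then (\<Sum>s\<in>B'. (if t = s then a h k * (e' k * b' s t') else 0)) else 0)"
    by (intro sum.cong refl, rename_tac k, case_tac "k = h'") (auto simp: *)
  also have "\<dots> = e' h' * a h h' * b' t t'"
    using fin mem by (simp add: ac_simps)
  finally have 2: "(\<Sum>k\<in>B. \<Sum>s\<in>B'. (if t = s then a h k else 0) * (if k = h' then e' k * b' s t' else 0)) =
      e' h' * a h h' * b' t t'" .
  have 3: "(\<Sum>k\<in>B. \<Sum>s\<in>B'. (if h = k then e h * b t s else 0) * (if s = t' then a' k h' else 0)) =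
      e h * a' h h' * b t t'"
  proof -
    have "(\<Sum>k\<in>B. \<Sum>s\<in>B'. (if h = k then e h * b t s else 0) * (if s = t' then a' k h' else 0)) =
        (\<Sum>k\<in>B. if h = k then (\<Sum>s\<in>B'. (if s = t' then e h * b t s * a' k h' else 0)) else 0)"
      by (intro sum.cong refl, rename_tac k, case_tac "h = k") (auto simp: ** intro!: sum.neutral)
    also have "\<dots> = e h * a' h h' * b t t'"
      using fin mem by (simp add: ac_simps)
    finally show ?thesis .
  qed
  have "(\<Sum>k\<in>B. \<Sum>s\<in>B'. (if h = k then e h * b t s else 0) * (if k = h' then e' k * b' s t' else 0)) =
      (\<Sum>k\<in>B. if h = k then (\<Sum>s\<in>B'. e h * b t s * (if h = h' then e' h * b' s t' else 0)) else 0)"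
    by (intro sum.cong refl) auto
  also have "\<dots> = (if h = h' then e h * e' h * mprod B' b b' t t' else 0)"
    using fin mem by (simp add: mprod_def sum_distrib_left ac_simps)
  finally have 4: "(\<Sum>k\<in>B. \<Sum>s\<in>B'. (if h = k then e h * b t s else 0) * (if k = h' then e' k * b' s t' else 0)) =
    (if h = h' then e h * e' h * mprod B' b b' t t' else 0)" .
  show ?thesis
    unfolding mprod_def[of "cons_set B B'"] sum_cons_set tmat_def list.sel distrib_left distrib_right sum.distrib 1 2 3 4
    by (simp add: algebra_simps)
qed

lemma psign_mult_self: "psign k * psign k = 1"
  by (simp add: psign_def)

lemma psign_odd: "odd (l - k) \<Longrightarrow> psign l = - psign k"
  by (auto simp: psign_def)

lemma psign_even: "even (l - k) \<Longrightarrow> psign l = psign k"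
  by (auto simp: psign_def)

text \<open>A complex of matrix factorizations of potential \<open>W\<close>. The degree conditions
  are included because the signs in tensor products depend on them.\<close>

definition mf_ok :: "('b, 's::comm_ring_1) mf_complex \<Rightarrow> 's \<Rightarrow> bool" where
  "mf_ok C W \<longleftrightarrow> finite (basis C) \<and> (\<forall>x\<in>basis C. \<forall>z\<in>basis C.
     mprod (basis C) (dmat C) (dmat C) x z = (if x = z then W else 0) \<and>
     mprod (basis C) (vmat C) (vmat C) x z = 0 \<and>
     mprod (basis C) (dmat C) (vmat C) x z = mprod (basis C) (vmat C) (dmat C) x z \<and>
     (dmat C x z \<noteq> 0 \<longrightarrow> odd (par C z - par C x) \<and> hdeg C z = hdeg C x) \<and>
     (vmat C x z \<noteq> 0 \<longrightarrow> even (par C z - par C x) \<and> hdeg C z = hdeg C x + 1))"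

lemma mf_okD:
  assumes "mf_ok C W"
  shows "finite (basis C)"
    and "x \<in> basis C \<Longrightarrow> z \<in> basis C \<Longrightarrow> mprod (basis C) (dmat C) (dmat C) x z = (if x = z then W else 0)"
    and "x \<in> basis C \<Longrightarrow> z \<in> basis C \<Longrightarrow> mprod (basis C) (vmat C) (vmat C) x z = 0"
    and "x \<in> basis C \<Longrightarrow> z \<in> basis C \<Longrightarrow>
      mprod (basis C) (dmat C) (vmat C) x z = mprod (basis C) (vmat C) (dmat C) x z"
    and "x \<in> basis C \<Longrightarrow> z \<in> basis C \<Longrightarrow> dmat C x z \<noteq> 0 \<Longrightarrow> odd (par C z - par C x)"
    and "x \<in> basis C \<Longrightarrow> z \<in> basis C \<Longrightarrow> dmat C x z \<noteq> 0 \<Longrightarrow> hdeg C z = hdeg C x"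
    and "x \<in> basis C \<Longrightarrow> z \<in> basis C \<Longrightarrow> vmat C x z \<noteq> 0 \<Longrightarrow> even (par C z - par C x)"
    and "x \<in> basis C \<Longrightarrow> z \<in> basis C \<Longrightarrow> vmat C x z \<noteq> 0 \<Longrightarrow> hdeg C z = hdeg C x + 1"
  using assms unfolding mf_ok_def by blast+

lemma basis_tensor: "basis (tensor (C # Cs)) = cons_set (basis C) (basis (tensor Cs))"
  by (simp add: cons_set_def)

lemma dmat_tensor: "dmat (tensor (C # Cs)) = tmat (dmat C) (\<lambda>h. psign (par C h)) (dmat (tensor Cs))"
  by (simp add: fun_eq_iff tmat_def)

lemma vmat_tensor: "vmat (tensor (C # Cs)) = tmat (vmat C) (\<lambda>h. psign (hdeg C h)) (vmat (tensor Cs))"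
  by (simp add: fun_eq_iff tmat_def)

lemma par_tensor: "par (tensor (C # Cs)) (h # t) = par C h + par (tensor Cs) t"
  and hdeg_tensor: "hdeg (tensor (C # Cs)) (h # t) = hdeg C h + hdeg (tensor Cs) t"
  by simp_all

lemma mf_ok_tensor_Nil: "mf_ok (tensor []) 0"
  by (simp add: mf_ok_def mprod_def)

lemma mf_ok_tensor_Cons:
  fixes C :: "('b, 's::comm_ring_1) mf_complex"
  assumes C: "mf_ok C W" and Cs: "mf_ok (tensor Cs) W'"
  shows "mf_ok (tensor (C # Cs)) (W + W')"
proof -
  let ?T = "tensor Cs"
  note C' = mf_okD[OF C] and T' = mf_okD[OF Cs]
  have fin: "finite (basis C)" "finite (basis ?T)" by (fact C' T')+
  show ?thesis
    unfolding mf_ok_def basis_tensor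
  proof (intro conjI ballI)
    show "finite (cons_set (basis C) (basis ?T))" by (intro finite_cons_set fin)
  next
    fix x z assume "x \<in> cons_set (basis C) (basis ?T)" "z \<in> cons_set (basis C) (basis ?T)"
    then obtain h t h' t' where x: "x = h # t" and z: "z = h' # t'"
      and mem: "h \<in> basis C" "h' \<in> basis C" "t \<in> basis ?T" "t' \<in> basis ?T"
      by (auto simp: cons_set_def)
    note prod = mprod_tmat[OF fin mem]
    note C'' = C'(2-)[OF mem(1,2)] and T'' = T'(2-)[OF mem(3,4)]
    \<comment> \<open>\<open>d\<close> flips the parity and keeps the homological degree,
      \<open>v\<close> keeps the parity and raises the homological degree by one. So the mixed terms
      cancel in both squares and match in the two orders of composing \<open>d\<close> with
      \<open>v\<close>.\<close>
    have dC: "psign (par C h') * dmat C h h' = - (psign (par C h) * dmat C h h')"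
      "psign (hdeg C h') * dmat C h h' = psign (hdeg C h) * dmat C h h'"
      using psign_odd[OF C''(4), where 'a = 's] C''(5) by (cases "dmat C h h' = 0"; simp)+
    have vC: "psign (par C h') * vmat C h h' = psign (par C h) * vmat C h h'"
      "psign (hdeg C h') * vmat C h h' = - (psign (hdeg C h) * vmat C h h')"
      using psign_even[OF C''(6), where 'a = 's] psign_odd[of "hdeg C h'" "hdeg C h", where 'a = 's] C''(7)
      by (cases "vmat C h h' = 0"; simp)+
    show "mprod (cons_set (basis C) (basis ?T)) (dmat (tensor (C # Cs))) (dmat (tensor (C # Cs))) x z =
        (if x = z then W + W' else 0)"
      unfolding dmat_tensor x z prod C''(1) T''(1) dC psign_mult_self by auto
    show "mprod (cons_set (basis C) (basis ?T)) (vmat (tensor (C # Cs))) (vmat (tensor (C # Cs))) x z = 0"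
      unfolding vmat_tensor x z prod C''(2) T''(2) vC by auto
    show "mprod (cons_set (basis C) (basis ?T)) (dmat (tensor (C # Cs))) (vmat (tensor (C # Cs))) x z =
        mprod (cons_set (basis C) (basis ?T)) (vmat (tensor (C # Cs))) (dmat (tensor (C # Cs))) x z"
      unfolding dmat_tensor vmat_tensor x z prod C''(3) T''(3) vC dC by (simp add: ac_simps)
    have d_nz: "t = t' \<and> dmat C h h' \<noteq> 0 \<or> h = h' \<and> dmat ?T t t' \<noteq> 0" if "dmat (tensor (C # Cs)) x z \<noteq> 0"
      using that unfolding dmat_tensor x z tmat_def by (auto split: if_splits)
    have "dmat (tensor (C # Cs)) x z \<noteq> 0 \<Longrightarrow> odd (par (tensor (C # Cs)) z - par (tensor (C # Cs)) x)"
      using d_nz C''(4) T''(4) unfolding x z par_tensor by fastforce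
    moreover have "dmat (tensor (C # Cs)) x z \<noteq> 0 \<Longrightarrow> hdeg (tensor (C # Cs)) z = hdeg (tensor (C # Cs)) x"
      using d_nz C''(5) T''(5) unfolding x z hdeg_tensor by fastforce
    ultimately show "dmat (tensor (C # Cs)) x z \<noteq> 0 \<longrightarrow> odd (par (tensor (C # Cs)) z - par (tensor (C # Cs)) x) \<and>
        hdeg (tensor (C # Cs)) z = hdeg (tensor (C # Cs)) x" by blast
    have v_nz: "t = t' \<and> vmat C h h' \<noteq> 0 \<or> h = h' \<and> vmat ?T t t' \<noteq> 0" if "vmat (tensor (C # Cs)) x z \<noteq> 0"
      using that unfolding vmat_tensor x z tmat_def by (auto split: if_splits)
    have "vmat (tensor (C # Cs)) x z \<noteq> 0 \<Longrightarrow> even (par (tensor (C # Cs)) z - par (tensor (C # Cs)) x)"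
      using v_nz C''(6) T''(6) unfolding x z par_tensor by fastforce
    moreover have "vmat (tensor (C # Cs)) x z \<noteq> 0 \<Longrightarrow> hdeg (tensor (C # Cs)) z = hdeg (tensor (C # Cs)) x + 1"
      using v_nz C''(7) T''(7) unfolding x z hdeg_tensor by fastforce
    ultimately show "vmat (tensor (C # Cs)) x z \<noteq> 0 \<longrightarrow> even (par (tensor (C # Cs)) z - par (tensor (C # Cs)) x) \<and>
        hdeg (tensor (C # Cs)) z = hdeg (tensor (C # Cs)) x + 1" by blast
  qed
qed

lemma mf_ok_tensor: "list_all2 mf_ok Cs Ws \<Longrightarrow> mf_ok (tensor Cs) (sum_list Ws)"
proof (induction Cs Ws rule: list_all2_induct)
  case Nil
  show ?case using mf_ok_tensor_Nil by simp
next
  case (Cons C Cs W Ws)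
  then show ?case using mf_ok_tensor_Cons[of C W Cs] by simp
qed

text \<open>Only the differential of the factorizations enters: \<open>p\<close> then acts as zero
  on their homology and so on the double homology. Oddness of \<open>h\<close> governs its sign when
  it is extended to a tensor product.\<close>

definition homotopy_on :: "'s set \<Rightarrow> ('b, 's::comm_ring_1) mf_complex \<Rightarrow> 's \<Rightarrow> ('b \<Rightarrow> 'b \<Rightarrow> 's) \<Rightarrow> bool" where
  "homotopy_on T C p h \<longleftrightarrow> (\<forall>x z. h x z \<in> T) \<and> (\<forall>x\<in>basis C. \<forall>z\<in>basis C.
     mprod (basis C) h (dmat C) x z + mprod (basis C) (dmat C) h x z = (if x = z then p else 0) \<and>
     (h x z \<noteq> 0 \<longrightarrow> odd (par C z - par C x)))"

definition nullhomotopic :: "'s set \<Rightarrow> ('b, 's::comm_ring_1) mf_complex \<Rightarrow> 's \<Rightarrow> bool" where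
  "nullhomotopic T C p \<longleftrightarrow> (\<exists>h. homotopy_on T C p h)"

lemma homotopy_onD:
  assumes "homotopy_on T C p h"
  shows "h x z \<in> T"
    and "x \<in> basis C \<Longrightarrow> z \<in> basis C \<Longrightarrow>
      mprod (basis C) h (dmat C) x z + mprod (basis C) (dmat C) h x z = (if x = z then p else 0)"
    and "x \<in> basis C \<Longrightarrow> z \<in> basis C \<Longrightarrow> h x z \<noteq> 0 \<Longrightarrow> odd (par C z - par C x)"
  using assms by (simp_all add: homotopy_on_def)

definition entries_in :: "'s set \<Rightarrow> ('b, 's::comm_ring_1) mf_complex \<Rightarrow> bool" where
  "entries_in T C \<longleftrightarrow> (\<forall>x z. dmat C x z \<in> T \<and> vmat C x z \<in> T)"

definition subring_set :: "'s::comm_ring_1 set \<Rightarrow> bool" where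
  "subring_set T \<longleftrightarrow> 0 \<in> T \<and> 1 \<in> T \<and> (\<forall>x\<in>T. \<forall>y\<in>T. x + y \<in> T) \<and> (\<forall>x\<in>T. \<forall>y\<in>T. x * y \<in> T) \<and> (\<forall>x\<in>T. - x \<in> T)"

context
  fixes T :: "'s::comm_ring_1 set"
  assumes subring: "subring_set T"
begin

lemma T: "0 \<in> T" "1 \<in> T" "\<And>x y. x \<in> T \<Longrightarrow> y \<in> T \<Longrightarrow> x + y \<in> T" "\<And>x y. x \<in> T \<Longrightarrow> y \<in> T \<Longrightarrow> x * y \<in> T"
    "\<And>x. x \<in> T \<Longrightarrow> - x \<in> T"
  using subring by (auto simp: subring_set_def)

lemma psign_mem: "psign k \<in> T"
  using T by (simp add: psign_def)

lemma tmat_mem: "(\<And>x z. a x z \<in> T) \<Longrightarrow> (\<And>x z. b x z \<in> T) \<Longrightarrow> tmat a (\<lambda>h. psign (f h)) b x z \<in> T"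
  using T psign_mem by (auto simp: tmat_def)

lemma entries_in_tensor: "(\<And>C. C \<in> set Cs \<Longrightarrow> entries_in T C) \<Longrightarrow> entries_in T (tensor Cs)"
proof (induction Cs)
  case (Cons C Cs)
  then have "entries_in T C" "entries_in T (tensor Cs)" by auto
  then show ?case unfolding entries_in_def dmat_tensor vmat_tensor
    by (intro allI conjI tmat_mem) auto
qed (simp add: entries_in_def T)

lemma nullhomotopic_add:
  assumes "nullhomotopic T C p" "nullhomotopic T C q"
  shows "nullhomotopic T C (p + q)"
proof -
  obtain h h' where h: "homotopy_on T C p h" "homotopy_on T C q h'"
    using assms unfolding nullhomotopic_def by blast
  note D = homotopy_onD[OF h(1)] homotopy_onD[OF h(2)]
  have eq: "mprod (basis C) (\<lambda>x z. h x z + h' x z) (dmat C) x z + mprod (basis C) (dmat C) (\<lambda>x z. h x z + h' x z) x z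
     = (mprod (basis C) h (dmat C) x z + mprod (basis C) (dmat C) h x z)
     + (mprod (basis C) h' (dmat C) x z + mprod (basis C) (dmat C) h' x z)" for x z
    by (simp add: mprod_def algebra_simps sum.distrib)
  have "homotopy_on T C (p + q) (\<lambda>x z. h x z + h' x z)"
    unfolding homotopy_on_def eq
  proof (intro conjI allI ballI impI)
    fix x z assume "x \<in> basis C" "z \<in> basis C" "h x z + h' x z \<noteq> 0"
    then show "odd (par C z - par C x)" using D(3,6)[of x z] by (cases "h x z = 0") auto
  qed (use D T(3) in auto)
  then show ?thesis unfolding nullhomotopic_def by blast
qed

lemma nullhomotopic_mult:
  assumes "nullhomotopic T C p" "a \<in> T"
  shows "nullhomotopic T C (a * p)"
proof -
  obtain h where h: "homotopy_on T C p h" using assms unfolding nullhomotopic_def by blast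
  note D = homotopy_onD[OF h]
  have eq: "mprod (basis C) (\<lambda>x z. a * h x z) (dmat C) x z + mprod (basis C) (dmat C) (\<lambda>x z. a * h x z) x z
     = a * (mprod (basis C) h (dmat C) x z + mprod (basis C) (dmat C) h x z)" for x z
    by (simp add: mprod_def algebra_simps sum_distrib_left)
  have "homotopy_on T C (a * p) (\<lambda>x z. a * h x z)"
    unfolding homotopy_on_def eq
  proof (intro conjI allI ballI impI)
    fix x z assume "x \<in> basis C" "z \<in> basis C" "a * h x z \<noteq> 0"
    then show "odd (par C z - par C x)" using D(3)[of x z] by (metis mult_zero_right)
  qed (use D T(4) assms(2) in auto)
  then show ?thesis unfolding nullhomotopic_def by blast
qed

text \<open>The homotopy acts on the first factor. Being odd, it anticommutes with the signed
  differential of the remaining factors.\<close>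

lemma nullhomotopic_Cons:
  assumes C: "mf_ok C W" "nullhomotopic T C p" and Cs: "mf_ok (tensor Cs) W'"
  shows "nullhomotopic T (tensor (C # Cs)) p"
proof -
  let ?T = "tensor Cs"
  have fin: "finite (basis C)" "finite (basis ?T)" using C Cs by (auto simp: mf_ok_def)
  obtain h where "homotopy_on T C p h" using C(2) unfolding nullhomotopic_def by blast
  note h = homotopy_onD[OF this]
  let ?h = "tmat h (\<lambda>h. psign (par C h)) (\<lambda>_ _. 0)"
  show ?thesis unfolding nullhomotopic_def homotopy_on_def basis_tensor
  proof (intro exI[of _ ?h] conjI allI ballI)
    show "?h x z \<in> T" for x z using h T by (intro tmat_mem) auto
    fix x z assume "x \<in> cons_set (basis C) (basis ?T)" "z \<in> cons_set (basis C) (basis ?T)"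
    then obtain k t k' t' where x: "x = k # t" and z: "z = k' # t'"
      and mem: "k \<in> basis C" "k' \<in> basis C" "t \<in> basis ?T" "t' \<in> basis ?T"
      by (auto simp: cons_set_def)
    have hk: "psign (par C k') * h k k' = - (psign (par C k) * h k k' :: 's)"
    proof (cases "h k k' = 0")
      case False
      have "psign (par C k') = (- psign (par C k) :: 's)"
        by (rule psign_odd) (rule h(3)[OF mem(1,2) False])
      then show ?thesis by simp
    qed simp
    have z0: "mprod (basis ?T) (\<lambda>_ _. 0) b t t' = 0" "mprod (basis ?T) b (\<lambda>_ _. 0) t t' = 0" for b
      by (simp_all add: mprod_def)
    show "mprod (cons_set (basis C) (basis ?T)) ?h (dmat (tensor (C # Cs))) x z +
      mprod (cons_set (basis C) (basis ?T)) (dmat (tensor (C # Cs))) ?h x z = (if x = z then p else 0)"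
      unfolding dmat_tensor x z mprod_tmat[OF fin mem] z0 hk using h(2)[OF mem(1,2)] by auto
    have "t = t' \<and> h k k' \<noteq> 0" if "?h x z \<noteq> 0"
      using that unfolding x z tmat_def by (auto split: if_splits)
    then show "?h x z \<noteq> 0 \<longrightarrow> odd (par (tensor (C # Cs)) z - par (tensor (C # Cs)) x)"
      unfolding x z par_tensor using h(3)[OF mem(1,2)] by fastforce
  qed
qed

text \<open>The homotopy of the remaining factors receives the Koszul sign, and so anticommutes with
  the odd differential of \<open>C\<close>.\<close>

lemma nullhomotopic_Cons':
  assumes C: "mf_ok C W" and Cs: "mf_ok (tensor Cs) W'" "nullhomotopic T (tensor Cs) p"
  shows "nullhomotopic T (tensor (C # Cs)) p"
proof -
  let ?T = "tensor Cs"
  have fin: "finite (basis C)" "finite (basis ?T)" using C Cs by (auto simp: mf_ok_def)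
  obtain h where "homotopy_on T ?T p h" using Cs(2) unfolding nullhomotopic_def by blast
  note h = homotopy_onD[OF this]
  let ?h = "tmat (\<lambda>_ _. 0) (\<lambda>h. psign (par C h)) h"
  show ?thesis unfolding nullhomotopic_def homotopy_on_def basis_tensor
  proof (intro exI[of _ ?h] conjI allI ballI)
    show "?h x z \<in> T" for x z using h T by (intro tmat_mem) auto
    fix x z assume "x \<in> cons_set (basis C) (basis ?T)" "z \<in> cons_set (basis C) (basis ?T)"
    then obtain k t k' t' where x: "x = k # t" and z: "z = k' # t'"
      and mem: "k \<in> basis C" "k' \<in> basis C" "t \<in> basis ?T" "t' \<in> basis ?T"
      by (auto simp: cons_set_def)
    have dk: "psign (par C k') * dmat C k k' = - (psign (par C k) * dmat C k k')"
    proof (cases "dmat C k k' = 0")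
      case False
      have "psign (par C k') = (- psign (par C k) :: 's)"
        by (rule psign_odd) (use C mem False in \<open>simp add: mf_ok_def\<close>)
      then show ?thesis by simp
    qed simp
    have z0: "mprod (basis C) (\<lambda>_ _. 0) b k k' = 0" "mprod (basis C) b (\<lambda>_ _. 0) k k' = 0" for b
      by (simp_all add: mprod_def)
    have "psign (par C k) * psign (par C k) * mprod (basis ?T) h (dmat ?T) t t' +
        psign (par C k) * psign (par C k) * mprod (basis ?T) (dmat ?T) h t t' = (if t = t' then p else 0)"
      unfolding psign_mult_self using h(2)[OF mem(3,4)] by simp
    then show "mprod (cons_set (basis C) (basis ?T)) ?h (dmat (tensor (C # Cs))) x z +
      mprod (cons_set (basis C) (basis ?T)) (dmat (tensor (C # Cs))) ?h x z = (if x = z then p else 0)"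
      unfolding dmat_tensor x z mprod_tmat[OF fin mem] z0 dk by auto
    have "k = k' \<and> h t t' \<noteq> 0" if "?h x z \<noteq> 0"
      using that unfolding x z tmat_def by (auto split: if_splits)
    then show "?h x z \<noteq> 0 \<longrightarrow> odd (par (tensor (C # Cs)) z - par (tensor (C # Cs)) x)"
      unfolding x z par_tensor using h(3)[OF mem(3,4)] by fastforce
  qed
qed

lemma nullhomotopic_tensor:
  assumes "list_all2 mf_ok Cs Ws" "C \<in> set Cs" "nullhomotopic T C p"
  shows "nullhomotopic T (tensor Cs) p"
  using assms
proof (induction Cs Ws rule: list_all2_induct)
  case (Cons D Cs W Ws)
  have ok: "mf_ok D W" "mf_ok (tensor Cs) (sum_list Ws)"
    using Cons mf_ok_tensor by auto
  show ?case
  proof (cases "C = D")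
    case True
    then show ?thesis using nullhomotopic_Cons[OF ok(1) _ ok(2)] Cons.prems(2) by simp
  next
    case False
    then have "nullhomotopic T (tensor Cs) p" using Cons by simp
    then show ?thesis by (rule nullhomotopic_Cons'[OF ok])
  qed
qed simp

end

section \<open>The complexes of a crossing and of a free circle\<close>

lemma basis_koszul [simp]: "basis (koszul f g) = {LeftCopy, RightCopy}"
  by (simp add: koszul_def)

lemma mf_ok_koszul: "mf_ok (koszul f g) (f * g)"
  by (auto simp: mf_ok_def mprod_def koszul_def mult.commute)

lemma sum_Plus: "finite A \<Longrightarrow> finite B \<Longrightarrow>
    (\<Sum>y\<in>Inl ` A \<union> Inr ` B. g y) = (\<Sum>a\<in>A. g (Inl a)) + (\<Sum>b\<in>B. g (Inr b))"
  by (subst sum.union_disjoint) (auto simp: sum.reindex)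

lemma mf_ok_two_term:
  assumes C: "mf_ok C W" and D: "mf_ok D W"
    and \<chi>: "\<And>x z. x \<in> basis C \<Longrightarrow> z \<in> basis D \<Longrightarrow>
        (\<Sum>y\<in>basis C. dmat C x y * \<chi> y z) = (\<Sum>y\<in>basis D. \<chi> x y * dmat D y z)"
    and par: "\<And>x z. x \<in> basis C \<Longrightarrow> z \<in> basis D \<Longrightarrow> \<chi> x z \<noteq> 0 \<Longrightarrow> even (par D z - par C x)"
  shows "mf_ok (two_term h C D \<chi>) W"
proof -
  note C' = mf_okD[OF C] and D' = mf_okD[OF D]
  have mp: "mprod (basis (two_term h C D \<chi>)) a b x z = (\<Sum>y\<in>basis C. a x (Inl y) * b (Inl y) z) + (\<Sum>y\<in>basis D. a x (Inr y) * b (Inr y) z)" for a b x z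
    by (simp add: mprod_def two_term_def sum_Plus C'(1) D'(1))
  show ?thesis unfolding mf_ok_def mp
  proof (intro conjI ballI)
    show "finite (basis (two_term h C D \<chi>))" using C'(1) D'(1) by (simp add: two_term_def)
  next
    fix x z assume "x \<in> basis (two_term h C D \<chi>)" "z \<in> basis (two_term h C D \<chi>)"
    then have xz: "x \<in> Inl ` basis C \<union> Inr ` basis D" "z \<in> Inl ` basis C \<union> Inr ` basis D"
      by (simp_all add: two_term_def)
    let ?T = "two_term h C D \<chi>"
    show "(\<Sum>y\<in>basis C. dmat ?T x (Inl y) * dmat ?T (Inl y) z) + (\<Sum>y\<in>basis D. dmat ?T x (Inr y) * dmat ?T (Inr y) z) = (if x = z then W else 0)"
      using xz C'(2)[unfolded mprod_def] D'(2)[unfolded mprod_def] by (elim UnE imageE; simp add: two_term_def)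
    show "(\<Sum>y\<in>basis C. vmat ?T x (Inl y) * vmat ?T (Inl y) z) + (\<Sum>y\<in>basis D. vmat ?T x (Inr y) * vmat ?T (Inr y) z) = 0"
      using xz by (auto simp: two_term_def)
    show "(\<Sum>y\<in>basis C. dmat ?T x (Inl y) * vmat ?T (Inl y) z) + (\<Sum>y\<in>basis D. dmat ?T x (Inr y) * vmat ?T (Inr y) z) =
       (\<Sum>y\<in>basis C. vmat ?T x (Inl y) * dmat ?T (Inl y) z) + (\<Sum>y\<in>basis D. vmat ?T x (Inr y) * dmat ?T (Inr y) z)"
      using xz \<chi> by (auto simp: two_term_def)
    show "dmat ?T x z \<noteq> 0 \<longrightarrow> odd (par ?T z - par ?T x) \<and> hdeg ?T z = hdeg ?T x"
      using xz C'(5) D'(5) by (elim UnE imageE; simp add: two_term_def)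
    show "vmat ?T x z \<noteq> 0 \<longrightarrow> even (par ?T z - par ?T x) \<and> hdeg ?T z = hdeg ?T x + 1"
      using xz par by (elim UnE imageE; simp add: two_term_def)
  qed
qed

lemma mf_ok_one_term:
  assumes C: "mf_ok C W"
  shows "mf_ok (one_term C) W"
proof -
  note C' = mf_okD[OF C]
  have mp: "mprod (basis (one_term C)) a b x z = (\<Sum>y\<in>basis C. a x (Inl y) * b (Inl y) z)" for a b x z
    by (simp add: mprod_def one_term_def sum.reindex)
  show ?thesis unfolding mf_ok_def mp
  proof (intro conjI ballI)
    show "finite (basis (one_term C))" using C'(1) by (simp add: one_term_def)
  next
    fix x z assume "x \<in> basis (one_term C)" "z \<in> basis (one_term C)"
    then have xz: "x \<in> Inl ` basis C" "z \<in> Inl ` basis C"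
      by (simp_all add: one_term_def)
    let ?T = "one_term C"
    show "(\<Sum>y\<in>basis C. dmat ?T x (Inl y) * dmat ?T (Inl y) z) = (if x = z then W else 0)"
      using xz C'(2)[unfolded mprod_def] by (elim imageE; simp add: one_term_def)
    show "(\<Sum>y\<in>basis C. vmat ?T x (Inl y) * vmat ?T (Inl y) z) = 0"
      "(\<Sum>y\<in>basis C. dmat ?T x (Inl y) * vmat ?T (Inl y) z) = (\<Sum>y\<in>basis C. vmat ?T x (Inl y) * dmat ?T (Inl y) z)"
      by (simp_all add: one_term_def)
    show "dmat ?T x z \<noteq> 0 \<longrightarrow> odd (par ?T z - par ?T x) \<and> hdeg ?T z = hdeg ?T x"
      using xz C'(5) by (elim imageE; simp add: one_term_def)
    show "vmat ?T x z \<noteq> 0 \<longrightarrow> even (par ?T z - par ?T x) \<and> hdeg ?T z = hdeg ?T x + 1"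
      by (simp add: one_term_def)
  qed
qed

text \<open>After reduction modulo the variables, such an element spans a summand on which both
  differentials vanish, so it stays visible in homology.\<close>

definition isolated :: "('b, 'v mpoly) mf_complex \<Rightarrow> 'b \<Rightarrow> bool" where
  "isolated C b \<longleftrightarrow> b \<in> basis C \<and> (\<forall>x\<in>basis C.
    const_coeff (dmat C x b) = 0 \<and> const_coeff (dmat C b x) = 0 \<and> const_coeff (vmat C x b) = 0 \<and> const_coeff (vmat C b x) = 0)"

lemma isolated_tensor: "(\<And>C. C \<in> set Cs \<Longrightarrow> \<exists>b. isolated C b) \<Longrightarrow> \<exists>b. isolated (tensor Cs) b"
proof (induction Cs)
  case Nil
  then show ?case by (simp add: isolated_def)
next
  case (Cons C Cs)
  from Cons.prems[of C] obtain b where b: "isolated C b" by auto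
  from Cons obtain bs where bs: "isolated (tensor Cs) bs" by auto
  have "isolated (tensor (C # Cs)) (b # bs)"
    using b bs unfolding isolated_def basis_tensor dmat_tensor vmat_tensor
    by (auto simp: cons_set_def tmat_def)
  then show ?case by blast
qed

definition poly_carrier :: "'v set \<Rightarrow> 'v mpoly set" where
  "poly_carrier V = {p. indets p \<subseteq> V}"

lemma poly_carrier_closed:
  "0 \<in> poly_carrier V" "1 \<in> poly_carrier V"
  "x \<in> poly_carrier V \<Longrightarrow> y \<in> poly_carrier V \<Longrightarrow> x + y \<in> poly_carrier V"
  "x \<in> poly_carrier V \<Longrightarrow> y \<in> poly_carrier V \<Longrightarrow> x * y \<in> poly_carrier V"
  "x \<in> poly_carrier V \<Longrightarrow> - x \<in> poly_carrier V"
  by (simp_all add: poly_carrier_def indets_closed)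

lemma subring_poly_carrier: "subring_set (poly_carrier V)"
  by (simp add: subring_set_def poly_carrier_closed)

lemma poly_carrier_diff:
  "x \<in> poly_carrier V \<Longrightarrow> y \<in> poly_carrier V \<Longrightarrow> x - y \<in> poly_carrier V"
  by (simp add: poly_carrier_def indets_closed)

lemmas poly_nullhomotopic_add = nullhomotopic_add[OF subring_poly_carrier]
lemmas poly_nullhomotopic_mult = nullhomotopic_mult[OF subring_poly_carrier]
lemmas poly_nullhomotopic_tensor = nullhomotopic_tensor[OF subring_poly_carrier]
lemmas poly_entries_in_tensor = entries_in_tensor[OF subring_poly_carrier]

text \<open>For \<open>f\<close> the homotopy has a 1 where the differential has \<open>g\<close>,
  and for \<open>g\<close> a 1 where it has \<open>f\<close>; composing with the other map in either
  order gives the scalar.\<close>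

lemma nullhomotopic_koszul:
  "nullhomotopic (poly_carrier V) (koszul f g) f" "nullhomotopic (poly_carrier V) (koszul f g) g"
proof -
  have "homotopy_on (poly_carrier V) (koszul f g) f (\<lambda>b b'. if b = LeftCopy \<and> b' = RightCopy then 1 else 0)"
    by (auto simp: homotopy_on_def mprod_def koszul_def poly_carrier_closed)
  then show "nullhomotopic (poly_carrier V) (koszul f g) f" unfolding nullhomotopic_def by blast
  have "homotopy_on (poly_carrier V) (koszul f g) g (\<lambda>b b'. if b = RightCopy \<and> b' = LeftCopy then 1 else 0)"
    by (auto simp: homotopy_on_def mprod_def koszul_def poly_carrier_closed)
  then show "nullhomotopic (poly_carrier V) (koszul f g) g" unfolding nullhomotopic_def by blast
qed

text \<open>\<open>\<chi>\<close> belongs to the other differential, so the homotopies of the two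
  terms can be chosen independently and put side by side.\<close>

lemma nullhomotopic_two_term:
  fixes C D :: "('b, 'v mpoly) mf_complex"
  assumes "mf_ok C W" "mf_ok D W" "nullhomotopic (poly_carrier V) C p" "nullhomotopic (poly_carrier V) D p"
  shows "nullhomotopic (poly_carrier V) (two_term k C D \<chi>) p"
proof -
  obtain h h' where "homotopy_on (poly_carrier V) C p h" "homotopy_on (poly_carrier V) D p h'"
    using assms unfolding nullhomotopic_def by blast
  note h = homotopy_onD[OF this(1)] and h' = homotopy_onD[OF this(2)]
  note fin = mf_okD(1)[OF assms(1)] mf_okD(1)[OF assms(2)]
  let ?T = "two_term k C D \<chi>"
  define H where "H x z = (case (x, z) of (Inl b, Inl b') \<Rightarrow> h b b' | (Inr b, Inr b') \<Rightarrow> h' b b' | _ \<Rightarrow> 0)" for x z :: "'b + 'b"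
  have mp: "mprod (basis ?T) a b x z = (\<Sum>y\<in>basis C. a x (Inl y) * b (Inl y) z) + (\<Sum>y\<in>basis D. a x (Inr y) * b (Inr y) z)" for a b x z
    by (simp add: mprod_def two_term_def sum_Plus fin)
  have "homotopy_on (poly_carrier V) ?T p H"
    unfolding homotopy_on_def mp
  proof (intro conjI allI ballI)
    show "H x z \<in> poly_carrier V" for x z
      using h(1) h'(1) by (auto simp: H_def poly_carrier_closed split: sum.split)
    fix x z assume "x \<in> basis ?T" "z \<in> basis ?T"
    then have xz: "x \<in> Inl ` basis C \<union> Inr ` basis D" "z \<in> Inl ` basis C \<union> Inr ` basis D"
      by (simp_all add: two_term_def)
    show "(\<Sum>y\<in>basis C. H x (Inl y) * dmat ?T (Inl y) z) + (\<Sum>y\<in>basis D. H x (Inr y) * dmat ?T (Inr y) z) +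
      ((\<Sum>y\<in>basis C. dmat ?T x (Inl y) * H (Inl y) z) + (\<Sum>y\<in>basis D. dmat ?T x (Inr y) * H (Inr y) z)) = (if x = z then p else 0)"
      using xz h(2)[unfolded mprod_def] h'(2)[unfolded mprod_def]
      by (elim UnE imageE; simp add: two_term_def H_def)
    show "H x z \<noteq> 0 \<longrightarrow> odd (par ?T z - par ?T x)"
      using xz h(3) h'(3) by (elim UnE imageE; simp add: two_term_def H_def)
  qed
  then show ?thesis unfolding nullhomotopic_def by blast
qed

lemma nullhomotopic_one_term:
  fixes C :: "('b, 'v mpoly) mf_complex"
  assumes "nullhomotopic (poly_carrier V) C p"
  shows "nullhomotopic (poly_carrier V) (one_term C) p"
proof -
  obtain h where "homotopy_on (poly_carrier V) C p h"
    using assms unfolding nullhomotopic_def by blast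
  note h = homotopy_onD[OF this]
  let ?T = "one_term C"
  define H where "H x z = (case (x, z) of (Inl b, Inl b') \<Rightarrow> h b b' | _ \<Rightarrow> 0)" for x z :: "'b + 'b"
  have mp: "mprod (basis ?T) a b x z = (\<Sum>y\<in>basis C. a x (Inl y) * b (Inl y) z)" for a b x z
    by (simp add: mprod_def one_term_def sum.reindex)
  have "homotopy_on (poly_carrier V) ?T p H"
    unfolding homotopy_on_def mp
  proof (intro conjI allI ballI)
    show "H x z \<in> poly_carrier V" for x z
      using h(1) by (auto simp: H_def poly_carrier_closed split: sum.split)
    fix x z assume "x \<in> basis ?T" "z \<in> basis ?T"
    then have xz: "x \<in> Inl ` basis C" "z \<in> Inl ` basis C"
      by (simp_all add: one_term_def)
    show "(\<Sum>y\<in>basis C. H x (Inl y) * dmat ?T (Inl y) z) +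
      (\<Sum>y\<in>basis C. dmat ?T x (Inl y) * H (Inl y) z) = (if x = z then p else 0)"
      using xz h(2)[unfolded mprod_def] by (elim imageE; simp add: one_term_def H_def)
    show "H x z \<noteq> 0 \<longrightarrow> odd (par ?T z - par ?T x)"
      using xz h(3) by (elim imageE; simp add: one_term_def H_def)
  qed
  then show ?thesis unfolding nullhomotopic_def by blast
qed

lemma entries_in_koszul: "f \<in> poly_carrier V \<Longrightarrow> g \<in> poly_carrier V \<Longrightarrow> entries_in (poly_carrier V) (koszul f g)"
  by (auto simp: entries_in_def koszul_def poly_carrier_closed split: side.split)

lemma entries_in_two_term:
  "entries_in (poly_carrier V) C \<Longrightarrow> entries_in (poly_carrier V) D \<Longrightarrow> (\<And>x z. \<chi> x z \<in> poly_carrier V) \<Longrightarrow>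
    entries_in (poly_carrier V) (two_term h C D \<chi>)"
  by (auto simp: entries_in_def two_term_def poly_carrier_closed split: sum.split)

lemma entries_in_one_term:
  "entries_in (poly_carrier V) C \<Longrightarrow> entries_in (poly_carrier V) (one_term C)"
  by (auto simp: entries_in_def one_term_def poly_carrier_closed split: sum.split)

lemma list_all2_koszul: "list_all2 mf_ok [koszul f g, koszul f' g'] [f * g, f' * g']"
  by (simp add: mf_ok_koszul)

lemma mf_ok_Gamma:
  "mf_ok (Gamma0 A \<rho> F u v) (A * \<rho> + F * (u * v))" "mf_ok (Gamma1 A \<rho> F u v) (A * \<rho> + F * (u * v))"
  using mf_ok_tensor[OF list_all2_koszul[of A \<rho> "F * v" u]] mf_ok_tensor[OF list_all2_koszul[of A \<rho> F "u * v"]]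
  by (simp_all add: Gamma0_def Gamma1_def mult.assoc mult.commute[of v])

lemma nullhomotopic_Gamma0:
  "p \<in> {A, \<rho>, F * v, u} \<Longrightarrow> nullhomotopic (poly_carrier V) (Gamma0 A \<rho> F u v) p"
  unfolding Gamma0_def
  using poly_nullhomotopic_tensor[OF list_all2_koszul[of A \<rho> "F * v" u], of _ V p] nullhomotopic_koszul by fastforce

lemma nullhomotopic_Gamma1:
  "p \<in> {A, \<rho>, F, u * v} \<Longrightarrow> nullhomotopic (poly_carrier V) (Gamma1 A \<rho> F u v) p"
  unfolding Gamma1_def
  using poly_nullhomotopic_tensor[OF list_all2_koszul[of A \<rho> F "u * v"], of _ V p] nullhomotopic_koszul by fastforce

lemma basis_Gamma:
  "basis (Gamma0 A \<rho> F u v) = {[a, b] | a b. True}" "basis (Gamma1 A \<rho> F u v) = {[a, b] | a b. True}"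
proof -
  have "{LeftCopy, RightCopy} = UNIV" using side.exhaust by blast
  then have "s \<in> {LeftCopy, RightCopy}" for s by simp
  then show "basis (Gamma0 A \<rho> F u v) = {[a, b] | a b. True}" "basis (Gamma1 A \<rho> F u v) = {[a, b] | a b. True}"
    unfolding Gamma0_def Gamma1_def by auto
qed

lemma sum_pairs: "(\<Sum>y\<in>{[a, b] | a b. True}. g y) = g [LeftCopy, LeftCopy] + g [LeftCopy, RightCopy] +
    g [RightCopy, LeftCopy] + g [RightCopy, RightCopy]"
proof -
  have "{[a, b] | a b. True} = {[LeftCopy, LeftCopy], [LeftCopy, RightCopy], [RightCopy, LeftCopy], [RightCopy, RightCopy]}"
    using side.exhaust by auto
  then show ?thesis by (simp add: add.assoc)
qed

lemma par_Gamma: "par (Gamma0 A \<rho> F u v) x = par (Gamma1 A \<rho> F u v) x"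
  by (simp add: Gamma0_def Gamma1_def koszul_def)

lemma mf_ok_positive: "mf_ok (two_term h (Gamma1 A \<rho> F u v) (Gamma0 A \<rho> F u v) (chi1 v)) (A * \<rho> + F * (u * v))"
proof (rule mf_ok_two_term[OF mf_ok_Gamma(2) mf_ok_Gamma(1)])
  fix x z assume "x \<in> basis (Gamma1 A \<rho> F u v)" "z \<in> basis (Gamma0 A \<rho> F u v)"
  then obtain a b a' b' where "x = [a, b]" "z = [a', b']" by (auto simp: basis_Gamma)
  then show "(\<Sum>y\<in>basis (Gamma1 A \<rho> F u v). dmat (Gamma1 A \<rho> F u v) x y * chi1 v y z) =
      (\<Sum>y\<in>basis (Gamma0 A \<rho> F u v). chi1 v x y * dmat (Gamma0 A \<rho> F u v) y z)"
    unfolding basis_Gamma sum_pairs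
    by (cases a; cases b; cases a'; cases b')
      (simp_all add: chi1_def Gamma0_def Gamma1_def koszul_def ac_simps)
  show "even (par (Gamma0 A \<rho> F u v) z - par (Gamma1 A \<rho> F u v) x)" if "chi1 v x z \<noteq> 0"
    using that by (auto simp: chi1_def par_Gamma split: if_splits)
qed

lemma mf_ok_negative: "mf_ok (two_term h (Gamma0 A \<rho> F u v) (Gamma1 A \<rho> F u v) (chi0 v)) (A * \<rho> + F * (u * v))"
proof (rule mf_ok_two_term[OF mf_ok_Gamma])
  fix x z assume "x \<in> basis (Gamma0 A \<rho> F u v)" "z \<in> basis (Gamma1 A \<rho> F u v)"
  then obtain a b a' b' where "x = [a, b]" "z = [a', b']" by (auto simp: basis_Gamma)
  then show "(\<Sum>y\<in>basis (Gamma0 A \<rho> F u v). dmat (Gamma0 A \<rho> F u v) x y * chi0 v y z) =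
      (\<Sum>y\<in>basis (Gamma1 A \<rho> F u v). chi0 v x y * dmat (Gamma1 A \<rho> F u v) y z)"
    unfolding basis_Gamma sum_pairs
    by (cases a; cases b; cases a'; cases b')
      (simp_all add: chi0_def Gamma0_def Gamma1_def koszul_def ac_simps)
  show "even (par (Gamma1 A \<rho> F u v) z - par (Gamma0 A \<rho> F u v) x)" if "chi0 v x z \<noteq> 0"
    using that by (auto simp: chi0_def par_Gamma split: if_splits)
qed

text \<open>Up to sign the entries are \<open>A\<close>, \<open>\<rho>\<close>, \<open>F * v\<close>
  and \<open>u\<close>. In \<Gamma>1 the entry \<open>F\<close> stands alone, and for
  \<open>N = 1\<close> it is a nonzero constant.\<close>

lemma const_coeff_dmat_Gamma0:
  assumes "const_coeff A = 0" "const_coeff \<rho> = 0" "const_coeff u = 0" "const_coeff v = 0"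
  shows "const_coeff (dmat (Gamma0 A \<rho> F u v) x z) = 0"
  using assms by (auto simp: Gamma0_def koszul_def split: side.split)

text \<open>In the second tensor factor, \<open>chi1\<close> enters \<Gamma>0 with the factor
  \<open>v\<close> on the left copy and 1 on the right copy; hence the second
  \<open>LeftCopy\<close>.\<close>

lemma isolated_positive:
  assumes "const_coeff A = 0" "const_coeff \<rho> = 0" "const_coeff u = 0" "const_coeff v = 0"
  shows "isolated (two_term h (Gamma1 A \<rho> F u v) (Gamma0 A \<rho> F u v) (chi1 v)) (Inr [LeftCopy, LeftCopy])"
  unfolding isolated_def using assms const_coeff_dmat_Gamma0[OF assms]
  by (auto simp: two_term_def basis_Gamma chi1_def)

text \<open>\<open>chi0\<close> leaves \<Gamma>0 with the factor 1 on the left copy and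
  \<open>v\<close> on the right copy of the second tensor factor; hence \<open>RightCopy\<close> in
  second place.\<close>

lemma isolated_negative:
  assumes "const_coeff A = 0" "const_coeff \<rho> = 0" "const_coeff u = 0" "const_coeff v = 0"
  shows "isolated (two_term h (Gamma0 A \<rho> F u v) (Gamma1 A \<rho> F u v) (chi0 v)) (Inl [LeftCopy, RightCopy])"
  unfolding isolated_def using assms const_coeff_dmat_Gamma0[OF assms]
  by (auto simp: two_term_def basis_Gamma chi0_def)

text \<open>Homotopies for the two outgoing edges suffice later, since every edge that meets a
  crossing also leaves one.\<close>

lemma crossing_complex_properties:
  fixes s :: bool
  assumes adm: "admissible_choice N M A F" and N: "N \<ge> 1"
    and ends: "k \<in> {1..M}" "l \<in> {1..M}" "i \<in> {1..M}" "j \<in> {1..M}"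
  defines "C \<equiv> crossing_complex s A F k l i j"
  shows "mf_ok C (Var k ^ (N + 1) + Var l ^ (N + 1) - Var i ^ (N + 1) - Var j ^ (N + 1))"
    and "entries_in (poly_carrier {1..M}) C"
    and "nullhomotopic (poly_carrier {1..M}) C (Var k ^ N)"
    and "nullhomotopic (poly_carrier {1..M}) C (Var l ^ N)"
    and "\<exists>b. isolated C b"
proof -
  let ?T = "poly_carrier {1..M}"
  define A' where "A' = poly_subst (specialize k l i j) A"
  define F' where "F' = poly_subst (specialize k l i j) F"
  define \<rho> where "\<rho> = (Var k + Var l - Var i - Var j :: nat mpoly)"
  define u where "u = (Var k - Var i :: nat mpoly)"
  define v where "v = (Var j - Var k :: nat mpoly)"
  note ids = crossing_identities[OF adm N ends, folded A'_def F'_def \<rho>_def u_def v_def]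
  have C: "C = (if s then two_term (-1) (Gamma1 A' \<rho> F' u v) (Gamma0 A' \<rho> F' u v) (chi1 v)
      else two_term 0 (Gamma0 A' \<rho> F' u v) (Gamma1 A' \<rho> F' u v) (chi0 v))"
    by (simp add: C_def crossing_complex_def Let_def A'_def F'_def \<rho>_def u_def v_def)
  show "mf_ok C (Var k ^ (N + 1) + Var l ^ (N + 1) - Var i ^ (N + 1) - Var j ^ (N + 1))"
    unfolding C ids(1)[symmetric] by (simp add: mf_ok_positive mf_ok_negative)
  have Var: "Var e \<in> ?T" if "e \<in> {1..M}" for e using that by (simp add: poly_carrier_def)
  have mem: "A' \<in> ?T" "F' \<in> ?T" "\<rho> \<in> ?T" "u \<in> ?T" "v \<in> ?T"
    using ids(2,3) ends by (simp_all add: poly_carrier_def[of "{1..M}"] \<rho>_def u_def v_def indets_closed)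
  have G: "entries_in ?T (Gamma0 A' \<rho> F' u v)" "entries_in ?T (Gamma1 A' \<rho> F' u v)"
    unfolding Gamma0_def Gamma1_def
    by (intro poly_entries_in_tensor; auto intro!: entries_in_koszul mem poly_carrier_closed)+
  have chi: "chi1 v x z \<in> ?T" "chi0 v x z \<in> ?T" for x z
    using mem(5) poly_carrier_closed(1,2) by (auto simp: chi1_def chi0_def split: side.split)
  show "entries_in ?T C"
    unfolding C by (simp add: entries_in_two_term G chi)
  have cc0: "const_coeff A' = 0" "const_coeff \<rho> = 0" "const_coeff u = 0" "const_coeff v = 0"
    using ids(4) by (simp_all add: \<rho>_def u_def v_def)
  show "\<exists>b. isolated C b"
    unfolding C using isolated_positive[OF cc0] isolated_negative[OF cc0] by (cases s; simp; blast)
  have combine: "nullhomotopic ?T C p"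
    if p0: "nullhomotopic ?T (Gamma0 A' \<rho> F' u v) (of_nat (N + 1) * p)" 
      and p1: "nullhomotopic ?T (Gamma1 A' \<rho> F' u v) (of_nat (N + 1) * p)" for p
  proof -
    \<comment> \<open>The factor \<open>N + 1\<close> from the derivative is invertible over the
      rationals.\<close>
    have inv: "Const (1 / of_nat (N + 1)) * (of_nat (N + 1) * p) = p"
      by (simp add: of_nat_eq_Const mult.assoc[symmetric] Const_mult[symmetric] Const_add[symmetric] del: of_nat_Suc)
    have c: "Const (1 / of_nat (N + 1)) \<in> ?T" by (simp add: poly_carrier_def)
    have "nullhomotopic ?T (Gamma0 A' \<rho> F' u v) p" "nullhomotopic ?T (Gamma1 A' \<rho> F' u v) p"
      using poly_nullhomotopic_mult[OF p0 c] poly_nullhomotopic_mult[OF p1 c] unfolding inv by blast+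
    then show ?thesis
      unfolding C by (auto intro: nullhomotopic_two_term[OF mf_ok_Gamma(2) mf_ok_Gamma(1)]
          nullhomotopic_two_term[OF mf_ok_Gamma])
  qed
  note G0 = nullhomotopic_Gamma0[of _ A' \<rho> F' v u "{1..M}"] and G1 = nullhomotopic_Gamma1[of _ A' \<rho> F' u v "{1..M}"]
  show "nullhomotopic ?T C (Var k ^ N)"
  proof (rule combine)
    obtain A1 F1 where AF: "A1 \<in> ?T" "F1 \<in> ?T"
      "of_nat (N + 1) * Var k ^ N = A1 * \<rho> + A' + F1 * (u * v) + F' * (v - u)"
      using ids(5) by (auto simp: poly_carrier_def)
    \<comment> \<open>Regrouped along the entries of \<Gamma>0, which are \<open>A'\<close>,
      \<open>\<rho>\<close>, \<open>F' * v\<close> and \<open>u\<close>.\<close>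
    have "of_nat (N + 1) * Var k ^ N = A1 * \<rho> + A' + (F1 * v - F') * u + F' * v"
      unfolding AF(3) by (simp add: algebra_simps)
    then show "nullhomotopic ?T (Gamma0 A' \<rho> F' u v) (of_nat (N + 1) * Var k ^ N)"
      using AF mem by (simp only:) (intro poly_nullhomotopic_add poly_nullhomotopic_mult G0 poly_carrier_closed poly_carrier_diff; simp)
    \<comment> \<open>Regrouped along the entries of \<Gamma>1, which are \<open>A'\<close>,
      \<open>\<rho>\<close>, \<open>F'\<close> and \<open>u * v\<close>.\<close>
    have "of_nat (N + 1) * Var k ^ N = A1 * \<rho> + A' + F1 * (u * v) + (v - u) * F'"
      unfolding AF(3) by (simp add: algebra_simps)
    then show "nullhomotopic ?T (Gamma1 A' \<rho> F' u v) (of_nat (N + 1) * Var k ^ N)"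
      using AF mem by (simp only:) (intro poly_nullhomotopic_add poly_nullhomotopic_mult G1 poly_carrier_closed poly_carrier_diff; simp)
  qed
  show "nullhomotopic ?T C (Var l ^ N)"
  proof (rule combine)
    obtain A1 F1 where AF: "A1 \<in> ?T" "F1 \<in> ?T"
      "of_nat (N + 1) * Var l ^ N = A1 * \<rho> + A' + F1 * (u * v)"
      using ids(6) by (auto simp: poly_carrier_def)
    have "of_nat (N + 1) * Var l ^ N = A1 * \<rho> + A' + (F1 * v) * u"
      unfolding AF(3) by (simp add: algebra_simps)
    then show "nullhomotopic ?T (Gamma0 A' \<rho> F' u v) (of_nat (N + 1) * Var l ^ N)"
      using AF mem by (simp only:) (intro poly_nullhomotopic_add poly_nullhomotopic_mult G0 poly_carrier_closed poly_carrier_diff; simp)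
    show "nullhomotopic ?T (Gamma1 A' \<rho> F' u v) (of_nat (N + 1) * Var l ^ N)"
      using AF mem by (simp only:) (intro poly_nullhomotopic_add poly_nullhomotopic_mult G1 poly_carrier_closed poly_carrier_diff; simp)
  qed
qed

lemma circle_complex_properties:
  assumes N: "N \<ge> 1" and e: "e \<in> {1..M}"
  defines "C \<equiv> circle_complex N e"
  shows "mf_ok C 0" "entries_in (poly_carrier {1..M}) C" "nullhomotopic (poly_carrier {1..M}) C (Var e ^ N)"
    "\<exists>b. isolated C b"
proof -
  let ?T = "poly_carrier {1..M}"
  let ?f = "of_nat (N + 1) * Var e ^ N :: nat mpoly"
  have ok: "list_all2 mf_ok [koszul ?f 0] [?f * 0]" by (simp only: list.rel_intros mf_ok_koszul)
  show "mf_ok C 0"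
    unfolding C_def circle_complex_def using mf_ok_one_term[OF mf_ok_tensor[OF ok]] by simp
  have f: "?f \<in> ?T" using e unfolding poly_carrier_def of_nat_eq_Const
    by (simp only: mem_Collect_eq) (intro indets_closed indets_power; simp)
  show "entries_in ?T C"
    unfolding C_def circle_complex_def
    by (intro entries_in_one_term poly_entries_in_tensor)
      (simp only: list.set singleton_iff entries_in_koszul[OF f poly_carrier_closed(1)])
  have "nullhomotopic ?T (tensor [koszul ?f 0]) ?f"
    by (rule poly_nullhomotopic_tensor[OF ok, of "koszul ?f 0"]) (simp_all only: list.set insertI1 nullhomotopic_koszul)
  then have "nullhomotopic ?T C ?f"
    unfolding C_def circle_complex_def by (rule nullhomotopic_one_term)
  moreover have "Const (1 / of_nat (N + 1)) * ?f = Var e ^ N"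
    by (simp add: of_nat_eq_Const mult.assoc[symmetric] Const_mult[symmetric] Const_add[symmetric] del: of_nat_Suc)
  moreover have "Const (1 / of_nat (N + 1)) \<in> ?T" by (simp add: poly_carrier_def)
  ultimately show "nullhomotopic ?T C (Var e ^ N)" using poly_nullhomotopic_mult by metis
  \<comment> \<open>The only nonzero entry is a multiple of the \<open>N\<close>-th power of the
    variable, which vanishes at the origin because \<open>N \<ge> 1\<close>.\<close>
  have "isolated C (Inl [LeftCopy])"
    using N by (auto simp: isolated_def C_def circle_complex_def one_term_def koszul_def split: side.split)
  then show "\<exists>b. isolated C b" by blast
qed

section \<open>The complex of a closed braid\<close>

lemma edge_at_eq: "(x, y) \<in> arc_steps n w \<Longrightarrow> edge_at n w x = edge_at n w y"
proof -
  assume xy: "(x, y) \<in> arc_steps n w"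
  have "(x, y) \<in> same_edge n w" "(y, x) \<in> same_edge n w"
    unfolding same_edge_def using xy by (auto intro: r_into_rtrancl)
  then show ?thesis
    unfolding edge_at_def same_edge_def by (auto intro: rtrancl_trans)
qed

lemma edge_at_mem: "x \<in> points n w \<Longrightarrow> edge_at n w x \<in> edges n w"
  by (auto simp: edges_def edge_at_def quotient_def)

lemma edges_E: "E \<in> edges n w \<Longrightarrow> \<exists>x\<in>points n w. E = edge_at n w x"
  by (auto simp: edges_def edge_at_def quotient_def)

lemma edge_at_untouched:
  "p \<in> {1..n} \<Longrightarrow> t < length w \<Longrightarrow> \<not> touches w t p \<Longrightarrow> edge_at n w (p, t) = edge_at n w (p, t + 1)"
  by (rule edge_at_eq) (auto simp: arc_steps_def)

lemma edge_at_closure: "p \<in> {1..n} \<Longrightarrow> edge_at n w (p, length w) = edge_at n w (p, 0)"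
  by (rule edge_at_eq) (auto simp: arc_steps_def)

text \<open>Go down the strand from \<open>(p, t)\<close>, continuing through the closure from the
  bottom to the top, until a crossing is met: the edge leaves that crossing. If none is met, the
  strand closes up to a free circle.\<close>

lemma edge_source:
  assumes p: "p \<in> {1..n}" and t: "t \<le> length w"
  shows "(\<exists>t'<length w. touches w t' p \<and> edge_at n w (p, t) = edge_at n w (p, t' + 1)) \<or>
    (p \<in> set (free_circles n w) \<and> edge_at n w (p, t) = edge_at n w (p, 0))"
proof -
  have *: "(\<exists>t'<t. touches w t' p \<and> edge_at n w (p, t) = edge_at n w (p, t' + 1)) \<or>
      ((\<forall>t'<t. \<not> touches w t' p) \<and> edge_at n w (p, t) = edge_at n w (p, 0))" if "t \<le> length w" for t
    using that
  proof (induction t)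
    case (Suc t)
    show ?case
    proof (cases "touches w t p")
      case True
      then show ?thesis by (intro disjI1 exI[of _ t]) (simp add: Suc_eq_plus1)
    next
      case False
      then have "edge_at n w (p, Suc t) = edge_at n w (p, t)"
        using edge_at_untouched[OF p, of t w] Suc.prems by (simp add: Suc_eq_plus1)
      then show ?thesis using Suc False by (auto simp: less_Suc_eq)
    qed
  qed simp
  show ?thesis
  proof (cases "\<exists>t'<length w. touches w t' p")
    case True
    then obtain s where "s < length w" "touches w s p" "edge_at n w (p, 0) = edge_at n w (p, s + 1)"
      using *[of "length w"] edge_at_closure[OF p, of w] by auto
    then show ?thesis using *[OF t] t by (metis less_le_trans)
  next
    case False
    then have "p \<in> set (free_circles n w)" using p by (auto simp: free_circles_def)
    then show ?thesis using *[OF t] False t by (meson less_le_trans)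
  qed
qed

text \<open>Edges refine components. This ensures that the variables numbered by components occur
  among the variables of the edges.\<close>

lemma card_components_le: "card (components n w) \<le> card (edges n w)"
proof -
  have fin: "finite (points n w)" by (simp add: points_def)
  have "edges n w = edge_at n w ` points n w"
    by (auto simp: edges_def edge_at_def quotient_def)
  then have fe: "finite (edges n w)" using fin by simp
  have sub: "same_edge n w \<subseteq> same_component n w"
    unfolding same_edge_def same_component_def Let_def by (intro rtrancl_mono) auto
  have trans: "trans (same_component n w)"
    unfolding same_component_def Let_def by (rule trans_rtrancl)
  have refl: "(x, x) \<in> same_edge n w" for x by (simp add: same_edge_def)
  have "same_component n w `` {x} = same_component n w `` (same_edge n w `` {x})" for x
    using sub trans refl by (auto dest: transD)
  then have "components n w \<subseteq> (\<lambda>E. same_component n w `` E) ` edges n w"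
    by (auto simp: components_def edges_def quotient_def)
  then show ?thesis
    using fe by (meson card_image_le card_mono finite_imageI le_trans)
qed

text \<open>The potential of a crossing is the change of the power sum over all strands between the
  levels below and above it. The potentials therefore telescope, and the closure identifies the last
  power sum with the first.\<close>

lemma KR_complex_properties:
  fixes A F :: "nat \<Rightarrow> crossing_var mpoly"
  assumes braid: "is_braid n w" and \<nu>: "bij_betw \<nu> (edges n w) {1..card (edges n w)}" and N: "N \<ge> 1"
    and adm: "\<forall>t<length w. admissible_choice N (card (edges n w)) (A t) (F t)"
  defines "C \<equiv> KR_complex N n w \<nu> A F" and "T \<equiv> poly_carrier {1..card (edges n w)}"
  shows "mf_ok C 0" "entries_in T C" "\<And>e. e \<in> {1..card (edges n w)} \<Longrightarrow> nullhomotopic T C (Var e ^ N)"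
    "\<exists>b. isolated C b"
proof -
  let ?M = "card (edges n w)"
  define e where "e x = \<nu> (edge_at n w x)" for x
  define X where "X t = (let p = fst (w ! t) in crossing_complex (snd (w ! t)) (A t) (F t)
      (e (p, t + 1)) (e (p + 1, t + 1)) (e (p, t)) (e (p + 1, t)))" for t
  define Y where "Y p = circle_complex N (e (p, 0))" for p
  let ?Cs = "map X [0..<length w] @ map Y (free_circles n w)"
  have C: "C = tensor ?Cs"
    by (simp add: C_def KR_complex_def X_def[abs_def] Y_def[abs_def] e_def[abs_def])
  have e_mem: "e (p, t) \<in> {1..?M}" if "p \<in> {1..n}" "t \<le> length w" for p t
  proof -
    have "(p, t) \<in> points n w" using that by (auto simp: points_def)
    then show ?thesis unfolding e_def using \<nu> edge_at_mem by (metis bij_betwE)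
  qed
  have ends: "fst (w ! t) \<in> {1..n}" "fst (w ! t) + 1 \<in> {1..n}" if "t < length w" for t
  proof -
    have "(fst (w ! t), snd (w ! t)) \<in> set w" using that by simp
    then have "1 \<le> fst (w ! t) \<and> fst (w ! t) < n" using braid unfolding is_braid_def by blast
    then show "fst (w ! t) \<in> {1..n}" "fst (w ! t) + 1 \<in> {1..n}" by auto
  qed
  define W where "W t = (let p = fst (w ! t) in Var (e (p, t + 1)) ^ (N + 1) + Var (e (p + 1, t + 1)) ^ (N + 1)
      - Var (e (p, t)) ^ (N + 1) - Var (e (p + 1, t)) ^ (N + 1) :: nat mpoly)" for t
  have X: "mf_ok (X t) (W t)" "entries_in T (X t)"
    "nullhomotopic T (X t) (Var (e (fst (w ! t), t + 1)) ^ N)"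
    "nullhomotopic T (X t) (Var (e (fst (w ! t) + 1, t + 1)) ^ N)"
    "\<exists>b. isolated (X t) b" if t: "t < length w" for t
  proof -
    have a: "admissible_choice N ?M (A t) (F t)" using adm t by blast
    have t1: "t + 1 \<le> length w" "t \<le> length w" using t by auto
    note props = crossing_complex_properties[OF a N e_mem[OF ends(1)[OF t] t1(1)] e_mem[OF ends(2)[OF t] t1(1)]
        e_mem[OF ends(1)[OF t] t1(2)] e_mem[OF ends(2)[OF t] t1(2)], of "snd (w ! t)"]
    show "mf_ok (X t) (W t)" "entries_in T (X t)"
      "nullhomotopic T (X t) (Var (e (fst (w ! t), t + 1)) ^ N)"
      "nullhomotopic T (X t) (Var (e (fst (w ! t) + 1, t + 1)) ^ N)"
      "\<exists>b. isolated (X t) b"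
      unfolding X_def W_def Let_def T_def by (fact props)+
  qed
  have circles: "p \<in> {1..n}" if "p \<in> set (free_circles n w)" for p
    using that by (auto simp: free_circles_def)
  note Y = circle_complex_properties[OF N e_mem[OF circles le0], folded Y_def T_def]
  have ok: "list_all2 mf_ok ?Cs (map W [0..<length w] @ map (\<lambda>_. 0) (free_circles n w))"
    by (rule list_all2_appendI) (auto simp: list.rel_map intro!: list.rel_refl_strong X(1) Y(1))
  define \<Phi> where "\<Phi> t = (\<Sum>p\<in>{1..n}. Var (e (p, t)) ^ (N + 1) :: nat mpoly)" for t
  have W: "W t = \<Phi> (t + 1) - \<Phi> t" if t: "t < length w" for t
  proof -
    let ?i = "fst (w ! t)"
    have "\<Phi> (t + 1) - \<Phi> t = (\<Sum>p\<in>{1..n}. Var (e (p, t + 1)) ^ (N + 1) - Var (e (p, t)) ^ (N + 1))"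
      by (simp add: \<Phi>_def sum_subtractf)
    also have "\<dots> = (\<Sum>p\<in>{?i, ?i + 1}. Var (e (p, t + 1)) ^ (N + 1) - Var (e (p, t)) ^ (N + 1))"
    proof (rule sum.mono_neutral_right)
      show "{?i, ?i + 1} \<subseteq> {1..n}" using ends[OF t] by simp
      show "\<forall>p\<in>{1..n} - {?i, ?i + 1}. Var (e (p, t + 1)) ^ (N + 1) - Var (e (p, t)) ^ (N + 1) = (0 :: nat mpoly)"
        using edge_at_untouched[OF _ t] by (simp add: e_def touches_def)
    qed simp
    also have "\<dots> = W t" by (simp add: W_def Let_def algebra_simps)
    finally show ?thesis by simp
  qed
  have tele: "sum_list (map W [0..<k]) = \<Phi> k - \<Phi> 0" if "k \<le> length w" for k
    using that by (induction k) (simp_all add: W, simp add: Suc_eq_plus1)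
  have "\<Phi> (length w) = \<Phi> 0"
    unfolding \<Phi>_def e_def by (intro sum.cong refl) (simp add: edge_at_closure)
  moreover have "sum_list (map (\<lambda>_. 0 :: nat mpoly) xs) = 0" for xs :: "nat list" by (induction xs) auto
  ultimately have "sum_list (map W [0..<length w] @ map (\<lambda>_. 0) (free_circles n w)) = 0"
    using tele[of "length w"] by simp
  then show "mf_ok C 0" using mf_ok_tensor[OF ok] by (simp add: C)
  show "entries_in T C"
    unfolding C T_def by (rule poly_entries_in_tensor) (use X(2) Y(2) in \<open>auto simp: T_def\<close>)
  show "\<exists>b. isolated C b"
    unfolding C by (rule isolated_tensor) (use X(5) Y(4) in auto)
  fix k assume "k \<in> {1..?M}"
  then have "k \<in> \<nu> ` edges n w" using \<nu> by (simp add: bij_betw_def)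
  then obtain E where E: "E \<in> edges n w" "k = \<nu> E" by blast
  then obtain p t where pt: "(p, t) \<in> points n w" "k = e (p, t)" using edges_E by (fastforce simp: e_def)
  then have p: "p \<in> {1..n}" and t: "t \<le> length w" by (auto simp: points_def)
  have "\<exists>D\<in>set ?Cs. nullhomotopic T D (Var k ^ N)"
    using edge_source[OF p t]
  proof (elim disjE exE conjE)
    fix s assume s: "s < length w" "touches w s p" "edge_at n w (p, t) = edge_at n w (p, s + 1)"
    then have "k = e (p, s + 1)" "p = fst (w ! s) \<or> p = fst (w ! s) + 1" using pt by (auto simp: e_def touches_def)
    then have "nullhomotopic T (X s) (Var k ^ N)" using X(3,4)[OF s(1)] by auto
    moreover have "X s \<in> set ?Cs" using s(1) by simp
    ultimately show ?thesis by blast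
  next
    assume c: "p \<in> set (free_circles n w)" "edge_at n w (p, t) = edge_at n w (p, 0)"
    then have "nullhomotopic T (Y p) (Var k ^ N)" using Y(3)[OF c(1)] pt(2) by (simp add: e_def)
    moreover have "Y p \<in> set ?Cs" using c(1) by simp
    ultimately show ?thesis by blast
  qed
  then show "nullhomotopic T C (Var k ^ N)"
    unfolding C T_def using poly_nullhomotopic_tensor[OF ok] by blast
qed

section \<open>Nonvanishing of the double homology\<close>

definition coeff_vectors :: "'v set \<Rightarrow> 'b set \<Rightarrow> ('b \<Rightarrow> 'v mpoly) set" where
  "coeff_vectors V B = {x. (\<forall>b. indets (x b) \<subseteq> V) \<and> (\<forall>b. b \<notin> B \<longrightarrow> x b = 0)}"

lemma coeff_vectors_closed:
  "0 \<in> coeff_vectors V B" "x \<in> coeff_vectors V B \<Longrightarrow> y \<in> coeff_vectors V B \<Longrightarrow> x + y \<in> coeff_vectors V B"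
  "x \<in> coeff_vectors V B \<Longrightarrow> y \<in> coeff_vectors V B \<Longrightarrow> x - y \<in> coeff_vectors V B" "x \<in> coeff_vectors V B \<Longrightarrow> - x \<in> coeff_vectors V B"
  "indets p \<subseteq> V \<Longrightarrow> x \<in> coeff_vectors V B \<Longrightarrow> fscale p x \<in> coeff_vectors V B"
  by (simp_all add: coeff_vectors_def fun_apply fscale_def indets_closed)

lemma apply_matrix_mem:
  assumes "\<And>b b'. a b b' \<in> poly_carrier V" "x \<in> coeff_vectors V B"
  shows "apply_matrix B a x \<in> coeff_vectors V B"
proof -
  have "indets (\<Sum>b\<in>B. a b b' * x b) \<subseteq> V" for b'
    using assms by (intro indets_sum indets_closed) (auto simp: coeff_vectors_def poly_carrier_def)
  then show ?thesis by (simp add: coeff_vectors_def apply_matrix_def)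
qed

lemma apply_matrix_add: "apply_matrix B a (x + y) = apply_matrix B a x + apply_matrix B a y"
  by (simp add: apply_matrix_def fun_eq_iff fun_apply distrib_left sum.distrib)

lemma apply_matrix_fscale: "apply_matrix B a (fscale p x) = fscale p (apply_matrix B a x)"
  by (simp add: apply_matrix_def fun_eq_iff fscale_def sum_distrib_left ac_simps)

lemma apply_matrix_diff: "apply_matrix B a (x - y) = apply_matrix B a x - apply_matrix B a y"
  by (rule additive_diff[of "apply_matrix B a", OF apply_matrix_add])

lemma apply_matrix_0: "apply_matrix B a 0 = 0"
  by (rule additive_0[of "apply_matrix B a", OF apply_matrix_add])

lemma apply_matrix_comp:
  "apply_matrix B a (apply_matrix B b x) = apply_matrix B (mprod B b a) x"
proof
  fix z
  have "(\<Sum>y\<in>B. a y z * (\<Sum>w\<in>B. b w y * x w)) = (\<Sum>w\<in>B. (\<Sum>y\<in>B. b w y * a y z) * x w)"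
    unfolding sum_distrib_left sum_distrib_right
    by (subst sum.swap) (intro sum.cong refl, simp add: ac_simps)
  then show "apply_matrix B a (apply_matrix B b x) z = apply_matrix B (mprod B b a) x z"
    by (simp add: apply_matrix_def mprod_def)
qed

lemma apply_matrix_cong:
  "(\<And>b b'. b \<in> B \<Longrightarrow> b' \<in> B \<Longrightarrow> a b b' = a' b b') \<Longrightarrow> apply_matrix B a x = apply_matrix B a' x"
  by (auto simp: apply_matrix_def fun_eq_iff intro!: sum.cong)

lemma apply_matrix_scalar:
  assumes "finite B" "x \<in> coeff_vectors V B"
  shows "apply_matrix B (\<lambda>b b'. if b = b' then p else 0) x = fscale p x"
proof
  fix z
  have "(\<Sum>b\<in>B. (if b = z then p else 0) * x b) = (\<Sum>b\<in>B. if b = z then p * x b else 0)"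
    by (intro sum.cong refl) simp
  then show "apply_matrix B (\<lambda>b b'. if b = b' then p else 0) x z = fscale p x z"
    using assms by (simp add: apply_matrix_def fscale_def coeff_vectors_def)
qed

text \<open>The ideal generated by the variables in \<open>U\<close>, described through monomials so
  that membership is decided coefficient by coefficient.\<close>

definition var_ideal :: "'v set \<Rightarrow> 'v mpoly set" where
  "var_ideal U = {p. \<forall>u. lookup p u \<noteq> 0 \<longrightarrow> (\<exists>k\<in>U. lookup u k \<noteq> 0)}"

lemma var_ideal_closed:
  "0 \<in> var_ideal U" "p \<in> var_ideal U \<Longrightarrow> q \<in> var_ideal U \<Longrightarrow> p + q \<in> var_ideal U"
  "p \<in> var_ideal U \<Longrightarrow> q \<in> var_ideal U \<Longrightarrow> p - q \<in> var_ideal U"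
  by (auto simp: var_ideal_def lookup_add lookup_minus) (metis add.right_neutral diff_zero)+

lemma var_ideal_mult: "p \<in> var_ideal U \<Longrightarrow> q * p \<in> var_ideal U"
proof -
  assume p: "p \<in> var_ideal U"
  have "indets q \<subseteq> UNIV" by simp
  then show ?thesis
  proof (induction q rule: mpoly_induct)
    case (Var v q)
    show ?case unfolding mult.assoc var_ideal_def
    proof (intro CollectI allI impI)
      fix u assume "lookup (Var v * (q * p)) u \<noteq> 0"
      then have "lookup (q * p) (u - single v 1) \<noteq> 0"
        by (auto simp: lookup_Var_mult split: if_splits)
      then obtain k where "k \<in> U" "lookup (u - single v 1) k \<noteq> 0"
        using Var unfolding var_ideal_def by blast
      then show "\<exists>k\<in>U. lookup u k \<noteq> 0" by (intro bexI[of _ k]) (auto simp: lookup_minus)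
    qed
  qed (use p in \<open>auto simp: distrib_right var_ideal_closed, auto simp: var_ideal_def lookup_Const_mult\<close>)
qed

lemma var_ideal_sum: "(\<And>a. a \<in> A \<Longrightarrow> f a \<in> var_ideal U) \<Longrightarrow> sum f A \<in> var_ideal U"
  by (induction A rule: infinite_finite_induct) (auto simp: var_ideal_closed)

lemma var_ideal_mono: "U \<subseteq> U' \<Longrightarrow> p \<in> var_ideal U \<Longrightarrow> p \<in> var_ideal U'"
  unfolding var_ideal_def by blast

lemma var_ideal_Var: "k \<in> U \<Longrightarrow> Var k * p \<in> var_ideal U"
  by (auto simp: var_ideal_def lookup_Var_mult split: if_splits)

text \<open>Multiplication by the variable shifts monomials injectively and leaves their exponents
  at indices in \<open>U\<close> unchanged.\<close>

lemma var_ideal_regular: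
  assumes "Var k * p \<in> var_ideal U" "k \<notin> U"
  shows "p \<in> var_ideal U"
  unfolding var_ideal_def
proof (intro CollectI allI impI)
  fix u assume "lookup p u \<noteq> 0"
  then have "lookup (Var k * p) (single k 1 + u) \<noteq> 0"
    by (simp add: lookup_Var_mult_Suc)
  then obtain l where "l \<in> U" "lookup (single k 1 + u) l \<noteq> 0"
    using assms(1) unfolding var_ideal_def by blast
  then show "\<exists>l\<in>U. lookup u l \<noteq> 0"
    using assms(2) by (intro bexI[of _ l]) (auto simp: lookup_add lookup_single when_def split: if_splits)
qed

lemma var_ideal_insert:
  assumes "p \<in> var_ideal (insert k U)" "indets p \<subseteq> V"
  shows "\<exists>i q. p = i + Var k * q \<and> i \<in> var_ideal U \<and> indets i \<subseteq> V \<and> indets q \<subseteq> V"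
proof -
  have "keys p \<subseteq> {u. keys u \<subseteq> V \<and> (\<exists>l\<in>insert k U. lookup u l \<noteq> 0)}"
    using assms by (auto simp: var_ideal_def indets_def in_keys_iff)
  then show ?thesis
  proof (induction p rule: poly_mapping_induct_keys)
    case zero
    show ?case by (intro exI[of _ 0]) (simp add: var_ideal_closed)
  next
    case (single u)
    let ?c = "lookup p u"
    have ind: "indets (single u' c) \<subseteq> V" if "keys u' \<subseteq> V" for u' and c :: rat
      using that by (auto simp: indets_def)
    show ?case
    proof (cases "lookup u k = 0")
      case True
      then have "single u ?c \<in> var_ideal U"
        using single by (auto simp: var_ideal_def lookup_single when_def split: if_splits)
      then show ?thesis using ind[of u ?c] single
        by (intro exI[of _ "single u ?c"] exI[of _ 0]) auto
    next
      case False
      then obtain w where w: "u = single k 1 + w" by (rule monomial_split)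
      have "keys w \<subseteq> keys u"
        unfolding w by (auto simp: in_keys_iff lookup_add)
      then have "keys w \<subseteq> V" using single by auto
      moreover have "single u ?c = Var k * single w ?c"
        by (simp add: Var_def mult_single w)
      ultimately show ?thesis using ind[of w ?c]
        by (intro exI[of _ 0] exI[of _ "single w ?c"]) (simp add: var_ideal_closed)
    qed
  next
    case (add p q)
    then obtain i j i' j' where "p = i + Var k * j" "i \<in> var_ideal U" "indets i \<subseteq> V" "indets j \<subseteq> V"
      "q = i' + Var k * j'" "i' \<in> var_ideal U" "indets i' \<subseteq> V" "indets j' \<subseteq> V" by blast
    then show ?case
      by (intro exI[of _ "i + i'"] exI[of _ "j + j'"]) (simp add: algebra_simps var_ideal_closed indets_closed)
  qed
qed

lemma apply_matrix_var_ideal: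
  "(\<And>b. x b \<in> var_ideal U) \<Longrightarrow> apply_matrix B a x b \<in> var_ideal U"
  by (auto simp: apply_matrix_def intro!: var_ideal_sum var_ideal_mult var_ideal_closed)

text \<open>Exactness passes to the quotient by a nonzerodivisor. This is the long exact sequence of
  multiplication by the next variable, written out on elements.\<close>

lemma exact_mod_variables:
  fixes \<tau> :: "'b \<Rightarrow> 'b \<Rightarrow> nat mpoly"
  assumes \<tau>: "\<And>b b'. \<tau> b b' \<in> poly_carrier {1..M}"
    and sq: "\<And>x. apply_matrix B \<tau> (apply_matrix B \<tau> x) = 0"
    and exact: "\<And>x. x \<in> coeff_vectors {1..M} B \<Longrightarrow> apply_matrix B \<tau> x = 0 \<Longrightarrow> \<exists>y\<in>coeff_vectors {1..M} B. x = apply_matrix B \<tau> y"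
    and j: "j \<le> M" and x: "x \<in> coeff_vectors {1..M} B" "\<And>b. apply_matrix B \<tau> x b \<in> var_ideal {1..j}"
  shows "\<exists>y\<in>coeff_vectors {1..M} B. \<forall>b. (x - apply_matrix B \<tau> y) b \<in> var_ideal {1..j}"
  using j x
proof (induction j arbitrary: x)
  case 0
  have "p = 0" if "p \<in> var_ideal {1..0}" for p :: "nat mpoly"
    using that by (intro poly_mapping_eqI) (auto simp: var_ideal_def)
  then have "apply_matrix B \<tau> x = 0" using 0 by (auto simp: fun_eq_iff fun_apply)
  then obtain y where "y \<in> coeff_vectors {1..M} B" "x = apply_matrix B \<tau> y" using exact 0 by blast
  then show ?case by (intro bexI[of _ y]) (auto simp: var_ideal_closed fun_apply)
next
  case (Suc j)
  let ?t = "apply_matrix B \<tau>" and ?X = "Var (Suc j) :: nat mpoly"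
  have ins: "{1..Suc j} = insert (Suc j) {1..j}" by auto
  have X: "indets ?X \<subseteq> {1..M}" using Suc.prems(1) by auto
  have tx: "?t x \<in> coeff_vectors {1..M} B" by (rule apply_matrix_mem[OF \<tau> Suc.prems(2)])
  have "\<exists>i q. ?t x b = i + ?X * q \<and> i \<in> var_ideal {1..j} \<and> indets i \<subseteq> {1..M} \<and> indets q \<subseteq> {1..M}
      \<and> (b \<notin> B \<longrightarrow> i = 0 \<and> q = 0)" for b
  proof (cases "b \<in> B")
    case True
    then show ?thesis using var_ideal_insert[of "?t x b" "Suc j" "{1..j}" "{1..M}"] Suc.prems(3)[of b] tx
      unfolding ins coeff_vectors_def by blast
  next
    case False
    then show ?thesis using tx by (intro exI[of _ 0]) (simp add: coeff_vectors_def var_ideal_closed)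
  qed
  then obtain i q where iq: "\<And>b. ?t x b = i b + ?X * q b" "\<And>b. i b \<in> var_ideal {1..j}"
    "\<And>b. indets (i b) \<subseteq> {1..M}" "\<And>b. indets (q b) \<subseteq> {1..M}" "\<And>b. b \<notin> B \<Longrightarrow> i b = 0 \<and> q b = 0"
    by metis
  have mem: "i \<in> coeff_vectors {1..M} B" "q \<in> coeff_vectors {1..M} B" using iq by (auto simp: coeff_vectors_def)
  have tx_eq: "?t x = i + fscale ?X q" using iq(1) by (simp add: fun_eq_iff fun_apply fscale_def)
  \<comment> \<open>The square being zero puts \<open>?X * ?t q b\<close> into the smaller ideal,
    where the variable can be cancelled. So \<open>q\<close> is a cycle modulo the smaller ideal,
    and by induction a boundary \<open>?t z\<close> modulo it.\<close>
  have "0 = ?t i + fscale ?X (?t q)"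
    using sq[of x] unfolding tx_eq apply_matrix_add apply_matrix_fscale by simp
  then have "fscale ?X (?t q) = 0 - ?t i" by (simp add: eq_neg_iff_add_eq_0 add.commute)
  then have "fscale ?X (?t q) b = 0 - ?t i b" for b by (simp add: fun_apply)
  then have eq: "?X * ?t q b = 0 - ?t i b" for b unfolding fscale_def by simp
  have "?X * ?t q b \<in> var_ideal {1..j}" for b
    unfolding eq by (intro var_ideal_closed apply_matrix_var_ideal iq)
  then have "?t q b \<in> var_ideal {1..j}" for b
    by (rule var_ideal_regular) simp
  then obtain z where z: "z \<in> coeff_vectors {1..M} B" "\<forall>b. (q - ?t z) b \<in> var_ideal {1..j}"
    using Suc.IH[of q] Suc.prems(1) mem by auto
  \<comment> \<open>Subtracting a multiple of the variable does not change \<open>x\<close> modulo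
    the larger ideal, but makes it a cycle modulo the smaller one, so the induction hypothesis
    applies a second time.\<close>
  have "?t (x - fscale ?X z) = i + fscale ?X (q - ?t z)"
    by (simp add: apply_matrix_diff apply_matrix_fscale tx_eq fscale_simps)
  then have "?t (x - fscale ?X z) b \<in> var_ideal {1..j}" for b
    using z(2) iq(2) by (simp add: fun_apply fscale_def var_ideal_closed var_ideal_mult)
  then obtain y where y: "y \<in> coeff_vectors {1..M} B" "\<forall>b. (x - fscale ?X z - ?t y) b \<in> var_ideal {1..j}"
    using Suc.IH[of "x - fscale ?X z"] Suc.prems(1,2) coeff_vectors_closed(3,5) z(1) X by (metis Suc_leD)
  have "(x - ?t y) b \<in> var_ideal {1..Suc j}" for b
  proof -
    have eq: "(x - ?t y) b = (x - fscale ?X z - ?t y) b + ?X * z b"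
      by (simp add: fun_apply fscale_def)
    have "(x - fscale ?X z - ?t y) b \<in> var_ideal {1..Suc j}"
      using y(2) var_ideal_mono[of "{1..j}" "{1..Suc j}"] by auto
    then show ?thesis unfolding eq by (rule var_ideal_closed(2)[OF _ var_ideal_Var]) simp
  qed
  then show ?case using y(1) by blast
qed

section \<open>The total differential of a complex of matrix factorizations\<close>

locale total_complex =
  fixes C :: "('b, nat mpoly) mf_complex" and M :: nat
  assumes ok: "mf_ok C 0" and entries: "entries_in (poly_carrier {1..M}) C"
begin

abbreviation "B \<equiv> basis C"
abbreviation "d \<equiv> apply_matrix B (dmat C)"
abbreviation "v \<equiv> apply_matrix B (vmat C)"
abbreviation "E \<equiv> coeff_vectors {1..M} B"

lemmas okD = mf_okD[OF ok]

lemma d_mem: "x \<in> E \<Longrightarrow> d x \<in> E" and v_mem: "x \<in> E \<Longrightarrow> v x \<in> E"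
  using entries by (auto simp: entries_in_def intro!: apply_matrix_mem)

lemma apply_zero_matrix: "(\<And>b b'. b \<in> B \<Longrightarrow> b' \<in> B \<Longrightarrow> a b b' = 0) \<Longrightarrow> apply_matrix B a x = 0"
  by (auto simp: apply_matrix_def fun_eq_iff fun_apply)

lemma d_d: "d (d x) = 0" and v_v: "v (v x) = 0" and d_v: "d (v x) = v (d x)"
proof -
  show "d (d x) = 0" "v (v x) = 0"
    unfolding apply_matrix_comp using okD(2,3) by (auto intro!: apply_zero_matrix)
  show "d (v x) = v (d x)"
    unfolding apply_matrix_comp using okD(4) by (intro apply_matrix_cong) simp
qed

lemma homotopy:
  assumes "nullhomotopic (poly_carrier {1..M}) C p" "x \<in> E" "d x = 0"
  shows "\<exists>z\<in>E. fscale p x = d z"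
proof -
  obtain h where "homotopy_on (poly_carrier {1..M}) C p h" using assms(1) unfolding nullhomotopic_def by blast
  note h = homotopy_onD[OF this]
  have "apply_matrix B (\<lambda>b b'. mprod B h (dmat C) b b' + mprod B (dmat C) h b b') x =
      apply_matrix B (\<lambda>b b'. if b = b' then p else 0) x"
    using h(2) by (intro apply_matrix_cong) auto
  moreover have "apply_matrix B (\<lambda>b b'. mprod B h (dmat C) b b' + mprod B (dmat C) h b b') x =
      d (apply_matrix B h x) + apply_matrix B h (d x)"
    unfolding apply_matrix_comp by (simp add: apply_matrix_def fun_eq_iff fun_apply distrib_right sum.distrib)
  ultimately have "fscale p x = d (apply_matrix B h x)"
    using apply_matrix_scalar[OF okD(1) assms(2)] assms(3) by (simp add: apply_matrix_0)
  moreover have "apply_matrix B h x \<in> E" using h(1) assms(2) by (intro apply_matrix_mem) auto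
  ultimately show ?thesis by blast
qed

text \<open>The sign makes \<open>d\<close> and \<open>v\<close> anticommute.\<close>

definition \<tau> :: "'b \<Rightarrow> 'b \<Rightarrow> nat mpoly" where
  "\<tau> b b' = psign (hdeg C b') * dmat C b b' + vmat C b b'"

abbreviation "tot \<equiv> apply_matrix B \<tau>"

lemma tau_mem: "\<tau> b b' \<in> poly_carrier {1..M}"
  using entries psign_mem[OF subring_poly_carrier] unfolding entries_in_def \<tau>_def
  by (intro poly_carrier_closed) auto

lemma tot_tot: "tot (tot x) = 0"
  unfolding apply_matrix_comp
proof (rule apply_zero_matrix)
  fix x z assume xz: "x \<in> B" "z \<in> B"
  have "\<tau> x y * \<tau> y z = psign (hdeg C x) * psign (hdeg C z) * (dmat C x y * dmat C y z) +
      psign (hdeg C x) * (dmat C x y * vmat C y z - vmat C x y * dmat C y z) + vmat C x y * vmat C y z"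
    if y: "y \<in> B" for y
  proof -
    have 1: "psign (hdeg C y) * dmat C x y = psign (hdeg C x) * dmat C x y"
      using okD(6)[OF xz(1) y] by (cases "dmat C x y = 0") auto
    have 2: "psign (hdeg C z) * (vmat C x y * dmat C y z) = - (psign (hdeg C x) * (vmat C x y * dmat C y z))"
    proof (cases "vmat C x y = 0 \<or> dmat C y z = 0")
      case False
      then have "hdeg C z = hdeg C x + 1" using okD(6)[OF y xz(2)] okD(8)[OF xz(1) y] by simp
      then show ?thesis by (simp add: psign_def)
    qed auto
    show ?thesis unfolding \<tau>_def 1 using 2 by (simp add: algebra_simps)
  qed
  then have "mprod B \<tau> \<tau> x z = psign (hdeg C x) * psign (hdeg C z) * mprod B (dmat C) (dmat C) x z +
      psign (hdeg C x) * (mprod B (dmat C) (vmat C) x z - mprod B (vmat C) (dmat C) x z) + mprod B (vmat C) (vmat C) x z"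
    by (simp add: mprod_def sum.distrib sum_subtractf sum_distrib_left right_diff_distrib)
  then show "mprod B \<tau> \<tau> x z = 0" using okD(2-4)[OF xz] by simp
qed

lemma tot_apply: "tot x b = psign (hdeg C b) * d x b + v x b"
  by (simp add: apply_matrix_def \<tau>_def distrib_right sum.distrib sum_distrib_left mult.assoc)

definition pr :: "int \<Rightarrow> ('b \<Rightarrow> nat mpoly) \<Rightarrow> 'b \<Rightarrow> nat mpoly" where
  "pr h x = (\<lambda>b. if hdeg C b = h then x b else 0)"

lemma pr_mem: "x \<in> E \<Longrightarrow> pr h x \<in> E"
  by (auto simp: coeff_vectors_def pr_def)

lemma pr_add: "pr h (x + y) = pr h x + pr h y"
  by (auto simp: pr_def fun_eq_iff fun_apply)

lemma d_pr: "d (pr h x) = pr h (d x)"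
proof
  fix b'
  have "(\<Sum>b\<in>B. dmat C b b' * pr h x b) = (if hdeg C b' = h then \<Sum>b\<in>B. dmat C b b' * x b else 0)" if "b' \<in> B"
    using okD(6)[OF _ that] by (auto simp: pr_def intro!: sum.cong sum.neutral) (metis mult_zero_left)+
  then show "d (pr h x) b' = pr h (d x) b'" by (auto simp: apply_matrix_def pr_def)
qed

lemma v_pr: "v (pr h x) = pr (h + 1) (v x)"
proof
  fix b'
  have "(\<Sum>b\<in>B. vmat C b b' * pr h x b) = (if hdeg C b' = h + 1 then \<Sum>b\<in>B. vmat C b b' * x b else 0)" if "b' \<in> B"
    using okD(8)[OF _ that] by (auto simp: pr_def intro!: sum.cong sum.neutral) (metis add_right_cancel mult_zero_left)+
  then show "v (pr h x) b' = pr (h + 1) (v x) b'" by (auto simp: apply_matrix_def pr_def)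
qed

text \<open>The degreewise comparison of a bounded double complex with its iterated homology: the
  lowest component of a total cycle represents a class of the double homology, and once that class
  vanishes, a total boundary removes the component.\<close>

lemma tot_exact:
  assumes acyclic: "\<And>x. x \<in> E \<Longrightarrow> d x = 0 \<Longrightarrow> \<exists>y\<in>E. v x = d y \<Longrightarrow> \<exists>y\<in>E. \<exists>z\<in>E. d y = 0 \<and> x = v y + d z"
    and x: "x \<in> E" "tot x = 0"
  shows "\<exists>y\<in>E. x = tot y"
proof -
  define top where "top = Max (insert 0 (hdeg C ` B))"
  have top: "hdeg C b \<le> top" if "b \<in> B" for b
    unfolding top_def using that okD(1) by (intro Max_ge) auto
  \<comment> \<open>Induction on the length of the range of homological degrees, counted down from
    \<open>top\<close>, in which the cycle may live.\<close>
  have main: "\<exists>y\<in>E. x = tot y" if "x \<in> E" "tot x = 0" "\<And>b. x b \<noteq> 0 \<Longrightarrow> hdeg C b > top - int n" for n x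
    using that
  proof (induction n arbitrary: x)
    case 0
    have "x b = 0" for b
    proof (rule ccontr)
      assume "x b \<noteq> 0"
      moreover from this have "b \<in> B" using 0(1) by (auto simp: coeff_vectors_def)
      ultimately show False using 0(3)[of b] top[of b] by simp
    qed
    then have "x = tot 0" by (simp add: apply_matrix_0 fun_eq_iff fun_apply)
    then show ?case using coeff_vectors_closed(1) by blast
  next
    case (Suc n)
    define h where "h = top - int n"
    have supp: "hdeg C b \<ge> h" if "x b \<noteq> 0" for b using Suc.prems(3)[OF that] by (simp add: h_def)
    have tot0: "psign (hdeg C b) * d x b + v x b = 0" for b
      using Suc.prems(2) tot_apply[of x b] by (simp add: fun_apply)
    have vx: "v x b = 0" if "hdeg C b = h" for b
    proof (cases "b \<in> B")
      case True
      have "vmat C b' b * x b' = 0" if "b' \<in> B" for b'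
        using okD(8)[OF that True] supp[of b'] \<open>hdeg C b = h\<close> by fastforce
      then have "(\<Sum>b'\<in>B. vmat C b' b * x b') = 0" by (rule sum.neutral[OF ballI])
      then show ?thesis by (simp add: apply_matrix_def)
    qed (simp add: apply_matrix_def)
    have psign_cancel: "psign k * (a :: nat mpoly) = 0 \<Longrightarrow> a = 0" for k a
      by (simp add: psign_def split: if_splits)
    have "d x b = 0" if "hdeg C b = h" for b
      by (rule psign_cancel[of "hdeg C b"]) (use tot0[of b] vx[OF that] in simp)
    then have dx: "d (pr h x) = 0" unfolding d_pr by (auto simp: pr_def fun_eq_iff fun_apply)
    \<comment> \<open>This is the cycle equation in degree \<open>h + 1\<close>, solved for
      \<open>v\<close>; the factor comes from the sign in \<open>\<tau>\<close>.\<close>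
    have "v (pr h x) b = d (fscale (- psign (h + 1)) (pr (h + 1) x)) b" for b
      using tot0[of b] unfolding v_pr apply_matrix_fscale d_pr
      by (auto simp: pr_def fscale_def eq_neg_iff_add_eq_0 add.commute)
    then have "v (pr h x) = d (fscale (- psign (h + 1)) (pr (h + 1) x))" by auto
    moreover have psign_in: "indets (psign k :: nat mpoly) \<subseteq> {1..M}" for k by (simp add: psign_def)
    then have "fscale (- psign (h + 1)) (pr (h + 1) x) \<in> E"
      using Suc.prems(1) by (intro coeff_vectors_closed pr_mem) simp_all
    ultimately obtain y z where yz: "y \<in> E" "z \<in> E" "d y = 0" "pr h x = v y + d z"
      using acyclic[OF pr_mem[OF Suc.prems(1)] dx] by blast
    \<comment> \<open>The witnesses may be inhomogeneous; only these components contribute to degree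
      \<open>h\<close>.\<close>
    define y' where "y' = pr (h - 1) y"
    define z' where "z' = pr h z"
    have y': "y' \<in> E" "d y' = 0" using yz pr_mem by (simp_all add: y'_def d_pr) (simp add: pr_def fun_eq_iff fun_apply)
    have z': "z' \<in> E" using yz pr_mem by (simp add: z'_def)
    have "pr h (pr h x) = v y' + d z'"
      unfolding yz(4) pr_add y'_def z'_def v_pr d_pr by simp
    moreover have "pr h (pr h x) = pr h x" by (simp add: pr_def fun_eq_iff)
    ultimately have xh: "pr h x = v y' + d z'" by simp
    \<comment> \<open>\<open>tot\<close> multiplies \<open>d z'\<close> by \<open>psign h\<close>,
      and the scaling cancels this. What \<open>tot w\<close> has besides \<open>pr h x\<close> is a
      multiple of \<open>v z'\<close>, in degree \<open>h + 1\<close>.\<close>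
    define w where "w = y' + fscale (psign h) z'"
    have w: "w \<in> E" unfolding w_def using y' z' psign_in by (intro coeff_vectors_closed)
    have dz': "psign (hdeg C b) * d z' b = psign h * d z' b" for b
      unfolding z'_def d_pr by (simp add: pr_def)
    have tot_w: "tot w b = pr h x b + psign h * v z' b" for b
    proof -
      have "tot w b = psign (hdeg C b) * (psign h * d z' b) + v y' b + psign h * v z' b"
        by (simp add: tot_apply w_def apply_matrix_add apply_matrix_fscale y' fun_apply distrib_left)
          (simp add: fscale_def tot_apply distrib_left mult.left_commute)
      also have "psign (hdeg C b) * (psign h * d z' b) = psign h * (psign (hdeg C b) * d z' b)" by (simp add: ac_simps)
      also have "\<dots> = d z' b" unfolding dz' by (simp add: mult.assoc[symmetric] psign_mult_self)
      finally show ?thesis by (simp add: xh fun_apply)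
    qed
    have "hdeg C b > top - int n" if "(x - tot w) b \<noteq> 0" for b
    proof (rule ccontr)
      assume "\<not> ?thesis"
      then have "hdeg C b \<le> h" by (simp add: h_def)
      moreover have "v z' b = 0" if "hdeg C b \<noteq> h + 1" unfolding z'_def v_pr using that by (simp add: pr_def)
      ultimately have eq: "(x - tot w) b = x b - pr h x b" by (simp add: fun_apply tot_w)
      have "hdeg C b \<noteq> h" using that unfolding eq by (auto simp: pr_def)
      moreover from this have "x b \<noteq> 0" using that unfolding eq by (simp add: pr_def)
      ultimately show False using supp[of b] \<open>hdeg C b \<le> h\<close> by simp
    qed
    moreover have "tot (x - tot w) = 0" by (simp add: apply_matrix_diff tot_tot Suc.prems(2))
    moreover have "tot w \<in> E" using w tau_mem by (intro apply_matrix_mem)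
    then have "x - tot w \<in> E" using Suc.prems(1) coeff_vectors_closed(3) by blast
    ultimately obtain u where "u \<in> E" "x - tot w = tot u" using Suc.IH[of "x - tot w"] by blast
    then have "u + w \<in> E" "x = tot (u + w)" using w coeff_vectors_closed(2) by (auto simp: apply_matrix_add algebra_simps)
    then show ?case by blast
  qed
  define bot where "bot = Min (insert 0 (hdeg C ` B))"
  \<comment> \<open>The bound equals \<open>bot - 1\<close>; the extra 1 makes the inequality
    strict.\<close>
  have "hdeg C b > top - int (nat (top - bot + 1))" if "x b \<noteq> 0" for b
  proof -
    have "b \<in> B" using that x(1) by (auto simp: coeff_vectors_def)
    then have "bot \<le> hdeg C b" unfolding bot_def using okD(1) by (intro Min_le) auto
    moreover have "hdeg C b \<le> top" using top \<open>b \<in> B\<close> by blast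
    ultimately show ?thesis by simp
  qed
  then show ?thesis using main x by blast
qed

theorem not_acyclic:
  assumes iso: "isolated C b0"
  shows "\<exists>x\<in>E. d x = 0 \<and> (\<exists>y\<in>E. v x = d y) \<and> \<not> (\<exists>y\<in>E. \<exists>z\<in>E. d y = 0 \<and> x = v y + d z)"
proof (rule ccontr)
  assume "\<not> ?thesis"
  then have exact: "\<exists>y\<in>E. x = tot y" if "x \<in> E" "tot x = 0" for x
    using tot_exact that by blast
  have b0: "b0 \<in> B" and cc0: "const_coeff (\<tau> b0 b) = 0" "const_coeff (\<tau> b b0) = 0" if "b \<in> B" for b
    using iso that by (auto simp: isolated_def \<tau>_def)
  have b0: "b0 \<in> B" using iso by (simp add: isolated_def)
  define x where "x b = (if b = b0 then 1 else 0 :: nat mpoly)" for b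
  have x: "x \<in> E" using b0 by (auto simp: coeff_vectors_def x_def)
  have "tot x b \<in> var_ideal {1..M}" for b
  proof (cases "b \<in> B")
    case True
    have "tot x b = \<tau> b0 b"
      using True b0 okD(1) by (simp add: apply_matrix_def x_def if_distrib[of "\<lambda>c. _ * c"] cong: if_cong)
    moreover have "\<tau> b0 b \<in> var_ideal {1..M}"
      unfolding var_ideal_def
    proof (intro CollectI allI impI)
      fix u assume u: "lookup (\<tau> b0 b) u \<noteq> 0"
      then have "u \<noteq> 0" using cc0(1)[OF True] by (auto simp: const_coeff_def)
      then obtain k where "lookup u k \<noteq> 0" by (rule poly_mapping_nonzeroE)
      moreover have "keys u \<subseteq> {1..M}"
        using u tau_mem[of b0 b] unfolding poly_carrier_def indets_subset_iff by blast
      ultimately show "\<exists>k\<in>{1..M}. lookup u k \<noteq> 0"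
        by (metis in_keys_iff subsetD)
    qed
    ultimately show ?thesis by simp
  qed (simp add: apply_matrix_def var_ideal_closed)
  then obtain y where y: "\<forall>b. (x - tot y) b \<in> var_ideal {1..M}"
    using exact_mod_variables[OF tau_mem tot_tot exact order.refl x] by blast
  \<comment> \<open>Membership in the ideal forces constant term 0. But \<open>x b0 = 1\<close>, and
    the entries of \<open>\<tau>\<close> into \<open>b0\<close> have no constant terms, so the
    constant term is 1.\<close>
  have "const_coeff ((x - tot y) b0) = 0"
  proof (rule ccontr)
    assume "const_coeff ((x - tot y) b0) \<noteq> 0"
    then have "\<exists>k\<in>{1..M}. lookup (0 :: nat \<Rightarrow>\<^sub>0 nat) k \<noteq> 0"
      using y unfolding const_coeff_def var_ideal_def by blast
    then show False by simp
  qed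
  moreover have "const_coeff (tot y b0) = 0"
    using b0 cc0(2) by (simp add: apply_matrix_def const_coeff_sum)
  ultimately show False by (simp add: fun_apply x_def)
qed

end

section \<open>Homology modules\<close>

lemma poly_ring_mono: "V' \<subseteq> V \<Longrightarrow> carrier (poly_ring V') \<subseteq> carrier (poly_ring V)"
  by (auto simp: poly_ring_def)

lemma module_poly_ring_subset:
  assumes "Module.module (poly_ring V) M" "V' \<subseteq> V"
  shows "Module.module (poly_ring V') M"
proof -
  interpret M: Module.module "poly_ring V" M by fact
  have sub: "p \<in> carrier (poly_ring V)" if "p \<in> carrier (poly_ring V')" for p
    using that poly_ring_mono[OF assms(2)] by blast
  have ops: "a \<oplus>\<^bsub>poly_ring V'\<^esub> b = a \<oplus>\<^bsub>poly_ring V\<^esub> b" "a \<otimes>\<^bsub>poly_ring V'\<^esub> b = a \<otimes>\<^bsub>poly_ring V\<^esub> b"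
    "\<one>\<^bsub>poly_ring V'\<^esub> = \<one>\<^bsub>poly_ring V\<^esub>" for a b
    by (simp_all add: poly_ring_def)
  show ?thesis
    by (rule moduleI[OF cring_poly_ring])
      (use M.abelian_group_axioms in \<open>auto simp: ops sub M.smult_l_distr M.smult_r_distr M.smult_assoc1\<close>)
qed

locale differential_module = Module.module R M
  for R :: "('r, 'c) ring_scheme" and M :: "('r, 'm) module" +
  fixes f :: "'m \<Rightarrow> 'm"
  assumes f_linear: "f \<in> linear_maps R M M"
    and f_f: "x \<in> carrier M \<Longrightarrow> f (f x) = \<zero>\<^bsub>M\<^esub>"
begin

definition cls :: "'m \<Rightarrow> 'm set" where
  "cls x = (f ` carrier M) +>\<^bsub>M\<^esub> x"

lemmas f_mem = linear_maps_D(1)[OF f_linear]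
lemmas f_add = linear_maps_D(2)[OF f_linear]
lemmas f_smult = linear_maps_D(3)[OF f_linear]
lemmas f_zero = linear_maps_zero[OF f_linear module_axioms module_axioms]

lemma f_inv: "x \<in> carrier M \<Longrightarrow> f (\<ominus>\<^bsub>M\<^esub> x) = \<ominus>\<^bsub>M\<^esub> f x"
proof -
  assume x: "x \<in> carrier M"
  have "f (\<ominus>\<^bsub>M\<^esub> x) \<oplus>\<^bsub>M\<^esub> f x = \<zero>\<^bsub>M\<^esub>"
    using f_add[of "\<ominus>\<^bsub>M\<^esub> x" x, symmetric] x f_zero by (simp add: M.l_neg)
  then show ?thesis using M.minus_equality[of "f (\<ominus>\<^bsub>M\<^esub> x)" "f x"] x f_mem by simp
qed

lemma cls_iff: "y \<in> cls x \<longleftrightarrow> (\<exists>z\<in>carrier M. y = f z \<oplus>\<^bsub>M\<^esub> x)"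
  by (auto simp: cls_def a_r_coset_def')

lemma cls_self: "x \<in> carrier M \<Longrightarrow> x \<in> cls x"
  unfolding cls_iff by (intro bexI[of _ "\<zero>\<^bsub>M\<^esub>"]) (simp_all add: f_zero)

lemma cls_subset: "y \<in> carrier M \<Longrightarrow> y \<in> cls x \<Longrightarrow> x \<in> carrier M \<Longrightarrow> cls x \<subseteq> cls y"
proof
  fix w assume x: "x \<in> carrier M" and "y \<in> cls x" "w \<in> cls x"
  then obtain z z' where z: "z \<in> carrier M" "y = f z \<oplus>\<^bsub>M\<^esub> x" "z' \<in> carrier M" "w = f z' \<oplus>\<^bsub>M\<^esub> x"
    unfolding cls_iff by blast
  have "w = f (z' \<ominus>\<^bsub>M\<^esub> z) \<oplus>\<^bsub>M\<^esub> y"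
    using z x f_mem by (simp add: M.minus_eq f_add f_inv M.a_assoc M.r_neg2 M.r_neg1)
  then show "w \<in> cls y" unfolding cls_iff using z(1,3) by (intro bexI[of _ "z' \<ominus>\<^bsub>M\<^esub> z"]) auto
qed

lemma cls_mem_carrier: "x \<in> carrier M \<Longrightarrow> y \<in> cls x \<Longrightarrow> y \<in> carrier M"
  unfolding cls_iff using f_mem by auto

lemma cls_eq:
  assumes "x \<in> carrier M" "y \<in> cls x"
  shows "cls y = cls x"
proof
  have y: "y \<in> carrier M" by (rule cls_mem_carrier[OF assms])
  show sub: "cls x \<subseteq> cls y" by (rule cls_subset[OF y assms(2,1)])
  then have "x \<in> cls y" using cls_self[OF assms(1)] by (rule subsetD)
  then show "cls y \<subseteq> cls x" by (rule cls_subset[OF assms(1) _ y])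
qed

lemma cls_eq_iff:
  assumes "x \<in> carrier M" "y \<in> carrier M"
  shows "cls y = cls x \<longleftrightarrow> (\<exists>z\<in>carrier M. y = f z \<oplus>\<^bsub>M\<^esub> x)"
  unfolding cls_iff[symmetric] using cls_eq[OF assms(1)] cls_self[OF assms(2)] by metis

lemma cls_zero: "cls \<zero>\<^bsub>M\<^esub> = f ` carrier M"
proof (rule Set.set_eqI)
  fix y
  have "f z \<oplus>\<^bsub>M\<^esub> \<zero>\<^bsub>M\<^esub> = f z" if "z \<in> carrier M" for z using f_mem[OF that] by simp
  then show "y \<in> cls \<zero>\<^bsub>M\<^esub> \<longleftrightarrow> y \<in> f ` carrier M"
    unfolding cls_iff image_iff by (intro bex_cong) simp_all
qed

lemma cls_zero_iff: "x \<in> carrier M \<Longrightarrow> cls x = cls \<zero>\<^bsub>M\<^esub> \<longleftrightarrow> x \<in> f ` carrier M"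
  using cls_eq[of "\<zero>\<^bsub>M\<^esub>" x] cls_self[of x] unfolding cls_zero[symmetric] by auto

lemma cls_add: "x \<in> carrier M \<Longrightarrow> y \<in> carrier M \<Longrightarrow> cls x <+>\<^bsub>M\<^esub> cls y = cls (x \<oplus>\<^bsub>M\<^esub> y)"
proof
  assume xy: "x \<in> carrier M" "y \<in> carrier M"
  show "cls x <+>\<^bsub>M\<^esub> cls y \<subseteq> cls (x \<oplus>\<^bsub>M\<^esub> y)"
  proof
    fix w assume "w \<in> cls x <+>\<^bsub>M\<^esub> cls y"
    then obtain a b where "a \<in> cls x" "b \<in> cls y" "w = a \<oplus>\<^bsub>M\<^esub> b" by (auto simp: set_add_def')
    then obtain z z' where z: "z \<in> carrier M" "z' \<in> carrier M" "w = f z \<oplus>\<^bsub>M\<^esub> x \<oplus>\<^bsub>M\<^esub> (f z' \<oplus>\<^bsub>M\<^esub> y)"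
      unfolding cls_iff by blast
    then have "w = f (z \<oplus>\<^bsub>M\<^esub> z') \<oplus>\<^bsub>M\<^esub> (x \<oplus>\<^bsub>M\<^esub> y)"
      using xy f_mem by (simp add: f_add M.a_ac)
    then show "w \<in> cls (x \<oplus>\<^bsub>M\<^esub> y)" unfolding cls_iff using z by blast
  qed
  show "cls (x \<oplus>\<^bsub>M\<^esub> y) \<subseteq> cls x <+>\<^bsub>M\<^esub> cls y"
  proof
    fix w assume "w \<in> cls (x \<oplus>\<^bsub>M\<^esub> y)"
    then obtain z where z: "z \<in> carrier M" "w = f z \<oplus>\<^bsub>M\<^esub> (x \<oplus>\<^bsub>M\<^esub> y)" unfolding cls_iff by blast
    then have "w = (f z \<oplus>\<^bsub>M\<^esub> x) \<oplus>\<^bsub>M\<^esub> y" using xy f_mem by (simp add: M.a_assoc)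
    moreover have "f z \<oplus>\<^bsub>M\<^esub> x \<in> cls x" unfolding cls_iff using z(1) by blast
    ultimately show "w \<in> cls x <+>\<^bsub>M\<^esub> cls y" using cls_self[OF xy(2)] by (auto simp: set_add_def')
  qed
qed

text \<open>\<open>homology\<close> multiplies a coset by forming a union over all its members.
  Linearity of \<open>f\<close> makes the united cosets equal, so the result is a single
  coset.\<close>

lemma cls_smult: "a \<in> carrier R \<Longrightarrow> x \<in> carrier M \<Longrightarrow> (\<Union>y\<in>cls x. cls (a \<odot>\<^bsub>M\<^esub> y)) = cls (a \<odot>\<^bsub>M\<^esub> x)"
proof -
  assume ax: "a \<in> carrier R" "x \<in> carrier M"
  have "cls (a \<odot>\<^bsub>M\<^esub> y) = cls (a \<odot>\<^bsub>M\<^esub> x)" if y: "y \<in> cls x" for y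
  proof -
    obtain z where z: "z \<in> carrier M" "y = f z \<oplus>\<^bsub>M\<^esub> x" using y unfolding cls_iff by blast
    then have "a \<odot>\<^bsub>M\<^esub> y = f (a \<odot>\<^bsub>M\<^esub> z) \<oplus>\<^bsub>M\<^esub> a \<odot>\<^bsub>M\<^esub> x"
      using ax f_mem by (simp add: smult_r_distr f_smult)
    then have "a \<odot>\<^bsub>M\<^esub> y \<in> cls (a \<odot>\<^bsub>M\<^esub> x)" unfolding cls_iff using z ax by auto
    then show ?thesis using ax by (intro cls_eq) simp
  qed
  then have "(\<Union>y\<in>cls x. cls (a \<odot>\<^bsub>M\<^esub> y)) = (\<Union>y\<in>cls x. cls (a \<odot>\<^bsub>M\<^esub> x))"
    by (rule SUP_cong[OF refl])
  then show ?thesis using cls_self[OF ax(2)] by auto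
qed

definition cycles :: "'m set" where "cycles = {x \<in> carrier M. f x = \<zero>\<^bsub>M\<^esub>}"

lemma cycles_closed:
  "\<zero>\<^bsub>M\<^esub> \<in> cycles" "x \<in> cycles \<Longrightarrow> y \<in> cycles \<Longrightarrow> x \<oplus>\<^bsub>M\<^esub> y \<in> cycles" "x \<in> cycles \<Longrightarrow> \<ominus>\<^bsub>M\<^esub> x \<in> cycles"
  "a \<in> carrier R \<Longrightarrow> x \<in> cycles \<Longrightarrow> a \<odot>\<^bsub>M\<^esub> x \<in> cycles"
  "x \<in> cycles \<Longrightarrow> x \<in> carrier M"
  by (auto simp: cycles_def f_zero f_add f_inv f_smult)

lemma homology_simps:
  "carrier (homology M f) = cls ` cycles"
  "\<zero>\<^bsub>homology M f\<^esub> = cls \<zero>\<^bsub>M\<^esub>"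
  "x \<in> cycles \<Longrightarrow> y \<in> cycles \<Longrightarrow> cls x \<oplus>\<^bsub>homology M f\<^esub> cls y = cls (x \<oplus>\<^bsub>M\<^esub> y)"
  "a \<in> carrier R \<Longrightarrow> x \<in> cycles \<Longrightarrow> a \<odot>\<^bsub>homology M f\<^esub> cls x = cls (a \<odot>\<^bsub>M\<^esub> x)"
proof -
  show "carrier (homology M f) = cls ` cycles"
    by (simp add: homology_def cls_def[abs_def] cycles_def)
  show "\<zero>\<^bsub>homology M f\<^esub> = cls \<zero>\<^bsub>M\<^esub>"
    unfolding cls_zero by (simp add: homology_def)
  show "x \<in> cycles \<Longrightarrow> y \<in> cycles \<Longrightarrow> cls x \<oplus>\<^bsub>homology M f\<^esub> cls y = cls (x \<oplus>\<^bsub>M\<^esub> y)"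
    using cls_add[of x y] by (simp add: homology_def cycles_def)
  show "a \<in> carrier R \<Longrightarrow> x \<in> cycles \<Longrightarrow> a \<odot>\<^bsub>homology M f\<^esub> cls x = cls (a \<odot>\<^bsub>M\<^esub> x)"
    using cls_smult[of a x] by (simp add: homology_def cycles_def cls_def[symmetric])
qed

lemma homology_E:
  assumes "X \<in> carrier (homology M f)"
  obtains x where "X = cls x" "x \<in> cycles"
  using assms unfolding homology_simps(1) by blast

lemma homology_cls_mem: "x \<in> cycles \<Longrightarrow> cls x \<in> carrier (homology M f)"
  unfolding homology_simps(1) by (rule imageI)

lemma module_homology: "Module.module R (homology M f)"
proof -
  note simps = homology_simps(2-4) homology_cls_mem cycles_closed(1-4)
  note mem = cycles_closed(5)
  show ?thesis
  proof (rule moduleI)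
    show "cring R" by (rule R.is_cring)
    show "abelian_group (homology M f)"
    proof (rule abelian_groupI)
      fix X assume "X \<in> carrier (homology M f)"
      then obtain x where x: "X = cls x" "x \<in> cycles" by (rule homology_E)
      have "cls (\<ominus>\<^bsub>M\<^esub> x) \<oplus>\<^bsub>homology M f\<^esub> X = \<zero>\<^bsub>homology M f\<^esub>"
        using x mem[of x] by (simp add: simps M.l_neg)
      then show "\<exists>Y\<in>carrier (homology M f). Y \<oplus>\<^bsub>homology M f\<^esub> X = \<zero>\<^bsub>homology M f\<^esub>"
        using x(2) homology_cls_mem cycles_closed(3) by blast
      show "\<zero>\<^bsub>homology M f\<^esub> \<oplus>\<^bsub>homology M f\<^esub> X = X"
        using x mem[of x] by (simp add: simps)
      fix Y assume "Y \<in> carrier (homology M f)"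
      then obtain y where y: "Y = cls y" "y \<in> cycles" by (rule homology_E)
      show "X \<oplus>\<^bsub>homology M f\<^esub> Y \<in> carrier (homology M f)" using x y by (simp add: simps)
      show "X \<oplus>\<^bsub>homology M f\<^esub> Y = Y \<oplus>\<^bsub>homology M f\<^esub> X"
        using x y M.a_comm[OF mem mem, of x y] by (simp add: simps)
      fix W assume "W \<in> carrier (homology M f)"
      then obtain w where w: "W = cls w" "w \<in> cycles" by (rule homology_E)
      show "X \<oplus>\<^bsub>homology M f\<^esub> Y \<oplus>\<^bsub>homology M f\<^esub> W = X \<oplus>\<^bsub>homology M f\<^esub> (Y \<oplus>\<^bsub>homology M f\<^esub> W)"
        using x y w M.a_assoc[OF mem mem mem, of x y w] by (simp add: simps)
    next
      show "\<zero>\<^bsub>homology M f\<^esub> \<in> carrier (homology M f)" by (simp add: simps)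
    qed
    fix a X assume a: "a \<in> carrier R" and "X \<in> carrier (homology M f)"
    from this(2) obtain x where x: "X = cls x" "x \<in> cycles" by (rule homology_E)
    show "a \<odot>\<^bsub>homology M f\<^esub> X \<in> carrier (homology M f)" using x a by (simp add: simps)
    fix b assume b: "b \<in> carrier R"
    show "(a \<oplus>\<^bsub>R\<^esub> b) \<odot>\<^bsub>homology M f\<^esub> X = a \<odot>\<^bsub>homology M f\<^esub> X \<oplus>\<^bsub>homology M f\<^esub> b \<odot>\<^bsub>homology M f\<^esub> X"
      using x a b smult_l_distr[OF a b mem, of x] by (simp add: simps)
    show "(a \<otimes>\<^bsub>R\<^esub> b) \<odot>\<^bsub>homology M f\<^esub> X = a \<odot>\<^bsub>homology M f\<^esub> (b \<odot>\<^bsub>homology M f\<^esub> X)"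
      using x a b smult_assoc1[OF a b mem, of x] by (simp add: simps)
  next
    fix X assume "X \<in> carrier (homology M f)"
    then obtain x where x: "X = cls x" "x \<in> cycles" by (rule homology_E)
    show "\<one>\<^bsub>R\<^esub> \<odot>\<^bsub>homology M f\<^esub> X = X" using x mem[of x] by (simp add: simps)
  next
    fix a X Y assume a: "a \<in> carrier R" and XY: "X \<in> carrier (homology M f)" "Y \<in> carrier (homology M f)"
    obtain x where x: "X = cls x" "x \<in> cycles" using XY(1) by (rule homology_E)
    obtain y where y: "Y = cls y" "y \<in> cycles" using XY(2) by (rule homology_E)
    show "a \<odot>\<^bsub>homology M f\<^esub> (X \<oplus>\<^bsub>homology M f\<^esub> Y) = a \<odot>\<^bsub>homology M f\<^esub> X \<oplus>\<^bsub>homology M f\<^esub> a \<odot>\<^bsub>homology M f\<^esub> Y"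
      using x y a smult_r_distr[OF a mem mem, of x y] by (simp add: simps)
  qed
qed

lemma induced_map_cls:
  assumes g: "g \<in> linear_maps R M M" and comm: "\<And>x. x \<in> carrier M \<Longrightarrow> f (g x) = g (f x)" and x: "x \<in> carrier M"
  shows "induced_map M f g (cls x) = cls (g x)"
proof -
  note g' = linear_maps_D[OF g]
  have "cls (g y) = cls (g x)" if y: "y \<in> cls x" for y
  proof -
    obtain z where z: "z \<in> carrier M" "y = f z \<oplus>\<^bsub>M\<^esub> x" using y unfolding cls_iff by blast
    then have "g y = f (g z) \<oplus>\<^bsub>M\<^esub> g x" using x f_mem by (simp add: g'(2) comm)
    then have "g y \<in> cls (g x)" unfolding cls_iff using z g'(1) by blast
    then show ?thesis by (rule cls_eq[OF g'(1)[OF x]])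
  qed
  then have "(\<Union>y\<in>cls x. cls (g y)) = (\<Union>y\<in>cls x. cls (g x))"
    by (rule SUP_cong[OF refl])
  then show ?thesis using cls_self[OF x] unfolding induced_map_def cls_def[symmetric] by auto
qed

lemma cycles_commuting:
  assumes g: "g \<in> linear_maps R M M" and comm: "\<And>x. x \<in> carrier M \<Longrightarrow> f (g x) = g (f x)" and x: "x \<in> cycles"
  shows "g x \<in> cycles"
proof -
  have "g \<zero>\<^bsub>M\<^esub> = \<zero>\<^bsub>M\<^esub>" by (rule linear_maps_zero[OF g module_axioms module_axioms])
  then show ?thesis using x comm[of x] linear_maps_D(1)[OF g] by (simp add: cycles_def)
qed

lemma induced_map_linear:
  assumes g: "g \<in> linear_maps R M M" and comm: "\<And>x. x \<in> carrier M \<Longrightarrow> f (g x) = g (f x)"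
  shows "induced_map M f g \<in> linear_maps R (homology M f) (homology M f)"
proof -
  note g' = linear_maps_D[OF g]
  have cyc: "g x \<in> cycles" if "x \<in> cycles" for x
    by (rule cycles_commuting[OF g _ that]) (rule comm)
  have ind: "induced_map M f g (cls x) = cls (g x)" if "x \<in> cycles" for x
    by (rule induced_map_cls[OF g _ cycles_closed(5)[OF that]]) (rule comm)
  show ?thesis
    unfolding linear_maps_def
  proof (intro CollectI conjI ballI funcsetI)
    fix X assume "X \<in> carrier (homology M f)"
    then obtain x where x: "X = cls x" "x \<in> cycles" by (rule homology_E)
    show "induced_map M f g X \<in> carrier (homology M f)"
      unfolding x(1) ind[OF x(2)] by (intro homology_cls_mem cyc x)
    fix Y assume "Y \<in> carrier (homology M f)"
    then obtain y where y: "Y = cls y" "y \<in> cycles" by (rule homology_E)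
    show "induced_map M f g (X \<oplus>\<^bsub>homology M f\<^esub> Y) = induced_map M f g X \<oplus>\<^bsub>homology M f\<^esub> induced_map M f g Y"
      using x y g'(2)[OF cycles_closed(5) cycles_closed(5), of x y]
      by (simp add: homology_simps(3) ind cyc cycles_closed(2))
  next
    fix a X assume a: "a \<in> carrier R" and "X \<in> carrier (homology M f)"
    from this(2) obtain x where x: "X = cls x" "x \<in> cycles" by (rule homology_E)
    show "induced_map M f g (a \<odot>\<^bsub>homology M f\<^esub> X) = a \<odot>\<^bsub>homology M f\<^esub> induced_map M f g X"
      using x a g'(3)[OF a cycles_closed(5), of x]
      by (simp add: homology_simps(4) ind cyc cycles_closed(4))
  qed
qed

end

section \<open>Projective dimension of a nonzero module with nilpotent variables\<close>

context quotient_presentation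
begin

text \<open>For each variable in turn, multiply by its highest power that keeps the element outside
  \<open>K\<close>. The variables treated before still send it into \<open>K\<close>, since
  multiplications commute.\<close>

lemma socle_exists:
  assumes x: "x \<in> Z" "x \<notin> K" and nil: "\<And>k x. k \<in> {1..m} \<Longrightarrow> x \<in> Z \<Longrightarrow> fscale (Var k ^ N) x \<in> K"
  shows "\<exists>s\<in>carrier M. s \<noteq> \<zero>\<^bsub>M\<^esub> \<and> (\<forall>k\<in>{1..m}. Var k \<odot>\<^bsub>M\<^esub> s = \<zero>\<^bsub>M\<^esub>)"
proof -
  have "\<exists>y\<in>Z. y \<notin> K \<and> (\<forall>k\<in>{1..j}. fscale (Var k) y \<in> K)" if "j \<le> m" for j
    using that
  proof (induction j)
    case 0
    then show ?case using x by auto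
  next
    case (Suc j)
    then obtain y where y: "y \<in> Z" "y \<notin> K" "\<forall>k\<in>{1..j}. fscale (Var k) y \<in> K" by auto
    let ?X = "Var (Suc j) :: nat mpoly"
    have X: "indets (?X ^ i) \<subseteq> {1..m}" for i using Suc.prems by (intro indets_power) auto
    \<comment> \<open>Exists by nilpotency and is positive because \<open>y \<notin> K\<close>, so
      the multiplier can be the power with exponent one less.\<close>
    define i where "i = (LEAST i. fscale (?X ^ i) y \<in> K)"
    have "fscale (?X ^ N) y \<in> K" using nil[of "Suc j" y] y(1) Suc.prems by auto
    then have iK: "fscale (?X ^ i) y \<in> K" unfolding i_def by (rule LeastI)
    have "i \<noteq> 0"
    proof
      assume "i = 0"
      then have "y \<in> K" using iK by (simp add: fscale_simps)
      then show False using y(2) by contradiction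
    qed
    then obtain i' where i': "i = Suc i'" by (cases i) auto
    let ?y = "fscale (?X ^ i') y"
    have "?y \<notin> K" unfolding i_def using not_less_Least[of i' "\<lambda>i. fscale (?X ^ i) y \<in> K"] i'
      by (simp add: i_def)
    moreover have "?y \<in> Z" by (intro Z_scale X y)
    moreover have "fscale (Var k) ?y \<in> K" if "k \<in> {1..Suc j}" for k
    proof (cases "k = Suc j")
      case True
      then show ?thesis using iK by (simp add: i' fscale_simps)
    next
      case False
      then have "fscale (Var k) y \<in> K" using that y(3) by auto
      then have "fscale (?X ^ i') (fscale (Var k) y) \<in> K" by (rule K_scale[OF X])
      then show ?thesis by (simp add: fscale_simps mult.commute)
    qed
    ultimately show ?case by blast
  qed
  then obtain y where y: "y \<in> Z" "y \<notin> K" "\<forall>k\<in>{1..m}. fscale (Var k) y \<in> K" by blast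
  have "Var k \<odot>\<^bsub>M\<^esub> \<pi> y = \<zero>\<^bsub>M\<^esub>" if "k \<in> {1..m}" for k
    using y that pi_scale[of "Var k" y] by (simp add: K_def)
  moreover have "\<pi> y \<noteq> \<zero>\<^bsub>M\<^esub>" using y by (simp add: K_def)
  ultimately show ?thesis using pi_mem[OF y(1)] by blast
qed

theorem projective_dimension_nilpotent:
  assumes "x \<in> Z" "x \<notin> K" "\<And>k x. k \<in> {1..m} \<Longrightarrow> x \<in> Z \<Longrightarrow> fscale (Var k ^ N) x \<in> K"
  shows "projective_dimension (poly_ring {1..m}) M = enat m"
proof (rule antisym)
  show "projective_dimension (poly_ring {1..m}) M \<le> enat m"
    unfolding projective_dimension_def using hilbert_syzygy by (intro Inf_lower) blast
  obtain s where s: "s \<in> carrier M" "s \<noteq> \<zero>\<^bsub>M\<^esub>" "\<And>k. k \<in> {1..m} \<Longrightarrow> Var k \<odot>\<^bsub>M\<^esub> s = \<zero>\<^bsub>M\<^esub>"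
    using socle_exists[OF assms] by blast
  show "enat m \<le> projective_dimension (poly_ring {1..m}) M"
    unfolding projective_dimension_def
  proof (rule Inf_greatest)
    fix e assume "e \<in> {enat k |k. has_projective_resolution (poly_ring {1..m}) M k}"
    then obtain l where "e = enat l" "has_projective_resolution (poly_ring {1..m}) M l" by blast
    then show "enat m \<le> e" using projective_resolution_length[OF module_M s] by simp
  qed
qed

end

section \<open>The double homology as a quotient of coefficient vectors\<close>

context total_complex
begin

abbreviation "S \<equiv> poly_ring {1..M} :: nat mpoly ring"
abbreviation "M0 \<equiv> total_module {1..M} C"

lemma carrier_M0: "carrier M0 = E"
proof (rule Set.set_eqI)
  fix x :: "'b \<Rightarrow> nat mpoly"
  have fin: "finite {b. x b \<noteq> 0}" if "\<forall>b. b \<notin> B \<longrightarrow> x b = 0"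
    by (rule finite_subset[OF _ okD(1)]) (use that in auto)
  have ind: "(\<forall>b\<in>B. indets (x b) \<subseteq> {1..M}) \<longleftrightarrow> (\<forall>b. indets (x b) \<subseteq> {1..M})" if "\<forall>b. b \<notin> B \<longrightarrow> x b = 0"
    using that by (metis empty_subsetI indets_0)
  have "x \<in> carrier M0 \<longleftrightarrow> (\<forall>b\<in>B. indets (x b) \<subseteq> {1..M}) \<and> (\<forall>b. b \<notin> B \<longrightarrow> x b = 0) \<and> finite {b. x b \<noteq> 0}"
    by (simp add: total_module_def free_module_def poly_ring_def)
  then show "x \<in> carrier M0 \<longleftrightarrow> x \<in> E" unfolding coeff_vectors_def using fin ind by blast
qed

lemma M0_simps: "x \<oplus>\<^bsub>M0\<^esub> y = x + y" "\<zero>\<^bsub>M0\<^esub> = 0" "p \<odot>\<^bsub>M0\<^esub> x = fscale p x"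
  by (simp_all add: total_module_def free_module_def poly_ring_def fscale_def fun_eq_iff fun_apply)

lemma module_M0: "Module.module S M0"
  unfolding total_module_def by (rule module_free_module[OF cring_poly_ring])

lemma apply_linear: "(\<And>x. x \<in> E \<Longrightarrow> apply_matrix B a x \<in> E) \<Longrightarrow> apply_matrix B a \<in> linear_maps S M0 M0"
  by (simp add: linear_maps_def carrier_M0 M0_simps apply_matrix_add apply_matrix_fscale)

sublocale D: differential_module S M0 d
  by (intro differential_module.intro module_M0 differential_module_axioms.intro apply_linear d_mem)
    (simp_all add: M0_simps d_d)

lemma v_linear: "v \<in> linear_maps S M0 M0"
  by (intro apply_linear v_mem)

abbreviation "H1 \<equiv> homology M0 d"
abbreviation "g \<equiv> induced_map M0 d v"

lemma v_cycles: "x \<in> D.cycles \<Longrightarrow> v x \<in> D.cycles"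
  by (rule D.cycles_commuting[OF v_linear]) (rule d_v)

lemma g_cls: "x \<in> D.cycles \<Longrightarrow> g (D.cls x) = D.cls (v x)"
  by (rule D.induced_map_cls[OF v_linear]) (rule d_v, rule D.cycles_closed(5))

sublocale G: differential_module S H1 g
proof (intro differential_module.intro differential_module_axioms.intro)
  show "Module.module S H1" by (rule D.module_homology)
  show "g \<in> linear_maps S H1 H1" by (rule D.induced_map_linear[OF v_linear]) (rule d_v)
  fix X assume "X \<in> carrier H1"
  then obtain x where x: "X = D.cls x" "x \<in> D.cycles" by (rule D.homology_E)
  show "g (g X) = \<zero>\<^bsub>H1\<^esub>"
    unfolding x(1) g_cls[OF x(2)] g_cls[OF v_cycles[OF x(2)]] D.homology_simps(2) v_v M0_simps ..
qed

abbreviation "H \<equiv> double_homology {1..M} C"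

lemma H_eq: "H = homology H1 g"
  by (simp add: double_homology_def Let_def)

text \<open>Representatives of the cycles of the induced map. They replace cosets of cosets by plain
  functions, as a quotient presentation requires.\<close>

definition Z where "Z = {x \<in> E. d x = 0 \<and> (\<exists>y\<in>E. v x = d y)}"

definition pi where "pi x = G.cls (D.cls x)"

lemma cycles_D: "D.cycles = {x \<in> E. d x = 0}"
  by (simp add: D.cycles_def carrier_M0 M0_simps)

lemma cls_cycles_iff:
  assumes "x \<in> D.cycles"
  shows "D.cls x \<in> G.cycles \<longleftrightarrow> (\<exists>y\<in>E. v x = d y)"
proof -
  have "D.cls x \<in> G.cycles \<longleftrightarrow> D.cls (v x) = D.cls \<zero>\<^bsub>M0\<^esub>"
    using D.homology_cls_mem[OF assms] by (simp add: G.cycles_def g_cls[OF assms] D.homology_simps(2))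
  also have "\<dots> \<longleftrightarrow> v x \<in> d ` carrier M0"
    by (rule D.cls_zero_iff[OF D.cycles_closed(5)[OF v_cycles[OF assms]]])
  finally show ?thesis by (auto simp: carrier_M0)
qed

lemma Z_iff: "x \<in> Z \<longleftrightarrow> x \<in> D.cycles \<and> D.cls x \<in> G.cycles"
  using cls_cycles_iff[of x] by (auto simp: Z_def cycles_D)

text \<open>Both passages to homology are unfolded at once; the right side is exactly what
  \<open>not_acyclic\<close> denies of its vector.\<close>

lemma pi_zero_iff:
  assumes "x \<in> Z"
  shows "pi x = \<zero>\<^bsub>H\<^esub> \<longleftrightarrow> (\<exists>y\<in>E. \<exists>z\<in>E. d y = 0 \<and> x = v y + d z)"
proof -
  have x: "x \<in> D.cycles" "D.cls x \<in> G.cycles" using assms Z_iff by auto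
  have "pi x = \<zero>\<^bsub>H\<^esub> \<longleftrightarrow> D.cls x \<in> g ` carrier H1"
    unfolding H_eq pi_def G.homology_simps(2) by (rule G.cls_zero_iff[OF G.cycles_closed(5)[OF x(2)]])
  also have "\<dots> \<longleftrightarrow> (\<exists>y\<in>D.cycles. D.cls x = D.cls (v y))"
    unfolding D.homology_simps(1) image_image image_iff using g_cls by auto
  also have "\<dots> \<longleftrightarrow> (\<exists>y\<in>D.cycles. \<exists>z\<in>E. x = d z + v y)"
  proof (rule bex_cong[OF refl])
    fix y assume "y \<in> D.cycles"
    then show "D.cls x = D.cls (v y) \<longleftrightarrow> (\<exists>z\<in>E. x = d z + v y)"
      using D.cls_eq_iff[OF D.cycles_closed(5)[OF v_cycles] D.cycles_closed(5)[OF x(1)], of y]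
      unfolding carrier_M0 M0_simps by blast
  qed
  also have "\<dots> \<longleftrightarrow> (\<exists>y\<in>E. \<exists>z\<in>E. d y = 0 \<and> x = v y + d z)"
    unfolding cycles_D by (auto simp: add.commute)
  finally show ?thesis .
qed

lemma quotient_presentation:
  assumes "m \<le> M"
  shows "quotient_presentation m H Z pi"
proof -
  have sub: "{1..m} \<subseteq> {1..M}" using assms by auto
  have S: "p \<in> carrier S" if "indets p \<subseteq> {1..m}" for p
    using that sub by (auto simp: poly_ring_def)
  note Dc = D.cycles_closed[unfolded M0_simps] and Dh = D.homology_simps[unfolded M0_simps]
  have md: "Module.module (poly_ring {1..m}) H"
    unfolding H_eq by (rule module_poly_ring_subset[OF G.module_homology sub])
  have zero: "0 \<in> Z" unfolding Z_iff using Dc(1) G.cycles_closed(1) Dh(2) by simp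
  have add: "x + y \<in> Z" "pi (x + y) = pi x \<oplus>\<^bsub>H\<^esub> pi y" if "x \<in> Z" "y \<in> Z" for x y
  proof -
    have xy: "x \<in> D.cycles" "D.cls x \<in> G.cycles" "y \<in> D.cycles" "D.cls y \<in> G.cycles"
      using that Z_iff by auto
    have "D.cls x \<oplus>\<^bsub>H1\<^esub> D.cls y = D.cls (x + y)" by (rule Dh(3)[OF xy(1,3)])
    then show "x + y \<in> Z" "pi (x + y) = pi x \<oplus>\<^bsub>H\<^esub> pi y"
      unfolding Z_iff pi_def H_eq using Dc(2)[OF xy(1,3)] G.cycles_closed(2)[OF xy(2,4)]
        G.homology_simps(3)[OF xy(2,4)] by simp_all
  qed
  have scale: "fscale p x \<in> Z" "pi (fscale p x) = p \<odot>\<^bsub>H\<^esub> pi x" if "indets p \<subseteq> {1..m}" "x \<in> Z" for p x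
  proof -
    have x: "x \<in> D.cycles" "D.cls x \<in> G.cycles" using that Z_iff by auto
    note p = S[OF that(1)]
    have "p \<odot>\<^bsub>H1\<^esub> D.cls x = D.cls (fscale p x)" by (rule Dh(4)[OF p x(1)])
    then show "fscale p x \<in> Z" "pi (fscale p x) = p \<odot>\<^bsub>H\<^esub> pi x"
      unfolding Z_iff pi_def H_eq using Dc(4)[OF p x(1)] G.cycles_closed(4)[OF p x(2)]
        G.homology_simps(4)[OF p x(2)] by simp_all
  qed
  have onto: "pi ` Z = carrier H"
  proof
    show "pi ` Z \<subseteq> carrier H"
      unfolding H_eq using G.homology_cls_mem by (auto simp: pi_def Z_iff)
    show "carrier H \<subseteq> pi ` Z"
    proof
      fix X assume "X \<in> carrier H"
      then obtain Y where Y: "X = G.cls Y" "Y \<in> G.cycles" unfolding H_eq by (rule G.homology_E)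
      have "Y \<in> carrier H1" by (rule G.cycles_closed(5)[OF Y(2)])
      then obtain x where x: "Y = D.cls x" "x \<in> D.cycles" by (rule D.homology_E)
      then have "x \<in> Z" using Y(2) by (simp add: Z_iff)
      moreover have "X = pi x" by (simp add: pi_def Y(1) x(1))
      ultimately show "X \<in> pi ` Z" by blast
    qed
  qed
  show ?thesis
    by (rule quotient_presentation.intro[OF md zero add(1) scale(1) onto add(2) scale(2)])
qed

theorem projective_dimension_double_homology:
  assumes m: "m \<le> M" and iso: "isolated C b"
    and nil: "\<And>k. k \<in> {1..m} \<Longrightarrow> nullhomotopic (poly_carrier {1..M}) C (Var k ^ N)"
  shows "projective_dimension (poly_ring {1..m}) H = enat m"
proof -
  interpret Q: quotient_presentation m H Z pi by (rule quotient_presentation[OF m])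
  obtain x where x: "x \<in> E" "d x = 0" "\<exists>y\<in>E. v x = d y" "\<not> (\<exists>y\<in>E. \<exists>z\<in>E. d y = 0 \<and> x = v y + d z)"
    using not_acyclic[OF iso] by blast
  have xZ: "x \<in> Z" using x by (simp add: Z_def)
  have xK: "x \<notin> Q.K" using x(4) pi_zero_iff[OF xZ] by (simp add: Q.K_def)
  have "fscale (Var k ^ N) z \<in> Q.K" if kz: "k \<in> {1..m}" "z \<in> Z" for k z
  proof -
    have "z \<in> E" "d z = 0" using kz(2) by (auto simp: Z_def)
    then obtain w where w: "w \<in> E" "fscale (Var k ^ N) z = d w"
      using homotopy[OF nil[OF kz(1)]] by blast
    have Zz: "fscale (Var k ^ N) z \<in> Z"
      using kz by (intro Q.Z_scale indets_power) auto
    \<comment> \<open>The class vanishes already in the homology of \<open>d\<close>, so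
      \<open>y = 0\<close> serves.\<close>
    moreover have "\<exists>y\<in>E. \<exists>z'\<in>E. d y = 0 \<and> fscale (Var k ^ N) z = v y + d z'"
      using w coeff_vectors_closed(1) by (intro bexI[of _ 0] bexI[of _ w]) (auto simp: apply_matrix_0)
    ultimately show ?thesis using pi_zero_iff[OF Zz] by (simp add: Q.K_def)
  qed
  then show ?thesis by (rule Q.projective_dimension_nilpotent[OF xZ xK])
qed

end

theorem lemma1p14:
  fixes n m N :: nat
    and B :: braid
    and K :: "nat \<Rightarrow> point set"
    and \<nu> :: "point set \<Rightarrow> nat"
    and A F :: "nat \<Rightarrow> crossing_var mpoly"
  assumes "is_braid n B"
    and "bij_betw K {1..m} (components n B)"
    and "bij_betw \<nu> (edges n B) {1..card (edges n B)}"
    and "\<forall>e\<in>edges n B. \<nu> e \<le> m \<longrightarrow> e \<subseteq> K (\<nu> e)"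
    and "N \<ge> 1"
    and "\<forall>t<length B. admissible_choice N (card (edges n B)) (A t) (F t)"
  shows "projective_dimension (poly_ring {1..m}) (KR_homology N n B \<nu> A F) = enat m"
proof -
  note KR = KR_complex_properties[OF assms(1,3,5,6)]
  interpret total_complex "KR_complex N n B \<nu> A F" "card (edges n B)"
    by unfold_locales (fact KR)+
  have m: "m \<le> card (edges n B)"
    using bij_betw_same_card[OF assms(2)] card_components_le[of n B] by simp
  obtain b where "isolated (KR_complex N n B \<nu> A F) b" using KR(4) by blast
  then show ?thesis
    unfolding KR_homology_def using m KR(3)
    by (intro projective_dimension_double_homology[of m b N]) auto
qed

end
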